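(* Suppose that $\mathcal F$ is a $C_0$-universal RKHS of functions on $\mathcal X$ and that $\mathbb E\big[\max_{\|f\|\le1}\{f(X_1)-f(X_2)\}\big]<\infty$. Then, under either the PSOD or the MSOD, for $k\ne k'$, $\hat\tau_{kk'}-\mathrm{SATE}_{kk'}\to0$ in probability (as $n\to\infty$).
   Context: Setup. There are $m\ge2$ treatments ($m$ fixed); for each $n=mp$ ($p\to\infty$) there are $n$ subjects, the first $n$ terms of an i.i.d. sequence of tuples $(X_i,Y_{i1},\dots,Y_{im})$, where $X_i\in\mathcal X$ are baseline covariates and $Y_{ik}\in\mathbb R$ is the potential outcome of subject $i$ under treatment $k$, with finite second moment. $X=(X_1,\dots,X_n)$, $Y=(Y_{ik})$; the conditional expectations $f_k(x)=\mathbb E[Y_{ik}\mid X_i=x]$ are not assumed to be in $\mathcal F$. $W\in\{1,\dots,m\}^n$ is the random assignment, drawn according to the design given $X$, independently of $Y$ given $X$. $\hat\tau_{kk'}=\frac1p\sum_{i:W_i=k}Y_{ik}-\frac1p\sum_{i:W_i=k'}Y_{ik'}$ and $\mathrm{SATE}_{kk'}=\frac1n\sum_{i=1}^nY_{ik}-\frac1n\sum_{i=1}^nY_{ik'}$. $\mathcal W\subset\{1,\dots,m\}^n$ is the set of assignments with exactly $p$ subjects in each treatment. $\Delta$ is the set of probability distributions $\sigma$ on $\mathcal W$ with $\sigma((k_1,\dots,k_n))=\sigma((\pi(k_1),\dots,\pi(k_n)))$ for every permutation $\pi$ of $\{1,\dots,m\}$. For $f:\mathcal X\to\mathbb R$,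 $B_{kl}(W,f)=\frac1p\sum_{i:W_i=k}f(X_i)-\frac1p\sum_{i:W_i=l}f(X_i)$. $C_0$-universal: for $\mathcal X$ Hausdorff, an RKHS $\mathcal F$ of functions $\mathcal X\to\mathbb R$ is $C_0$-universal if for any continuous $g:\mathcal X\to\mathbb R$ with compact support and any $\eta>0$ there exists $f\in\mathcal F$ with $\sup_{x\in\mathcal X}|f(x)-g(x)|\le\eta$. $\|\cdot\|$ is the norm of $\mathcal F$, considered modulo constants: $\|f\|$ means $\min_{c\in\mathbb R}\|f+c\|$, with $\|f\|=\infty$ for functions not in $\mathcal F$. Given $X$: $M_{\mathrm P}^2(W)=\max_{\|f\|\le1}\max_{k\ne k'}B_{kk'}^2(W,f)$ for $W\in\mathcal W$; the pure strategy optimal design (PSOD) draws $W$ uniformly at random from $\arg\min_{W\in\mathcal W}M_{\mathrm P}^2(W)$. $M_{\mathrm M}^2(\sigma)=\max_{\|f\|\le1}\max_{k\ne k'}\sum_{W\in\mathcal W}\sigma(W)B_{kk'}^2(W,f)$ for $\sigma\in\Delta$; the mixed strategy optimal design (MSOD) draws $W$ from some $\sigma\in\arg\min_{\sigma\in\Delta}M_{\mathrm M}^2(\sigma)$.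
   Formalization: The covariate space is assumed locally compact Hausdorff, the law of X_1 Radon, and max_{‖f‖≤1}{f(x)−f(x')} jointly measurable; for merely Hausdorff spaces the claim fails (on ℓ² the zero space is C_0-universal). *)

theory Defs
  imports "HOL-Probability.Probability"
begin

text \<open>
  Treatments are numbered \<open>0, ..., m - 1\<close> and subjects \<open>0, ..., m * p - 1\<close>.  An assignment is an
  extensional function from subjects to treatments, a covariate vector is a function
  \<open>x :: nat \<Rightarrow> 'x\<close> of which only the values on subjects matter.
\<close>

section \<open>Reproducing kernel Hilbert spaces of functions\<close>

locale rkhs =
  fixes F :: "('x \<Rightarrow> real) set"
    and ip :: "('x \<Rightarrow> real) \<Rightarrow> ('x \<Rightarrow> real) \<Rightarrow> real"
  assumes zero_mem: "(\<lambda>x. 0) \<in> F"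
    and add_mem: "f \<in> F \<Longrightarrow> g \<in> F \<Longrightarrow> (\<lambda>x. f x + g x) \<in> F"
    and scale_mem: "f \<in> F \<Longrightarrow> (\<lambda>x. c * f x) \<in> F"
    and ip_commute: "f \<in> F \<Longrightarrow> g \<in> F \<Longrightarrow> ip f g = ip g f"
    and ip_add: "f \<in> F \<Longrightarrow> g \<in> F \<Longrightarrow> h \<in> F \<Longrightarrow> ip (\<lambda>x. f x + g x) h = ip f h + ip g h"
    and ip_scale: "f \<in> F \<Longrightarrow> g \<in> F \<Longrightarrow> ip (\<lambda>x. c * f x) g = c * ip f g"
    and ip_pos: "f \<in> F \<Longrightarrow> f \<noteq> (\<lambda>x. 0) \<Longrightarrow> 0 < ip f f"
    and complete:
      "(\<And>j. s j \<in> F) \<Longrightarrow>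
       (\<And>e. 0 < e \<Longrightarrow> \<exists>N. \<forall>i\<ge>N. \<forall>j\<ge>N.
          sqrt (ip (\<lambda>x. s i x - s j x) (\<lambda>x. s i x - s j x)) < e) \<Longrightarrow>
       \<exists>f\<in>F. (\<lambda>j. sqrt (ip (\<lambda>x. s j x - f x) (\<lambda>x. s j x - f x))) \<longlonglongrightarrow> 0"
    and reproducing: "\<exists>K. \<forall>x. K x \<in> F \<and> (\<forall>f\<in>F. f x = ip f (K x))"

definition C0_universal :: "('x::t2_space \<Rightarrow> real) set \<Rightarrow> bool" where
  "C0_universal F \<longleftrightarrow>
     (\<forall>g. continuous_on UNIV g \<longrightarrow> compact (closure {x. g x \<noteq> 0}) \<longrightarrow>
        (\<forall>\<eta>>0. \<exists>f\<in>F. \<forall>x. \<bar>f x - g x\<bar> \<le> \<eta>))"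

definition rkhs_norm ::
  "('x \<Rightarrow> real) set \<Rightarrow> (('x \<Rightarrow> real) \<Rightarrow> ('x \<Rightarrow> real) \<Rightarrow> real) \<Rightarrow> ('x \<Rightarrow> real) \<Rightarrow> ennreal" where
  "rkhs_norm F ip f = (if f \<in> F then ennreal (sqrt (ip f f)) else \<infinity>)"

text \<open>The norm modulo constants.  In an RKHS the infimum is attained, and so are the suprema
  below, which range over its unit ball.\<close>

definition quot_norm ::
  "('x \<Rightarrow> real) set \<Rightarrow> (('x \<Rightarrow> real) \<Rightarrow> ('x \<Rightarrow> real) \<Rightarrow> real) \<Rightarrow> ('x \<Rightarrow> real) \<Rightarrow> ennreal" where
  "quot_norm F ip f = (INF c::real. rkhs_norm F ip (\<lambda>x. f x + c))"

definition unit_ball ::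
  "('x \<Rightarrow> real) set \<Rightarrow> (('x \<Rightarrow> real) \<Rightarrow> ('x \<Rightarrow> real) \<Rightarrow> real) \<Rightarrow> ('x \<Rightarrow> real) set" where
  "unit_ball F ip = {f. quot_norm F ip f \<le> 1}"

section \<open>Assignments, imbalance and optimal designs\<close>

definition assignments :: "nat \<Rightarrow> nat \<Rightarrow> (nat \<Rightarrow> nat) set" where
  "assignments m p =
     {w \<in> {..<m * p} \<rightarrow>\<^sub>E {..<m}. \<forall>k<m. card {i \<in> {..<m * p}. w i = k} = p}"

definition group_mean :: "nat \<Rightarrow> nat \<Rightarrow> (nat \<Rightarrow> nat) \<Rightarrow> nat \<Rightarrow> (nat \<Rightarrow> real) \<Rightarrow> real" where
  "group_mean m p w k v = (1 / real p) * (\<Sum>i | i < m * p \<and> w i = k. v i)"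

definition imbalance ::
  "nat \<Rightarrow> nat \<Rightarrow> (nat \<Rightarrow> 'x) \<Rightarrow> (nat \<Rightarrow> nat) \<Rightarrow> nat \<Rightarrow> nat \<Rightarrow> ('x \<Rightarrow> real) \<Rightarrow> real" where
  "imbalance m p x w k l f =
     group_mean m p w k (\<lambda>i. f (x i)) - group_mean m p w l (\<lambda>i. f (x i))"

definition treatment_pairs :: "nat \<Rightarrow> (nat \<times> nat) set" where
  "treatment_pairs m = {(k, l). k < m \<and> l < m \<and> k \<noteq> l}"

definition MP2 ::
  "('x \<Rightarrow> real) set \<Rightarrow> (('x \<Rightarrow> real) \<Rightarrow> ('x \<Rightarrow> real) \<Rightarrow> real) \<Rightarrow>
   nat \<Rightarrow> nat \<Rightarrow> (nat \<Rightarrow> 'x) \<Rightarrow> (nat \<Rightarrow> nat) \<Rightarrow> real" where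
  "MP2 F ip m p x w =
     (SUP f\<in>unit_ball F ip. MAX (k, l)\<in>treatment_pairs m. (imbalance m p x w k l f)\<^sup>2)"

definition PSOD ::
  "('x \<Rightarrow> real) set \<Rightarrow> (('x \<Rightarrow> real) \<Rightarrow> ('x \<Rightarrow> real) \<Rightarrow> real) \<Rightarrow>
   nat \<Rightarrow> nat \<Rightarrow> (nat \<Rightarrow> 'x) \<Rightarrow> (nat \<Rightarrow> nat) pmf" where
  "PSOD F ip m p x =
     pmf_of_set {w. is_arg_min (MP2 F ip m p x) (\<lambda>w. w \<in> assignments m p) w}"

definition mixed_strategies :: "nat \<Rightarrow> nat \<Rightarrow> (nat \<Rightarrow> nat) pmf set" where
  "mixed_strategies m p =
     {\<sigma>. set_pmf \<sigma> \<subseteq> assignments m p \<and>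
         (\<forall>\<pi>. \<pi> permutes {..<m} \<longrightarrow>
            (\<forall>w\<in>assignments m p. pmf \<sigma> w = pmf \<sigma> (\<lambda>i\<in>{..<m * p}. \<pi> (w i))))}"

definition MM2 ::
  "('x \<Rightarrow> real) set \<Rightarrow> (('x \<Rightarrow> real) \<Rightarrow> ('x \<Rightarrow> real) \<Rightarrow> real) \<Rightarrow>
   nat \<Rightarrow> nat \<Rightarrow> (nat \<Rightarrow> 'x) \<Rightarrow> (nat \<Rightarrow> nat) pmf \<Rightarrow> real" where
  "MM2 F ip m p x \<sigma> =
     (SUP f\<in>unit_ball F ip. MAX (k, l)\<in>treatment_pairs m.
        \<Sum>w\<in>assignments m p. pmf \<sigma> w * (imbalance m p x w k l f)\<^sup>2)"

text \<open>A minimiser of \<open>MM2\<close> need not be unique, so an MSOD is any selection of minimisers.\<close>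

definition is_MSOD ::
  "('x \<Rightarrow> real) set \<Rightarrow> (('x \<Rightarrow> real) \<Rightarrow> ('x \<Rightarrow> real) \<Rightarrow> real) \<Rightarrow>
   nat \<Rightarrow> nat \<Rightarrow> ((nat \<Rightarrow> 'x) \<Rightarrow> (nat \<Rightarrow> nat) pmf) \<Rightarrow> bool" where
  "is_MSOD F ip m p D \<longleftrightarrow>
     (\<forall>x. is_arg_min (MM2 F ip m p x) (\<lambda>\<sigma>. \<sigma> \<in> mixed_strategies m p) (D x))"

section \<open>Random assignment and estimation\<close>

definition covariates :: "nat \<Rightarrow> (nat \<Rightarrow> 'a \<Rightarrow> 'x) \<Rightarrow> 'a \<Rightarrow> nat \<Rightarrow> 'x" where
  "covariates n X \<omega> = (\<lambda>i\<in>{..<n}. X i \<omega>)"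

definition outcomes ::
  "nat \<Rightarrow> nat \<Rightarrow> (nat \<Rightarrow> nat \<Rightarrow> 'a \<Rightarrow> real) \<Rightarrow> 'a \<Rightarrow> nat \<times> nat \<Rightarrow> real" where
  "outcomes n m Y \<omega> = (\<lambda>(i, k)\<in>{..<n} \<times> {..<m}. Y i k \<omega>)"

definition sigma_covariates ::
  "'a measure \<Rightarrow> nat \<Rightarrow> (nat \<Rightarrow> 'a \<Rightarrow> 'x::topological_space) \<Rightarrow> 'a measure" where
  "sigma_covariates M n X =
     vimage_algebra (space M) (covariates n X) (\<Pi>\<^sub>M i\<in>{..<n}. borel)"

definition cond_prob_given :: "'a measure \<Rightarrow> 'a measure \<Rightarrow> 'a set \<Rightarrow> 'a \<Rightarrow> real" where
  "cond_prob_given M G A = real_cond_exp M G (indicator A)"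

text \<open>The almost sure equality makes \<open>D\<close>, evaluated at the covariates, measurable up to a null
  set, so that no measurability of \<open>D\<close> has to be required.\<close>

definition drawn_from ::
  "'a measure \<Rightarrow> nat \<Rightarrow> (nat \<Rightarrow> 'a \<Rightarrow> 'x::topological_space) \<Rightarrow> ('a \<Rightarrow> nat \<Rightarrow> nat) \<Rightarrow>
   ((nat \<Rightarrow> 'x) \<Rightarrow> (nat \<Rightarrow> nat) pmf) \<Rightarrow> bool" where
  "drawn_from M n X W D \<longleftrightarrow>
     (\<forall>w. AE \<omega> in M.
        cond_prob_given M (sigma_covariates M n X) {\<omega> \<in> space M. W \<omega> = w} \<omega> =
        pmf (D (covariates n X \<omega>)) w)"

definition cond_indep ::
  "'a measure \<Rightarrow> 'a measure \<Rightarrow> 'b measure \<Rightarrow> ('a \<Rightarrow> 'b) \<Rightarrow> 'c measure \<Rightarrow> ('a \<Rightarrow> 'c) \<Rightarrow> bool" where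
  "cond_indep M G N U L V \<longleftrightarrow>
     (\<forall>A\<in>sets N. \<forall>B\<in>sets L. AE \<omega> in M.
        cond_prob_given M G {\<omega> \<in> space M. U \<omega> \<in> A \<and> V \<omega> \<in> B} \<omega> =
        cond_prob_given M G {\<omega> \<in> space M. U \<omega> \<in> A} \<omega> *
        cond_prob_given M G {\<omega> \<in> space M. V \<omega> \<in> B} \<omega>)"

definition tau_hat ::
  "nat \<Rightarrow> nat \<Rightarrow> (nat \<Rightarrow> nat) \<Rightarrow> (nat \<Rightarrow> nat \<Rightarrow> real) \<Rightarrow> nat \<Rightarrow> nat \<Rightarrow> real" where
  "tau_hat m p w y k l = group_mean m p w k (\<lambda>i. y i k) - group_mean m p w l (\<lambda>i. y i l)"

definition SATE :: "nat \<Rightarrow> (nat \<Rightarrow> nat \<Rightarrow> real) \<Rightarrow> nat \<Rightarrow> nat \<Rightarrow> real" where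
  "SATE n y k l = (1 / real n) * (\<Sum>i<n. y i k) - (1 / real n) * (\<Sum>i<n. y i l)"

definition tendsto_zero_in_prob :: "'a measure \<Rightarrow> (nat \<Rightarrow> 'a \<Rightarrow> real) \<Rightarrow> bool" where
  "tendsto_zero_in_prob M Z \<longleftrightarrow>
     (\<forall>\<epsilon>>0. (\<lambda>p. measure M {\<omega> \<in> space M. \<bar>Z p \<omega>\<bar> > \<epsilon>}) \<longlonglongrightarrow> 0)"

text \<open>Inner regularity of the Borel measure \<open>P\<close>; a finite Borel measure on a Hausdorff space is
  Radon iff this holds.  On a locally compact Hausdorff space it makes the compactly supported
  continuous functions dense in \<open>L\<^sup>2(P)\<close>; on a general Hausdorff space the only such function may be
  \<open>0\<close>, and then even the trivial RKHS is \<open>C\<^sub>0\<close>-universal.\<close>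

definition inner_regular :: "'x::topological_space measure \<Rightarrow> bool" where
  "inner_regular P \<longleftrightarrow>
     (\<forall>A\<in>sets borel. emeasure P A = (SUP K\<in>{K. K \<subseteq> A \<and> compact K}. emeasure P K))"

end

theory Submission
  imports Defs
begin

text \<open>
  Fix a treatment \<open>k\<close>.  It suffices that the mean outcome of group \<open>k\<close> minus the mean of \<open>Y\<^sub>i\<^sub>k\<close> over
  all subjects tends to \<open>0\<close> in probability, because \<open>tau_hat - SATE\<close> is a difference of two such
  errors.  The error is a weighted sum of the \<open>Y\<^sub>i\<^sub>k\<close> whose weights depend on the assignment only and
  have modulus at most \<open>1 / p\<close>.  Let \<open>f\<close> be the regression function of the outcome on the covariate,
  and let \<open>g\<close> be continuous with compact support and \<open>E \<bar>f X - g X\<bar>\<close> small; such a \<open>g\<close> exists by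
  Urysohn's lemma and inner regularity (\<open>compactly_supported_dense_L1\<close>).  Write
  \<open>Y = g X + (f X - g X) + (Y - f X)\<close>.

  The middle term contributes at most \<open>m * E \<bar>f X - g X\<bar>\<close> in \<open>L\<^sup>1\<close>, for any assignment.  Residuals
  \<open>Y - f X\<close> of distinct subjects stay orthogonal after conditioning on all covariates and on the
  assignment, as the assignment is conditionally independent of the outcomes; hence the last term has
  second moment \<open>O (1 / p)\<close> (\<open>weighted_residuals_second_moment\<close>).

  The term in \<open>g\<close> is an average of imbalances.  By \<open>C\<^sub>0\<close>-universality \<open>g\<close> is uniformly close to an
  element of \<open>F\<close>, so the imbalance has to be controlled for elements of \<open>F\<close>.  Both designs satisfy:
  conditionally on the covariates, the expected squared imbalance of each element of the unit ball is
  at most \<open>MP2\<close> of any balanced assignment (\<open>optimal_design_unit_ball\<close>).  For the MSOD this holds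
  because the PSOD is itself a feasible mixed strategy.  It remains to exhibit one assignment for
  which \<open>MP2\<close> tends to \<open>0\<close>, and assigning subject \<open>i\<close> to treatment \<open>i mod m\<close> does: its imbalance is a
  mean of \<open>p\<close> i.i.d. symmetric random elements of the dual of \<open>F\<close> modulo constants, with integrable norm,
  so it obeys the weak law of large numbers (\<open>total_block_bound_small\<close>).

  For the imbalances, expectations are taken only of expressions in the discrepancy \<open>sup (f x - f y)\<close> over the unit ball
  and in \<open>g\<close>, all of which are measurable; elements of \<open>F\<close> enter through pointwise inequalities.  For
  this reason the weak law is derived for the real-valued Gram form of the random elements, which
  polarisation expresses by the discrepancy.
\<close>

section \<open>Differences of function values in a reproducing kernel Hilbert space\<close>

definition discrepancy ::
  "('x \<Rightarrow> real) set \<Rightarrow> (('x \<Rightarrow> real) \<Rightarrow> ('x \<Rightarrow> real) \<Rightarrow> real) \<Rightarrow> 'x \<Rightarrow> 'x \<Rightarrow> real" where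
  "discrepancy F ip x y = (SUP f\<in>unit_ball F ip. f x - f y)"

text \<open>
  This is the inner product of the functionals \<open>f u - f v\<close> and \<open>f y - f z\<close>, polarised so that it
  is a measurable function of four points as soon as the discrepancy is measurable.
\<close>

definition difference_form ::
  "('x \<Rightarrow> real) set \<Rightarrow> (('x \<Rightarrow> real) \<Rightarrow> ('x \<Rightarrow> real) \<Rightarrow> real) \<Rightarrow> 'x \<Rightarrow> 'x \<Rightarrow> 'x \<Rightarrow> 'x \<Rightarrow> real" where
  "difference_form F ip u v y z =
     ((discrepancy F ip u z)\<^sup>2 + (discrepancy F ip v y)\<^sup>2 -
      (discrepancy F ip u y)\<^sup>2 - (discrepancy F ip v z)\<^sup>2) / 2"

context rkhs
begin

definition kernel :: "'x \<Rightarrow> 'x \<Rightarrow> real" where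
  "kernel = (SOME K. \<forall>x. K x \<in> F \<and> (\<forall>f\<in>F. f x = ip f (K x)))"

lemma kernel_mem: "kernel x \<in> F"
  and ip_kernel: "f \<in> F \<Longrightarrow> ip f (kernel x) = f x"
proof -
  have "\<forall>x. kernel x \<in> F \<and> (\<forall>f\<in>F. f x = ip f (kernel x))"
    unfolding kernel_def by (rule someI_ex[OF reproducing])
  then show "kernel x \<in> F" "f \<in> F \<Longrightarrow> ip f (kernel x) = f x" by auto
qed

lemma kernel_commute: "kernel x y = kernel y x"
  using ip_kernel[OF kernel_mem, of x y] ip_kernel[OF kernel_mem, of y x]
    ip_commute[OF kernel_mem kernel_mem, of x y] by simp

lemma diff_mem: "f \<in> F \<Longrightarrow> g \<in> F \<Longrightarrow> (\<lambda>x. f x - g x) \<in> F"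
  using add_mem[of f "\<lambda>x. (-1) * g x"] scale_mem[of g "-1"] by simp

lemma ip_zero: "f \<in> F \<Longrightarrow> ip (\<lambda>x. 0) f = 0"
  using ip_scale[of f f 0] by simp

lemma ip_diff:
  assumes "f \<in> F" "g \<in> F" "h \<in> F"
  shows "ip (\<lambda>x. f x - g x) h = ip f h - ip g h"
  using ip_add[of f "\<lambda>x. (-1) * g x" h] ip_scale[of g h "-1"] scale_mem[of g "-1"] assms
  by simp

lemma ip_nonneg: "f \<in> F \<Longrightarrow> 0 \<le> ip f f"
  using ip_pos[of f] ip_zero[of f] by (cases "f = (\<lambda>x. 0)") auto

lemma Cauchy_Schwarz:
  assumes "f \<in> F" "g \<in> F"
  shows "(ip f g)\<^sup>2 \<le> ip f f * ip g g"
proof (cases "g = (\<lambda>x. 0)")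
  case True
  then show ?thesis using assms ip_zero ip_commute by auto
next
  case False
  define t where "t = ip f g / ip g g"
  have pos: "0 < ip g g" using False assms ip_pos by blast
  have tg: "(\<lambda>x. t * g x) \<in> F" using assms scale_mem by blast
  have "0 \<le> ip (\<lambda>x. f x - t * g x) (\<lambda>x. f x - t * g x)"
    using diff_mem[OF assms(1) tg] ip_nonneg by blast
  also have "\<dots> = ip f (\<lambda>x. f x - t * g x) - t * ip g (\<lambda>x. f x - t * g x)"
    using ip_diff[OF assms(1) tg diff_mem[OF assms(1) tg]] ip_scale[OF assms(2) diff_mem[OF assms(1) tg]]
    by simp
  also have "ip f (\<lambda>x. f x - t * g x) = ip f f - t * ip f g"
    using ip_commute[OF assms(1) diff_mem[OF assms(1) tg]] ip_diff[OF assms(1) tg assms(1)]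
      ip_scale[OF assms(2,1), of t] ip_commute[OF assms] by simp
  also have "ip g (\<lambda>x. f x - t * g x) = ip f g - t * ip g g"
    using ip_commute[OF assms(2) diff_mem[OF assms(1) tg]] ip_diff[OF assms(1) tg assms(2)]
      ip_scale[OF assms(2,2), of t] by simp
  finally have "0 \<le> ip f f - ip f g * ip f g / ip g g"
    using pos by (simp add: t_def)
  then show ?thesis using pos by (simp add: field_simps power2_eq_square)
qed

lemma lincomb_mem:
  "(\<And>j. j \<in> J \<Longrightarrow> h j \<in> F) \<Longrightarrow> (\<lambda>x. \<Sum>j\<in>J. c j * h j x) \<in> F"
  by (induction J rule: infinite_finite_induct) (auto intro!: zero_mem add_mem scale_mem)

lemma ip_lincomb:
  "(\<And>j. j \<in> J \<Longrightarrow> h j \<in> F) \<Longrightarrow> f \<in> F \<Longrightarrow>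
     ip (\<lambda>x. \<Sum>j\<in>J. c j * h j x) f = (\<Sum>j\<in>J. c j * ip (h j) f)"
proof (induction J rule: infinite_finite_induct)
  case (insert i J)
  have "ip (\<lambda>x. c i * h i x + (\<Sum>j\<in>J. c j * h j x)) f =
      ip (\<lambda>x. c i * h i x) f + ip (\<lambda>x. \<Sum>j\<in>J. c j * h j x) f"
    using insert.prems by (intro ip_add scale_mem lincomb_mem) auto
  then show ?case using insert ip_scale by simp
qed (simp_all add: ip_zero)

lemma unit_ballI:
  assumes "f \<in> F" "ip f f \<le> 1"
  shows "f \<in> unit_ball F ip"
proof -
  have "quot_norm F ip f \<le> rkhs_norm F ip (\<lambda>x. f x + 0)"
    unfolding quot_norm_def by (rule INF_lower) simp
  also have "\<dots> \<le> 1" using assms by (simp add: rkhs_norm_def)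
  finally show ?thesis by (simp add: unit_ball_def)
qed

text \<open>
  The quotient norm is an infimum over shifts, so a shift of norm at most \<open>1 + e\<close> exists.  Working
  with such shifts avoids showing that the infimum is attained, and treats the cases with and
  without constants in \<open>F\<close> alike.
\<close>

lemma unit_ball_shift:
  assumes "f \<in> unit_ball F ip" "0 < e"
  obtains c where "(\<lambda>x. f x + c) \<in> F" "ip (\<lambda>x. f x + c) (\<lambda>x. f x + c) \<le> (1 + e)\<^sup>2"
proof -
  have "quot_norm F ip f < ennreal (1 + e)"
    using assms by (auto simp: unit_ball_def ennreal_1[symmetric] simp del: ennreal_1
        intro: order.strict_trans1)
  then obtain c where c: "rkhs_norm F ip (\<lambda>x. f x + c) < ennreal (1 + e)"
    unfolding quot_norm_def by (auto simp: INF_less_iff)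
  then have m: "(\<lambda>x. f x + c) \<in> F"
    by (auto simp: rkhs_norm_def split: if_splits)
  have "sqrt (ip (\<lambda>x. f x + c) (\<lambda>x. f x + c)) < 1 + e"
    using c m assms ip_nonneg[OF m] by (simp add: rkhs_norm_def ennreal_less_iff del: ennreal_plus)
  then have "(sqrt (ip (\<lambda>x. f x + c) (\<lambda>x. f x + c)))\<^sup>2 \<le> (1 + e)\<^sup>2"
    using ip_nonneg[OF m] by (intro power_mono) auto
  then show ?thesis using that m ip_nonneg[OF m] by simp
qed

lemma zero_unit_ball: "(\<lambda>x. 0) \<in> unit_ball F ip"
  using unit_ballI[OF zero_mem] ip_zero[OF zero_mem] by simp

text \<open>The Riesz representer of the functional that the lemma \<open>ip_representer\<close> displays.\<close>

definition representer :: "'j set \<Rightarrow> ('j \<Rightarrow> real) \<Rightarrow> ('j \<Rightarrow> 'x) \<Rightarrow> ('j \<Rightarrow> 'x) \<Rightarrow> 'x \<Rightarrow> real" where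
  "representer J c u v = (\<lambda>y. \<Sum>j\<in>J. c j * (kernel (u j) y - kernel (v j) y))"

lemma representer_mem: "representer J c u v \<in> F"
  unfolding representer_def
  using lincomb_mem[of J "\<lambda>j y. kernel (u j) y - kernel (v j) y"] by (simp add: diff_mem kernel_mem)

lemma ip_representer:
  assumes "f \<in> F"
  shows "ip f (representer J c u v) = (\<Sum>j\<in>J. c j * (f (u j) - f (v j)))"
proof -
  have "ip (representer J c u v) f = (\<Sum>j\<in>J. c j * ip (\<lambda>y. kernel (u j) y - kernel (v j) y) f)"
    unfolding representer_def using assms
    by (intro ip_lincomb) (simp_all add: diff_mem kernel_mem)
  also have "\<dots> = (\<Sum>j\<in>J. c j * (f (u j) - f (v j)))"
    using assms by (simp add: ip_diff kernel_mem ip_commute[OF kernel_mem] ip_kernel)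
  finally show ?thesis using ip_commute[OF assms representer_mem, of J c u v] by simp
qed

text \<open>
  A combination of differences does not see constants, so it may be evaluated on a shift of \<open>f\<close>
  that lies in \<open>F\<close> and has norm at most \<open>1 + e\<close>.  The bound is Cauchy--Schwarz with \<open>e\<close> tending
  to \<open>0\<close>.
\<close>

lemma unit_ball_sq_le_representer:
  assumes f: "f \<in> unit_ball F ip"
  shows "(\<Sum>j\<in>J. c j * (f (u j) - f (v j)))\<^sup>2
           \<le> ip (representer J c u v) (representer J c u v)"
proof -
  let ?r = "representer J c u v"
  let ?L = "(\<Sum>j\<in>J. c j * (f (u j) - f (v j)))"
  have bound: "?L\<^sup>2 \<le> (1 + e)\<^sup>2 * ip ?r ?r" if "0 < e" for e
  proof -
    obtain b where b: "(\<lambda>x. f x + b) \<in> F" "ip (\<lambda>x. f x + b) (\<lambda>x. f x + b) \<le> (1 + e)\<^sup>2"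
      using unit_ball_shift[OF f \<open>0 < e\<close>] by blast
    have "?L = ip (\<lambda>x. f x + b) ?r" by (simp add: ip_representer[OF b(1)])
    then have "?L\<^sup>2 \<le> ip (\<lambda>x. f x + b) (\<lambda>x. f x + b) * ip ?r ?r"
      using Cauchy_Schwarz[OF b(1) representer_mem] by simp
    also have "\<dots> \<le> (1 + e)\<^sup>2 * ip ?r ?r"
      using b(2) ip_nonneg[OF representer_mem] by (intro mult_right_mono)
    finally show ?thesis .
  qed
  have "((\<lambda>e. (1 + e)\<^sup>2 * ip ?r ?r) \<longlongrightarrow> (1 + 0)\<^sup>2 * ip ?r ?r) (at_right 0)"
    by (intro tendsto_intros)
  moreover have "eventually (\<lambda>e. ?L\<^sup>2 \<le> (1 + e)\<^sup>2 * ip ?r ?r) (at_right (0::real))"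
    using eventually_at_right_less[of "0::real"] by eventually_elim (rule bound)
  ultimately have "?L\<^sup>2 \<le> (1 + 0)\<^sup>2 * ip ?r ?r"
    by (intro tendsto_lowerbound[of _ _ "at_right 0"]) auto
  then show ?thesis by simp
qed

lemma representer_singleton: "representer {()} (\<lambda>_. 1) (\<lambda>_. x) (\<lambda>_. y) = (\<lambda>z. kernel x z - kernel y z)"
  by (simp add: representer_def)

text \<open>
  The supremum is attained at the normalised representer of \<open>f x - f y\<close>; both sides are the norm
  of that representer.
\<close>

lemma discrepancy_eq_norm:
  "discrepancy F ip x y = sqrt (kernel x x + kernel y y - 2 * kernel x y)"
  and bdd_above_discrepancy: "bdd_above ((\<lambda>f. f x - f y) ` unit_ball F ip)"
  and kernel_diff_nonneg: "0 \<le> kernel x x + kernel y y - 2 * kernel x y"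
proof -
  define r where "r = (\<lambda>z. kernel x z - kernel y z)"
  define N where "N = kernel x x + kernel y y - 2 * kernel x y"
  have r: "r \<in> F" unfolding r_def by (intro diff_mem kernel_mem)
  have ev: "ip f r = f x - f y" if "f \<in> F" for f
    using ip_representer[OF that, of "{()}" "\<lambda>_. 1" "\<lambda>_. x" "\<lambda>_. y"]
    by (simp add: r_def representer_singleton)
  have N: "ip r r = N"
    using ev[OF r] by (simp add: N_def r_def kernel_commute[of y x])
  show N0: "0 \<le> kernel x x + kernel y y - 2 * kernel x y"
    using ip_nonneg[OF r] N N_def by simp
  have upper: "f x - f y \<le> sqrt N" if "f \<in> unit_ball F ip" for f
  proof -
    have "(f x - f y)\<^sup>2 \<le> N"
      using unit_ball_sq_le_representer[OF that, of "\<lambda>_. 1" "\<lambda>_. x" "\<lambda>_. y" "{()}"] N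
      by (simp add: r_def representer_singleton)
    then show ?thesis by (simp add: real_le_rsqrt)
  qed
  then show bdd: "bdd_above ((\<lambda>f. f x - f y) ` unit_ball F ip)" by (intro bdd_aboveI2)
  have "sqrt N \<le> discrepancy F ip x y"
  proof (cases "N = 0")
    case True
    then show ?thesis
      unfolding discrepancy_def using cSUP_upper[OF zero_unit_ball bdd] by simp
  next
    case False
    then have Npos: "0 < N" using N0 by (simp add: N_def)
    define f where "f = (\<lambda>z. (1 / sqrt N) * r z)"
    have f: "f \<in> F" unfolding f_def using r scale_mem by blast
    have "ip f f = (1 / sqrt N) * ((1 / sqrt N) * N)"
      using ip_scale[OF r f, of "1 / sqrt N"] ip_scale[OF r r, of "1 / sqrt N"] ip_commute[OF r f] N
      unfolding f_def by simp
    also have "\<dots> = 1" using Npos by simp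
    finally have "f \<in> unit_ball F ip" using unit_ballI[OF f] by simp
    then have "f x - f y \<le> discrepancy F ip x y"
      unfolding discrepancy_def by (intro cSUP_upper bdd)
    moreover have "f x - f y = sqrt N"
      using ev[OF f] ip_scale[OF r r, of "1 / sqrt N"] N Npos unfolding f_def
      by (simp add: real_div_sqrt)
    ultimately show ?thesis by simp
  qed
  moreover have "discrepancy F ip x y \<le> sqrt N"
    unfolding discrepancy_def using upper zero_unit_ball by (intro cSUP_least) auto
  ultimately show "discrepancy F ip x y = sqrt (kernel x x + kernel y y - 2 * kernel x y)"
    by (simp add: N_def)
qed

lemma discrepancy_nonneg: "0 \<le> discrepancy F ip x y"
  unfolding discrepancy_eq_norm by (intro real_sqrt_ge_zero kernel_diff_nonneg)

lemma discrepancy_sq: "(discrepancy F ip x y)\<^sup>2 = kernel x x + kernel y y - 2 * kernel x y"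
  unfolding discrepancy_eq_norm by (rule real_sqrt_pow2[OF kernel_diff_nonneg])

lemma discrepancy_commute: "discrepancy F ip x y = discrepancy F ip y x"
  using kernel_commute[of x y] by (simp add: discrepancy_eq_norm add.commute)

lemma difference_form_eq_kernel:
  "difference_form F ip u v y z = kernel y u - kernel z u - (kernel y v - kernel z v)"
  by (simp add: difference_form_def discrepancy_sq kernel_commute[of u y] kernel_commute[of u z]
      kernel_commute[of v y] kernel_commute[of v z] field_simps)

lemma unit_ball_diff_le:
  assumes "f \<in> unit_ball F ip"
  shows "\<bar>f x - f y\<bar> \<le> discrepancy F ip x y"
  using cSUP_upper[OF assms bdd_above_discrepancy[of x y]] cSUP_upper[OF assms bdd_above_discrepancy[of y x]]
    discrepancy_commute[of x y] by (simp add: discrepancy_def abs_le_iff)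

lemma abs_difference_form_le:
  "\<bar>difference_form F ip u v y z\<bar> \<le> discrepancy F ip u v * discrepancy F ip y z"
proof -
  define r where "r = (\<lambda>x. kernel u x - kernel v x)"
  define s where "s = (\<lambda>x. kernel y x - kernel z x)"
  have mem: "r \<in> F" "s \<in> F" unfolding r_def s_def by (intro diff_mem kernel_mem)+
  have ev: "ip f r = f u - f v" "ip f s = f y - f z" if "f \<in> F" for f
    using ip_representer[OF that, of "{()}" "\<lambda>_. 1" "\<lambda>_. u" "\<lambda>_. v"]
      ip_representer[OF that, of "{()}" "\<lambda>_. 1" "\<lambda>_. y" "\<lambda>_. z"]
    by (simp_all add: r_def s_def representer_singleton)
  have "ip s r = difference_form F ip u v y z"
    using ev(1)[OF mem(2)] by (simp add: s_def difference_form_eq_kernel)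
  moreover have "ip s s = (discrepancy F ip y z)\<^sup>2" "ip r r = (discrepancy F ip u v)\<^sup>2"
    using ev(2)[OF mem(2)] ev(1)[OF mem(1)] kernel_commute[of z y] kernel_commute[of v u]
    by (simp_all add: s_def r_def discrepancy_sq)
  ultimately have "(difference_form F ip u v y z)\<^sup>2 \<le> (discrepancy F ip u v * discrepancy F ip y z)\<^sup>2"
    using Cauchy_Schwarz[OF mem(2,1)] by (simp add: power_mult_distrib mult.commute)
  then show ?thesis unfolding abs_le_square_iff[symmetric] by (simp add: abs_mult discrepancy_nonneg)
qed

text \<open>
  The right-hand side is the squared dual norm of the combination, written with discrepancies
  only.  This is what turns a supremum over the unit ball into a measurable expression.
\<close>

lemma unit_ball_sq_le:
  assumes "f \<in> unit_ball F ip"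
  shows "(\<Sum>j\<in>J. c j * (f (u j) - f (v j)))\<^sup>2
           \<le> (\<Sum>i\<in>J. \<Sum>j\<in>J. c i * c j * difference_form F ip (u i) (v i) (u j) (v j))"
proof -
  let ?r = "representer J c u v"
  have "ip ?r ?r = (\<Sum>i\<in>J. c i * (?r (u i) - ?r (v i)))"
    by (rule ip_representer[OF representer_mem])
  also have "\<dots> = (\<Sum>i\<in>J. \<Sum>j\<in>J. c i * c j * difference_form F ip (u i) (v i) (u j) (v j))"
  proof (rule sum.cong[OF refl])
    fix i
    have "?r (u i) - ?r (v i) = (\<Sum>j\<in>J. c j * difference_form F ip (u i) (v i) (u j) (v j))"
      unfolding representer_def difference_form_eq_kernel
      by (simp only: sum_subtractf[symmetric] right_diff_distrib[symmetric])
    then show "c i * (?r (u i) - ?r (v i)) =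
        (\<Sum>j\<in>J. c i * c j * difference_form F ip (u i) (v i) (u j) (v j))"
      by (simp add: sum_distrib_left mult.assoc)
  qed
  finally show ?thesis using unit_ball_sq_le_representer[OF assms, of c u v J] by simp
qed

end

lemma difference_form_swap: "difference_form F ip v u y z = - difference_form F ip u v y z"
  by (simp add: difference_form_def field_simps)

section \<open>Balance of optimal designs\<close>

lemma finite_treatment_pairs: "finite (treatment_pairs m)"
  by (rule finite_subset[of _ "{..<m} \<times> {..<m}"]) (auto simp: treatment_pairs_def)

lemma treatment_pairs_nonempty: "2 \<le> m \<Longrightarrow> treatment_pairs m \<noteq> {}"
proof -
  assume "2 \<le> m"
  then have "(0, 1) \<in> treatment_pairs m" by (simp add: treatment_pairs_def)
  then show ?thesis by blast
qed

lemma finite_assignments: "finite (assignments m p)"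
  by (rule finite_subset[of _ "{..<m * p} \<rightarrow>\<^sub>E {..<m}"]) (auto simp: assignments_def intro: finite_PiE)

definition block_assignment :: "nat \<Rightarrow> nat \<Rightarrow> nat \<Rightarrow> nat" where
  "block_assignment m p = (\<lambda>i\<in>{..<m * p}. i mod m)"

lemma block_assignment_group:
  assumes "k < m"
  shows "bij_betw (\<lambda>j. m * j + k) {..<p} {i. i < m * p \<and> block_assignment m p i = k}"
proof (rule bij_betwI')
  fix j assume "j \<in> {..<p}"
  then have "m * j + k < m * Suc j" "m * Suc j \<le> m * p"
    using assms by (simp, intro mult_le_mono2) auto
  then have "m * j + k < m * p" by linarith
  then show "m * j + k \<in> {i. i < m * p \<and> block_assignment m p i = k}"
    using assms by (simp add: block_assignment_def)
next
  fix i assume i: "i \<in> {i. i < m * p \<and> block_assignment m p i = k}"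
  then have "i mod m = k" "i < m * p" by (auto simp: block_assignment_def)
  then have "i = m * (i div m) + k" "i div m < p"
    using assms by (auto simp: less_mult_imp_div_less mult.commute)
  then show "\<exists>j\<in>{..<p}. i = m * j + k" by blast
qed (use assms in auto)

lemma block_assignment_mem: "0 < m \<Longrightarrow> block_assignment m p \<in> assignments m p"
  using bij_betw_same_card[OF block_assignment_group[of _ m p]]
  by (auto simp: assignments_def block_assignment_def)

lemma group_mean_eq_sum:
  "group_mean m p w k v = (\<Sum>i<m * p. (if w i = k then 1 else 0) / real p * v i)"
proof -
  have "(\<Sum>i | i < m * p \<and> w i = k. v i) = (\<Sum>i<m * p. if w i = k then v i else 0)"
    by (subst sum.inter_filter[symmetric]) (auto intro: sum.cong)
  then show ?thesis
    unfolding group_mean_def by (simp add: sum_distrib_left) (auto intro: sum.cong)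
qed

lemma imbalance_eq_sum:
  "imbalance m p x w k l f =
     (\<Sum>i<m * p. ((if w i = k then 1 else 0) - (if w i = l then 1 else 0)) / real p * f (x i))"
  by (simp add: imbalance_def group_mean_eq_sum sum_subtractf[symmetric] left_diff_distrib diff_divide_distrib)

text \<open>Groups of a balanced assignment have equal size, so constants cancel.\<close>

lemma imbalance_shift:
  assumes "w \<in> assignments m p" "k < m" "l < m"
  shows "imbalance m p x w k l (\<lambda>z. f z + c) = imbalance m p x w k l f"
proof -
  have card: "(\<Sum>i<m * p. if w i = k then 1 else 0 :: real) = real p" if "k < m" for k
  proof -
    have "(\<Sum>i<m * p. if w i = k then 1 else 0 :: real) = real (card {i \<in> {..<m * p}. w i = k})"
      by (simp add: sum.If_cases Int_def)
    then show ?thesis using assms(1) that by (simp add: assignments_def)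
  qed
  have "(\<Sum>i<m * p. ((if w i = k then 1 else 0) - (if w i = l then 1 else 0)) / real p * c)
      = ((\<Sum>i<m * p. if w i = k then 1 else 0) - (\<Sum>i<m * p. if w i = l then 1 else 0)) / real p * c"
    by (simp only: sum_subtractf[symmetric] sum_divide_distrib sum_distrib_right)
  also have "\<dots> = 0" using card assms by simp
  finally show ?thesis by (simp add: imbalance_eq_sum distrib_left sum.distrib)
qed

lemma imbalance_block:
  assumes "k < m" "l < m"
  shows "imbalance m p x (block_assignment m p) k l f =
           (\<Sum>j<p. 1 / real p * (f (x (m * j + k)) - f (x (m * j + l))))"
  using sum.reindex_bij_betw[OF block_assignment_group[OF assms(1), of p], of "\<lambda>i. f (x i)"]
    sum.reindex_bij_betw[OF block_assignment_group[OF assms(2), of p], of "\<lambda>i. f (x i)"]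
  by (simp add: imbalance_def group_mean_def sum_distrib_left[symmetric] sum_subtractf
      sum_divide_distrib[symmetric] diff_divide_distrib)

definition relabel :: "nat \<Rightarrow> nat \<Rightarrow> (nat \<Rightarrow> nat) \<Rightarrow> (nat \<Rightarrow> nat) \<Rightarrow> nat \<Rightarrow> nat" where
  "relabel m p \<pi> w = (\<lambda>i\<in>{..<m * p}. \<pi> (w i))"

lemma relabel_group:
  assumes "\<pi> permutes {..<m}"
  shows "{i. i < m * p \<and> relabel m p \<pi> w i = \<pi> k} = {i. i < m * p \<and> w i = k}"
  using permutes_inj[OF assms] by (auto simp: relabel_def inj_eq)

lemma relabel_mem:
  assumes "\<pi> permutes {..<m}" "w \<in> assignments m p"
  shows "relabel m p \<pi> w \<in> assignments m p"
proof -
  have "card {i \<in> {..<m * p}. relabel m p \<pi> w i = k} = p" if "k < m" for k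
  proof -
    obtain k' where "k = \<pi> k'" "k' < m"
      using permutes_image[OF assms(1)] \<open>k < m\<close> by (metis imageE lessThan_iff)
    then show ?thesis using relabel_group[OF assms(1), of p w k'] assms(2) by (simp add: assignments_def)
  qed
  then show ?thesis
    using assms permutes_in_image[OF assms(1)] by (auto simp: assignments_def relabel_def)
qed

text \<open>The maximum over all pairs of treatments is insensitive to renaming the treatments.\<close>

lemma MP2_relabel:
  assumes "\<pi> permutes {..<m}"
  shows "MP2 F ip m p x (relabel m p \<pi> w) = MP2 F ip m p x w"
proof -
  have iff: "(\<pi> k, \<pi> l) \<in> treatment_pairs m \<longleftrightarrow> (k, l) \<in> treatment_pairs m" for k l
    using permutes_in_image[OF assms, of k] permutes_in_image[OF assms, of l]
      inj_eq[OF permutes_inj[OF assms], of k l] by (simp add: treatment_pairs_def)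
  \<comment> \<open>Reindexing the maximum by the renaming itself.\<close>
  have pairs: "treatment_pairs m = map_prod \<pi> \<pi> ` treatment_pairs m"
  proof
    show "map_prod \<pi> \<pi> ` treatment_pairs m \<subseteq> treatment_pairs m"
      using iff by auto
    show "treatment_pairs m \<subseteq> map_prod \<pi> \<pi> ` treatment_pairs m"
    proof
      fix z assume z: "z \<in> treatment_pairs m"
      obtain k l where kl: "z = (\<pi> k, \<pi> l)"
        using permutes_surj[OF assms] by (metis surjD surj_pair)
      then have "(k, l) \<in> treatment_pairs m" using z iff by simp
      then show "z \<in> map_prod \<pi> \<pi> ` treatment_pairs m" using kl by force
    qed
  qed
  have "(MAX (k, l)\<in>treatment_pairs m. (imbalance m p x (relabel m p \<pi> w) k l f)\<^sup>2) =
        (MAX (k, l)\<in>treatment_pairs m. (imbalance m p x w k l f)\<^sup>2)" for f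
  proof -
    have "imbalance m p x (relabel m p \<pi> w) (\<pi> k) (\<pi> l) f = imbalance m p x w k l f" for k l
      by (simp add: imbalance_def group_mean_def relabel_group[OF assms])
    then have "(\<lambda>(k, l). (imbalance m p x (relabel m p \<pi> w) k l f)\<^sup>2) \<circ> map_prod \<pi> \<pi> =
        (\<lambda>(k, l). (imbalance m p x w k l f)\<^sup>2)"
      by (auto simp: fun_eq_iff)
    then show ?thesis by (subst pairs) (simp add: image_comp)
  qed
  then show ?thesis by (simp add: MP2_def)
qed

lemma PSOD_support:
  assumes "0 < m"
  shows "set_pmf (PSOD F ip m p x) = {w. is_arg_min (MP2 F ip m p x) (\<lambda>w. w \<in> assignments m p) w}"
    and "finite {w. is_arg_min (MP2 F ip m p x) (\<lambda>w. w \<in> assignments m p) w}"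
    and "{w. is_arg_min (MP2 F ip m p x) (\<lambda>w. w \<in> assignments m p) w} \<noteq> {}"
proof -
  let ?A = "{w. is_arg_min (MP2 F ip m p x) (\<lambda>w. w \<in> assignments m p) w}"
  show fin: "finite ?A"
    by (rule finite_subset[OF _ finite_assignments[of m p]]) (auto simp: is_arg_min_def)
  have "assignments m p \<noteq> {}" using block_assignment_mem[OF assms] by blast
  then have "is_arg_min (MP2 F ip m p x) (\<lambda>w. w \<in> assignments m p)
      (arg_min_on (MP2 F ip m p x) (assignments m p))"
    using arg_min_if_finite[OF finite_assignments, of m p "MP2 F ip m p x"]
    by (auto simp: is_arg_min_def)
  then show ne: "?A \<noteq> {}" by blast
  show "set_pmf (PSOD F ip m p x) = ?A"
    unfolding PSOD_def by (rule set_pmf_of_set[OF ne fin])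
qed

text \<open>
  By \<open>MP2_relabel\<close> the set of minimisers is invariant under renaming, hence so is the uniform
  distribution on it.  This makes the PSOD a competitor in the minimisation that defines the MSOD.
\<close>

lemma PSOD_mixed_strategy:
  assumes "0 < m"
  shows "PSOD F ip m p x \<in> mixed_strategies m p"
proof -
  let ?A = "{w. is_arg_min (MP2 F ip m p x) (\<lambda>w. w \<in> assignments m p) w}"
  have "pmf (PSOD F ip m p x) w = pmf (PSOD F ip m p x) (relabel m p \<pi> w)"
    if "\<pi> permutes {..<m}" "w \<in> assignments m p" for \<pi> w
  proof -
    have "w \<in> ?A \<longleftrightarrow> relabel m p \<pi> w \<in> ?A"
      using that relabel_mem[OF that] MP2_relabel[OF that(1), of F ip p x w]
      by (simp add: is_arg_min_def)
    then show ?thesis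
      using PSOD_support[OF assms, of F ip p x]
      by (simp add: PSOD_def pmf_of_set indicator_def)
  qed
  then show ?thesis
    using PSOD_support(1)[OF assms, of F ip p x]
    by (auto simp: mixed_strategies_def relabel_def is_arg_min_def)
qed

context rkhs
begin

lemma unit_ball_imbalance_bounded:
  assumes "w \<in> assignments m p" "k < m" "l < m" "f \<in> unit_ball F ip"
  shows "\<bar>imbalance m p x w k l f\<bar> \<le> (\<Sum>i<m * p. 2 / real p * discrepancy F ip (x i) (x 0))"
proof -
  have "imbalance m p x w k l f = imbalance m p x w k l (\<lambda>z. f z + - f (x 0))"
    using imbalance_shift[OF assms(1-3)] by metis
  also have "\<bar>\<dots>\<bar> \<le> (\<Sum>i<m * p. 2 / real p * discrepancy F ip (x i) (x 0))"
    unfolding imbalance_eq_sum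
  proof (intro order.trans[OF sum_abs] sum_mono)
    fix i
    have "\<bar>((if w i = k then 1 else 0) - (if w i = l then 1 else 0)) / real p\<bar> \<le> 2 / real p"
      by (auto simp: divide_right_mono)
    moreover have "\<bar>f (x i) + - f (x 0)\<bar> \<le> discrepancy F ip (x i) (x 0)"
      using unit_ball_diff_le[OF assms(4), of "x i" "x 0"] by simp
    ultimately show "\<bar>((if w i = k then 1 else 0) - (if w i = l then 1 else 0)) / real p *
        (f (x i) + - f (x 0))\<bar> \<le> 2 / real p * discrepancy F ip (x i) (x 0)"
      unfolding abs_mult by (intro mult_mono) auto
  qed
  finally show ?thesis .
qed

text \<open>
  The common form of the objectives \<open>MP2\<close> and \<open>MM2\<close>.  The point is boundedness of the supremum,
  without which its value would carry no information.
\<close>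

lemma weighted_imbalance_le_SUP:
  assumes m: "2 \<le> m" and A: "finite A" "A \<subseteq> assignments m p"
    and f: "f \<in> unit_ball F ip" and kl: "(k, l) \<in> treatment_pairs m"
  shows "(\<Sum>w\<in>A. c w * (imbalance m p x w k l f)\<^sup>2) \<le>
     (SUP f\<in>unit_ball F ip. MAX (k, l)\<in>treatment_pairs m. \<Sum>w\<in>A. c w * (imbalance m p x w k l f)\<^sup>2)"
proof -
  let ?g = "\<lambda>f. \<lambda>(k, l). \<Sum>w\<in>A. c w * (imbalance m p x w k l f)\<^sup>2"
  let ?B = "\<Sum>i<m * p. 2 / real p * discrepancy F ip (x i) (x 0)"
  have "Max (?g f ` treatment_pairs m) \<le> (\<Sum>w\<in>A. \<bar>c w\<bar> * ?B\<^sup>2)" if "f \<in> unit_ball F ip" for f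
  proof (subst Max_le_iff)
    show "\<forall>a\<in>?g f ` treatment_pairs m. a \<le> (\<Sum>w\<in>A. \<bar>c w\<bar> * ?B\<^sup>2)"
    proof (safe, intro sum_mono)
      fix k l w assume "(k, l) \<in> treatment_pairs m" "w \<in> A"
      then have "\<bar>imbalance m p x w k l f\<bar> \<le> ?B"
        using A that by (intro unit_ball_imbalance_bounded) (auto simp: treatment_pairs_def)
      then have "(imbalance m p x w k l f)\<^sup>2 \<le> ?B\<^sup>2"
        using power_mono[of "\<bar>imbalance m p x w k l f\<bar>" ?B 2] by simp
      then show "c w * (imbalance m p x w k l f)\<^sup>2 \<le> \<bar>c w\<bar> * ?B\<^sup>2"
        by (intro mult_mono) auto
    qed
  qed (use finite_treatment_pairs treatment_pairs_nonempty[OF m] in auto)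
  then have bdd: "bdd_above ((\<lambda>f. Max (?g f ` treatment_pairs m)) ` unit_ball F ip)"
    by (intro bdd_aboveI2)
  have "(\<Sum>w\<in>A. c w * (imbalance m p x w k l f)\<^sup>2) \<le> Max (?g f ` treatment_pairs m)"
    using kl finite_treatment_pairs by (intro Max_ge) force+
  also have "\<dots> \<le> (SUP f\<in>unit_ball F ip. Max (?g f ` treatment_pairs m))"
    by (intro cSUP_upper f bdd)
  finally show ?thesis .
qed

lemma imbalance_sq_le_MP2:
  assumes "2 \<le> m" "w \<in> assignments m p" "f \<in> unit_ball F ip" "(k, l) \<in> treatment_pairs m"
  shows "(imbalance m p x w k l f)\<^sup>2 \<le> MP2 F ip m p x w"
  using weighted_imbalance_le_SUP[of m "{w}" p f k l "\<lambda>_. 1" x] assms by (simp add: MP2_def)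

text \<open>
  For the PSOD every assignment in the support has minimal \<open>MP2\<close>.  For the MSOD the left-hand side
  is at most \<open>MM2\<close> of the optimum, hence at most \<open>MM2\<close> of the PSOD, to which the first case applies.
\<close>

lemma optimal_design_unit_ball:
  assumes m: "2 \<le> m" and D: "D = PSOD F ip m p \<or> is_MSOD F ip m p D"
    and f: "f \<in> unit_ball F ip" and kl: "(k, l) \<in> treatment_pairs m" and w0: "w0 \<in> assignments m p"
  shows "(\<Sum>w\<in>assignments m p. pmf (D x) w * (imbalance m p x w k l f)\<^sup>2) \<le> MP2 F ip m p x w0"
proof -
  have PSOD: "(\<Sum>w\<in>assignments m p. pmf (PSOD F ip m p x) w * (imbalance m p x w k l f)\<^sup>2)
      \<le> MP2 F ip m p x w0"
    if f: "f \<in> unit_ball F ip" and kl: "(k, l) \<in> treatment_pairs m" for f k l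
  proof -
    have supp: "set_pmf (PSOD F ip m p x) \<subseteq> assignments m p"
      using PSOD_mixed_strategy[of m F ip p x] m by (simp add: mixed_strategies_def)
    have "(\<Sum>w\<in>assignments m p. pmf (PSOD F ip m p x) w * (imbalance m p x w k l f)\<^sup>2)
        \<le> (\<Sum>w\<in>assignments m p. pmf (PSOD F ip m p x) w * MP2 F ip m p x w0)"
    proof (rule sum_mono)
      fix w assume w: "w \<in> assignments m p"
      show "pmf (PSOD F ip m p x) w * (imbalance m p x w k l f)\<^sup>2
          \<le> pmf (PSOD F ip m p x) w * MP2 F ip m p x w0"
      proof (cases "w \<in> set_pmf (PSOD F ip m p x)")
        case True
        then have "MP2 F ip m p x w \<le> MP2 F ip m p x w0"
          using PSOD_support(1)[of m F ip p x] m w0 by (auto simp: is_arg_min_def not_less)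
        then show ?thesis
          using imbalance_sq_le_MP2[OF m w f kl, of x] by (intro mult_left_mono) auto
      qed (simp add: set_pmf_iff)
    qed
    also have "\<dots> = MP2 F ip m p x w0"
      using sum_pmf_eq_1[OF finite_assignments supp] by (simp add: sum_distrib_right[symmetric])
    finally show ?thesis .
  qed
  show ?thesis
  proof (cases "D = PSOD F ip m p")
    case True
    then show ?thesis using PSOD[OF f kl] by simp
  next
    case False
    then have opt: "is_arg_min (MM2 F ip m p x) (\<lambda>\<sigma>. \<sigma> \<in> mixed_strategies m p) (D x)"
      using D by (auto simp: is_MSOD_def)
    have "(\<Sum>w\<in>assignments m p. pmf (D x) w * (imbalance m p x w k l f)\<^sup>2) \<le> MM2 F ip m p x (D x)"
      unfolding MM2_def by (intro weighted_imbalance_le_SUP m finite_assignments order.refl f kl)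
    also have "\<dots> \<le> MM2 F ip m p x (PSOD F ip m p x)"
      using opt PSOD_mixed_strategy[of m F ip p x] m by (auto simp: is_arg_min_def not_less)
    also have "\<dots> \<le> MP2 F ip m p x w0"
      unfolding MM2_def
      using PSOD zero_unit_ball finite_treatment_pairs treatment_pairs_nonempty[OF m]
      by (intro cSUP_least) (auto simp: Max_le_iff)
    finally show ?thesis .
  qed
qed

lemma optimal_design_imbalance:
  assumes m: "2 \<le> m" and D: "D = PSOD F ip m p \<or> is_MSOD F ip m p D"
    and f: "f \<in> F" and kl: "(k, l) \<in> treatment_pairs m" and w0: "w0 \<in> assignments m p"
  shows "(\<Sum>w\<in>assignments m p. pmf (D x) w * (imbalance m p x w k l f)\<^sup>2)
           \<le> (ip f f + 1) * MP2 F ip m p x w0"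
proof -
  define s where "s = sqrt (ip f f + 1)"
  have s: "s\<^sup>2 = ip f f + 1" "0 < s" using ip_nonneg[OF f] by (simp_all add: s_def)
  define h where "h = (\<lambda>z. (1 / s) * f z)"
  have h: "h \<in> F" unfolding h_def by (rule scale_mem[OF f])
  have "ip h h = ip f f / s\<^sup>2"
    using ip_scale[OF f h, of "1 / s"] ip_scale[OF f f, of "1 / s"] ip_commute[OF f h]
    unfolding h_def by (simp add: power2_eq_square)
  also have "\<dots> \<le> 1" using s ip_nonneg[OF f] by simp
  finally have hb: "h \<in> unit_ball F ip" by (rule unit_ballI[OF h])
  have "imbalance m p x w k l f = s * imbalance m p x w k l h" for w
    using s(2) by (simp add: imbalance_eq_sum h_def sum_distrib_left)
  then have "(\<Sum>w\<in>assignments m p. pmf (D x) w * (imbalance m p x w k l f)\<^sup>2) =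
      s\<^sup>2 * (\<Sum>w\<in>assignments m p. pmf (D x) w * (imbalance m p x w k l h)\<^sup>2)"
    by (simp add: power_mult_distrib sum_distrib_left mult_ac)
  also have "\<dots> \<le> s\<^sup>2 * MP2 F ip m p x w0"
    using optimal_design_unit_ball[OF m D hb kl w0] by (intro mult_left_mono) auto
  finally show ?thesis by (simp add: s)
qed

end

text \<open>
  A bound, up to truncation at \<open>1\<close>, for the squared dual norm of the mean of the functionals \<open>f (u j) - f (v j)\<close>, \<open>j < p\<close>.
  Up to the factor \<open>2\<close>, the first term is the squared norm of the part with discrepancy at most \<open>R\<close>.
  The second is the mean discrepancy of the rest, not squared because only the first moment of the
  discrepancy is assumed finite.
\<close>

definition block_bound ::
  "('x \<Rightarrow> real) set \<Rightarrow> (('x \<Rightarrow> real) \<Rightarrow> ('x \<Rightarrow> real) \<Rightarrow> real) \<Rightarrow>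
   nat \<Rightarrow> real \<Rightarrow> (nat \<Rightarrow> 'x) \<Rightarrow> (nat \<Rightarrow> 'x) \<Rightarrow> real" where
  "block_bound F ip p R u v =
     2 * ((\<Sum>i<p. \<Sum>j<p. of_bool (discrepancy F ip (u i) (v i) \<le> R) * of_bool (discrepancy F ip (u j) (v j) \<le> R)
            * difference_form F ip (u i) (v i) (u j) (v j)) / (real p)\<^sup>2)
     + 2 * ((\<Sum>j<p. of_bool (R < discrepancy F ip (u j) (v j)) * discrepancy F ip (u j) (v j)) / real p)"

context rkhs
begin

lemma unit_ball_block_le:
  fixes p :: nat and u v :: "nat \<Rightarrow> 'x" and R :: real
  defines "A \<equiv> (\<Sum>i<p. \<Sum>j<p. of_bool (discrepancy F ip (u i) (v i) \<le> R) * of_bool (discrepancy F ip (u j) (v j) \<le> R)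
            * difference_form F ip (u i) (v i) (u j) (v j)) / (real p)\<^sup>2"
    and "b \<equiv> (\<Sum>j<p. of_bool (R < discrepancy F ip (u j) (v j)) * discrepancy F ip (u j) (v j)) / real p"
  assumes f: "f \<in> unit_ball F ip"
  shows "(\<Sum>j<p. 1 / real p * (f (u j) - f (v j)))\<^sup>2 \<le> 2 * A + 2 * b\<^sup>2" "0 \<le> A" "0 \<le> b"
proof -
  define a where "a = (\<lambda>j. of_bool (discrepancy F ip (u j) (v j) \<le> R) / real p)"
  define c where "c = (\<lambda>j. of_bool (R < discrepancy F ip (u j) (v j)) / real p)"
  define S where "S = (\<Sum>j<p. a j * (f (u j) - f (v j)))"
  define T where "T = (\<Sum>j<p. c j * (f (u j) - f (v j)))"
  have "A = (\<Sum>i<p. \<Sum>j<p. a i * a j * difference_form F ip (u i) (v i) (u j) (v j))"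
    unfolding A_def a_def sum_divide_distrib power2_eq_square by (intro sum.cong) simp_all
  then have SA: "S\<^sup>2 \<le> A" unfolding S_def using unit_ball_sq_le[OF f] by simp
  then show "0 \<le> A" by (rule order.trans[OF zero_le_power2])
  show b0: "0 \<le> b" unfolding b_def by (intro divide_nonneg_nonneg sum_nonneg) (simp_all add: discrepancy_nonneg)
  have "\<bar>T\<bar> \<le> (\<Sum>j<p. c j * discrepancy F ip (u j) (v j))"
    unfolding T_def by (intro order.trans[OF sum_abs] sum_mono)
      (simp add: abs_mult c_def mult_left_mono divide_right_mono unit_ball_diff_le[OF f])
  also have "\<dots> = b" unfolding b_def c_def sum_divide_distrib by (intro sum.cong) simp_all
  finally have "T\<^sup>2 \<le> b\<^sup>2" using power_mono[of "\<bar>T\<bar>" b 2] by simp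
  have "a j + c j = 1 / real p" for j by (simp add: a_def c_def)
  then have "(\<Sum>j<p. 1 / real p * (f (u j) - f (v j))) = S + T"
    by (simp add: S_def T_def sum.distrib[symmetric] distrib_right[symmetric])
  moreover have "(S + T)\<^sup>2 \<le> 2 * S\<^sup>2 + 2 * T\<^sup>2"
    using sum_squares_bound[of S T] by (simp add: power2_sum)
  ultimately show "(\<Sum>j<p. 1 / real p * (f (u j) - f (v j)))\<^sup>2 \<le> 2 * A + 2 * b\<^sup>2"
    using SA \<open>T\<^sup>2 \<le> b\<^sup>2\<close> by simp
qed

lemma block_bound_nonneg: "0 \<le> block_bound F ip p R u v"
  using unit_ball_block_le(2,3)[OF zero_unit_ball, where p = p and R = R and u = u and v = v] by (simp add: block_bound_def)

text \<open>
  The squared mean of the large discrepancies may be replaced by the mean itself, since only values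
  below \<open>1\<close> matter after truncating \<open>MP2\<close> at \<open>1\<close>.
\<close>

lemma min_MP2_block_le:
  assumes m: "2 \<le> m"
  shows "min 1 (MP2 F ip m p x (block_assignment m p)) \<le>
     (\<Sum>(k, l)\<in>treatment_pairs m. block_bound F ip p R (\<lambda>j. x (m * j + k)) (\<lambda>j. x (m * j + l)))"
    (is "_ \<le> ?S")
proof (cases "1 \<le> ?S")
  case False
  have "MP2 F ip m p x (block_assignment m p) \<le> ?S"
    unfolding MP2_def
  proof (rule cSUP_least)
    fix f assume f: "f \<in> unit_ball F ip"
    show "(MAX (k, l)\<in>treatment_pairs m. (imbalance m p x (block_assignment m p) k l f)\<^sup>2) \<le> ?S"
    proof (subst Max_le_iff)
      show "\<forall>a\<in>(\<lambda>(k, l). (imbalance m p x (block_assignment m p) k l f)\<^sup>2) ` treatment_pairs m. a \<le> ?S"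
      proof safe
      fix k l assume kl: "(k, l) \<in> treatment_pairs m"
      let ?u = "\<lambda>j. x (m * j + k)" and ?v = "\<lambda>j. x (m * j + l)"
      define A where "A = (\<Sum>i<p. \<Sum>j<p. of_bool (discrepancy F ip (?u i) (?v i) \<le> R) * of_bool (discrepancy F ip (?u j) (?v j) \<le> R)
            * difference_form F ip (?u i) (?v i) (?u j) (?v j)) / (real p)\<^sup>2"
      define b where "b = (\<Sum>j<p. of_bool (R < discrepancy F ip (?u j) (?v j)) * discrepancy F ip (?u j) (?v j)) / real p"
      have le: "block_bound F ip p R ?u ?v \<le> ?S"
        using member_le_sum[OF kl _ finite_treatment_pairs, of "\<lambda>(k, l). block_bound F ip p R (\<lambda>j. x (m * j + k)) (\<lambda>j. x (m * j + l))"]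
          block_bound_nonneg by auto
      note bb = unit_ball_block_le[OF f, where p = p and R = R and u = ?u and v = ?v, folded A_def b_def]
      have eq: "block_bound F ip p R ?u ?v = 2 * A + 2 * b" by (simp add: block_bound_def A_def b_def)
      then have "b \<le> 1" using le False bb(2,3) by linarith
      then have "b\<^sup>2 \<le> b" using bb(3) by (simp add: power2_eq_square mult_left_le)
      then show "(imbalance m p x (block_assignment m p) k l f)\<^sup>2 \<le> ?S"
        using bb(1) le eq kl by (auto simp: imbalance_block treatment_pairs_def)
      qed
    qed (use finite_treatment_pairs treatment_pairs_nonempty[OF m] in auto)
  qed (use zero_unit_ball in auto)
  then show ?thesis by simp
qed simp

end

section \<open>The weak law of large numbers for the block assignment\<close>

locale iid_sequence = prob_space M for M :: "'a measure" +
  fixes N :: "'b measure" and Z :: "nat \<Rightarrow> 'a \<Rightarrow> 'b"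
  assumes independent: "indep_vars (\<lambda>_. N) Z UNIV"
    and identical: "\<And>i. distr M N (Z i) = distr M N (Z 0)"
begin

lemma term_measurable: "Z i \<in> measurable M N"
  using independent by (simp add: indep_vars_def)

lemma indep_vars_subsequence:
  assumes "inj_on \<tau> I"
  shows "indep_vars (\<lambda>_. N) (\<lambda>i. Z (\<tau> i)) I"
  unfolding indep_vars_def2
proof (intro conjI ballI term_measurable indep_setsI)
  fix A J assume J: "J \<noteq> {}" "J \<subseteq> I" "finite J"
    and A: "\<forall>j\<in>J. A j \<in> {Z (\<tau> j) -` B \<inter> space M |B. B \<in> sets N}"
  have inj: "inj_on \<tau> J" using assms J(2) by (rule inj_on_subset)
  define A' where "A' = (\<lambda>i. A (the_inv_into J \<tau> i))"
  have A': "A' (\<tau> j) = A j" if "j \<in> J" for j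
    using the_inv_into_f_f[OF inj that] by (simp add: A'_def)
  have "indep_sets (\<lambda>i. {Z i -` B \<inter> space M |B. B \<in> sets N}) UNIV"
    using independent unfolding indep_vars_def2 by blast
  then have "prob (\<Inter>i\<in>\<tau> ` J. A' i) = (\<Prod>i\<in>\<tau> ` J. prob (A' i))"
    by (rule indep_setsD) (use J A A' in auto)
  then show "prob (\<Inter>j\<in>J. A j) = (\<Prod>j\<in>J. prob (A j))"
    by (simp add: prod.reindex[OF inj] A' cong: INF_cong_simp)
qed (use term_measurable in \<open>auto intro: measurable_sets\<close>)

lemma distr_subsequence:
  assumes "inj_on \<tau> I" "I \<noteq> {}"
  shows "distr M (\<Pi>\<^sub>M i\<in>I. N) (\<lambda>\<omega>. \<lambda>i\<in>I. Z (\<tau> i) \<omega>) = (\<Pi>\<^sub>M i\<in>I. distr M N (Z 0))"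
proof -
  have "(\<Pi>\<^sub>M i\<in>I. distr M N (Z (\<tau> i))) = (\<Pi>\<^sub>M i\<in>I. distr M N (Z 0))"
    by (intro PiM_cong refl identical)
  then show ?thesis
    using indep_vars_iff_distr_eq_PiM[OF assms(2), where M' = "\<lambda>_. N" and X = "\<lambda>i. Z (\<tau> i)"]
      indep_vars_subsequence[OF assms(1)] term_measurable by simp
qed

text \<open>
  The joint law of finitely many distinct terms is a power of the common law, which does not depend
  on the choice or the order of the terms.
\<close>

lemma integral_subsequence:
  fixes \<phi> :: "('i \<Rightarrow> 'b) \<Rightarrow> real"
  assumes inj: "inj_on \<tau> I" "inj_on \<tau>' I" and ne: "I \<noteq> {}"
    and \<phi>: "\<phi> \<in> borel_measurable (\<Pi>\<^sub>M i\<in>I. N)"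
  shows "(\<integral>\<omega>. \<phi> (\<lambda>i\<in>I. Z (\<tau> i) \<omega>) \<partial>M) = (\<integral>\<omega>. \<phi> (\<lambda>i\<in>I. Z (\<tau>' i) \<omega>) \<partial>M)"
    and "integrable M (\<lambda>\<omega>. \<phi> (\<lambda>i\<in>I. Z (\<tau> i) \<omega>)) \<longleftrightarrow> integrable M (\<lambda>\<omega>. \<phi> (\<lambda>i\<in>I. Z (\<tau>' i) \<omega>))"
proof -
  have meas: "(\<lambda>\<omega>. \<lambda>i\<in>I. Z (\<sigma> i) \<omega>) \<in> measurable M (\<Pi>\<^sub>M i\<in>I. N)" for \<sigma>
    by (intro measurable_restrict term_measurable)
  show "(\<integral>\<omega>. \<phi> (\<lambda>i\<in>I. Z (\<tau> i) \<omega>) \<partial>M) = (\<integral>\<omega>. \<phi> (\<lambda>i\<in>I. Z (\<tau>' i) \<omega>) \<partial>M)"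
    unfolding integral_distr[OF meas \<phi>, symmetric] distr_subsequence[OF inj(1) ne] distr_subsequence[OF inj(2) ne] ..
  show "integrable M (\<lambda>\<omega>. \<phi> (\<lambda>i\<in>I. Z (\<tau> i) \<omega>)) \<longleftrightarrow> integrable M (\<lambda>\<omega>. \<phi> (\<lambda>i\<in>I. Z (\<tau>' i) \<omega>))"
    unfolding integrable_distr_eq[OF meas \<phi>, symmetric] distr_subsequence[OF inj(1) ne] distr_subsequence[OF inj(2) ne] ..
qed

lemma pair_law:
  fixes \<phi> :: "'b \<Rightarrow> 'b \<Rightarrow> real"
  assumes "case_prod \<phi> \<in> borel_measurable (N \<Otimes>\<^sub>M N)" "a \<noteq> b"
  shows "(\<integral>\<omega>. \<phi> (Z a \<omega>) (Z b \<omega>) \<partial>M) = (\<integral>\<omega>. \<phi> (Z 0 \<omega>) (Z 1 \<omega>) \<partial>M)"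
    and "integrable M (\<lambda>\<omega>. \<phi> (Z a \<omega>) (Z b \<omega>)) \<longleftrightarrow> integrable M (\<lambda>\<omega>. \<phi> (Z 0 \<omega>) (Z 1 \<omega>))"
proof -
  have "(\<lambda>z. (z 0, z 1)) \<in> measurable (\<Pi>\<^sub>M i\<in>{0, 1 :: nat}. N) (N \<Otimes>\<^sub>M N)" by measurable
  from measurable_compose[OF this assms(1)]
  have m: "(\<lambda>z. \<phi> (z 0) (z 1)) \<in> borel_measurable (\<Pi>\<^sub>M i\<in>{0, 1 :: nat}. N)" by simp
  have inj: "inj_on (\<lambda>i. if i = 0 then a else b) {0, 1 :: nat}" "inj_on (\<lambda>i. i) {0, 1 :: nat}"
    using assms(2) by (auto simp: inj_on_def)
  show "(\<integral>\<omega>. \<phi> (Z a \<omega>) (Z b \<omega>) \<partial>M) = (\<integral>\<omega>. \<phi> (Z 0 \<omega>) (Z 1 \<omega>) \<partial>M)"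
    "integrable M (\<lambda>\<omega>. \<phi> (Z a \<omega>) (Z b \<omega>)) \<longleftrightarrow> integrable M (\<lambda>\<omega>. \<phi> (Z 0 \<omega>) (Z 1 \<omega>))"
    using integral_subsequence[OF inj _ m] by simp_all
qed

lemma swap_law:
  fixes \<phi> :: "'b \<Rightarrow> 'b \<Rightarrow> 'b \<Rightarrow> 'b \<Rightarrow> real"
  assumes "(\<lambda>(a, b, c, d). \<phi> a b c d) \<in> borel_measurable (N \<Otimes>\<^sub>M N \<Otimes>\<^sub>M N \<Otimes>\<^sub>M N)"
    "distinct [a, b, c, d]"
  shows "(\<integral>\<omega>. \<phi> (Z a \<omega>) (Z b \<omega>) (Z c \<omega>) (Z d \<omega>) \<partial>M) = (\<integral>\<omega>. \<phi> (Z b \<omega>) (Z a \<omega>) (Z c \<omega>) (Z d \<omega>) \<partial>M)"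
proof -
  let ?I = "{0, 1, 2, 3 :: nat}"
  have "(\<lambda>z. (z 0, z 1, z 2, z 3)) \<in> measurable (\<Pi>\<^sub>M i\<in>?I. N) (N \<Otimes>\<^sub>M N \<Otimes>\<^sub>M N \<Otimes>\<^sub>M N)" by measurable
  from measurable_compose[OF this assms(1)]
  have m: "(\<lambda>z. \<phi> (z 0) (z 1) (z 2) (z 3)) \<in> borel_measurable (\<Pi>\<^sub>M i\<in>?I. N)" by simp
  have inj: "inj_on ((!) [a, b, c, d]) ?I" "inj_on ((!) [b, a, c, d]) ?I"
    using assms(2) by (auto simp: inj_on_def)
  show ?thesis using integral_subsequence(1)[OF inj _ m] by simp
qed

end

locale covariate_sample = iid_sequence M borel X + rkhs F ip
  for M :: "'a measure" and X :: "nat \<Rightarrow> 'a \<Rightarrow> 'x::topological_space"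
    and F :: "('x \<Rightarrow> real) set" and ip +
  assumes discrepancy_measurable: "case_prod (discrepancy F ip) \<in> borel_measurable (borel \<Otimes>\<^sub>M borel)"
    and discrepancy_integrable: "integrable M (\<lambda>\<omega>. discrepancy F ip (X 0 \<omega>) (X 1 \<omega>))"
begin

lemma discrepancy_compose:
  assumes "f \<in> measurable L borel" "g \<in> measurable L borel"
  shows "(\<lambda>\<omega>. discrepancy F ip (f \<omega>) (g \<omega>)) \<in> borel_measurable L"
  using measurable_compose[OF measurable_Pair[OF assms] discrepancy_measurable] by simp

lemma difference_form_compose:
  assumes "f \<in> measurable L borel" "g \<in> measurable L borel" "h \<in> measurable L borel" "k \<in> measurable L borel"
  shows "(\<lambda>\<omega>. difference_form F ip (f \<omega>) (g \<omega>) (h \<omega>) (k \<omega>)) \<in> borel_measurable L"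
  unfolding difference_form_def using assms
  by (intro borel_measurable_divide borel_measurable_diff borel_measurable_add borel_measurable_power
      borel_measurable_const discrepancy_compose)

definition truncated_form :: "real \<Rightarrow> 'x \<Rightarrow> 'x \<Rightarrow> 'x \<Rightarrow> 'x \<Rightarrow> real" where
  "truncated_form R u v y z =
     of_bool (discrepancy F ip u v \<le> R) * of_bool (discrepancy F ip y z \<le> R) * difference_form F ip u v y z"

lemma truncated_form_compose:
  assumes "f \<in> measurable L borel" "g \<in> measurable L borel" "h \<in> measurable L borel" "k \<in> measurable L borel"
  shows "(\<lambda>\<omega>. truncated_form R (f \<omega>) (g \<omega>) (h \<omega>) (k \<omega>)) \<in> borel_measurable L"
proof -
  note [measurable] = discrepancy_compose[OF assms(1,2)] discrepancy_compose[OF assms(3,4)]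
    difference_form_compose[OF assms]
  show ?thesis unfolding truncated_form_def by measurable
qed

lemma abs_truncated_form_le:
  assumes "0 \<le> R"
  shows "\<bar>truncated_form R u v y z\<bar> \<le> R\<^sup>2"
proof (cases "discrepancy F ip u v \<le> R \<and> discrepancy F ip y z \<le> R")
  case True
  then have "\<bar>difference_form F ip u v y z\<bar> \<le> R * R"
    using assms discrepancy_nonneg
    by (intro order.trans[OF abs_difference_form_le] mult_mono) auto
  then show ?thesis using True by (simp add: truncated_form_def power2_eq_square)
qed (auto simp: truncated_form_def)

lemma truncated_form_integrable:
  assumes "0 \<le> R"
  shows "integrable M (\<lambda>\<omega>. truncated_form R (X a \<omega>) (X b \<omega>) (X c \<omega>) (X d \<omega>))"
  using abs_truncated_form_le[OF assms]
  by (intro integrable_const_bound[of _ "R\<^sup>2"] truncated_form_compose term_measurable) auto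

text \<open>
  The form changes sign when its first two points are exchanged, while the joint law of the four
  points does not change.  Truncation preserves this because the discrepancy is symmetric.
\<close>

lemma expectation_truncated_form:
  assumes "distinct [a, b, c, d]"
  shows "expectation (\<lambda>\<omega>. truncated_form R (X a \<omega>) (X b \<omega>) (X c \<omega>) (X d \<omega>)) = 0"
proof -
  have m: "(\<lambda>(a, b, c, d). truncated_form R a b c d) \<in>
      borel_measurable (borel \<Otimes>\<^sub>M borel \<Otimes>\<^sub>M borel \<Otimes>\<^sub>M borel)"
    unfolding split_beta' by (intro truncated_form_compose) measurable
  have swap: "truncated_form R v u y z = - truncated_form R u v y z" for u v y z
    using discrepancy_commute[of u v] difference_form_swap[of F ip v u y z]
    by (simp add: truncated_form_def)
  have "expectation (\<lambda>\<omega>. truncated_form R (X b \<omega>) (X a \<omega>) (X c \<omega>) (X d \<omega>)) =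
      - expectation (\<lambda>\<omega>. truncated_form R (X a \<omega>) (X b \<omega>) (X c \<omega>) (X d \<omega>))"
    unfolding Bochner_Integration.integral_minus[symmetric]
    by (intro Bochner_Integration.integral_cong refl swap)
  then show ?thesis using swap_law[OF m assms] by simp
qed

definition tail_discrepancy :: "real \<Rightarrow> 'x \<Rightarrow> 'x \<Rightarrow> real" where
  "tail_discrepancy R u v = of_bool (R < discrepancy F ip u v) * discrepancy F ip u v"

lemma tail_discrepancy_compose:
  assumes "f \<in> measurable L borel" "g \<in> measurable L borel"
  shows "(\<lambda>\<omega>. tail_discrepancy R (f \<omega>) (g \<omega>)) \<in> borel_measurable L"
proof -
  note [measurable] = discrepancy_compose[OF assms]
  show ?thesis unfolding tail_discrepancy_def by measurable
qed

lemma tail_discrepancy_law: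
  assumes "a \<noteq> b"
  shows "integrable M (\<lambda>\<omega>. tail_discrepancy R (X a \<omega>) (X b \<omega>))"
    and "expectation (\<lambda>\<omega>. tail_discrepancy R (X a \<omega>) (X b \<omega>)) =
           expectation (\<lambda>\<omega>. tail_discrepancy R (X 0 \<omega>) (X 1 \<omega>))"
proof -
  have m: "case_prod (tail_discrepancy R) \<in> borel_measurable (borel \<Otimes>\<^sub>M borel)"
    unfolding split_beta' by (intro tail_discrepancy_compose) measurable
  have "integrable M (\<lambda>\<omega>. tail_discrepancy R (X 0 \<omega>) (X 1 \<omega>))"
    by (intro Bochner_Integration.integrable_bound[OF discrepancy_integrable]
        tail_discrepancy_compose term_measurable AE_I2) (auto simp: tail_discrepancy_def)
  then show "integrable M (\<lambda>\<omega>. tail_discrepancy R (X a \<omega>) (X b \<omega>))"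
    using pair_law(2)[OF m assms] by simp
  show "expectation (\<lambda>\<omega>. tail_discrepancy R (X a \<omega>) (X b \<omega>)) =
           expectation (\<lambda>\<omega>. tail_discrepancy R (X 0 \<omega>) (X 1 \<omega>))"
    by (rule pair_law(1)[OF m assms])
qed

lemma tail_discrepancy_tendsto_0:
  "(\<lambda>n. expectation (\<lambda>\<omega>. tail_discrepancy (real n) (X 0 \<omega>) (X 1 \<omega>))) \<longlonglongrightarrow> 0"
proof -
  have "(\<lambda>n. expectation (\<lambda>\<omega>. tail_discrepancy (real n) (X 0 \<omega>) (X 1 \<omega>))) \<longlonglongrightarrow> expectation (\<lambda>\<omega>. 0)"
  proof (rule integral_dominated_convergence[OF _ _ discrepancy_integrable])
    show "AE \<omega> in M. (\<lambda>n. tail_discrepancy (real n) (X 0 \<omega>) (X 1 \<omega>)) \<longlonglongrightarrow> 0"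
    proof (rule AE_I2)
      fix \<omega>
      obtain k :: nat where "discrepancy F ip (X 0 \<omega>) (X 1 \<omega>) \<le> real k" using real_arch_simple by blast
      then have "eventually (\<lambda>n. tail_discrepancy (real n) (X 0 \<omega>) (X 1 \<omega>) = 0) sequentially"
        by (auto simp: eventually_sequentially tail_discrepancy_def intro!: exI[of _ k])
      then show "(\<lambda>n. tail_discrepancy (real n) (X 0 \<omega>) (X 1 \<omega>)) \<longlonglongrightarrow> 0"
        by (rule tendsto_eventually)
    qed
    show "AE \<omega> in M. norm (tail_discrepancy (real n) (X 0 \<omega>) (X 1 \<omega>)) \<le> discrepancy F ip (X 0 \<omega>) (X 1 \<omega>)" for n
      by (auto simp: tail_discrepancy_def discrepancy_nonneg)
  qed (intro tail_discrepancy_compose term_measurable borel_measurable_const)+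
  then show ?thesis by simp
qed

lemma block_bound_eq:
  "block_bound F ip p R u v =
     2 * ((\<Sum>i<p. \<Sum>j<p. truncated_form R (u i) (v i) (u j) (v j)) / (real p)\<^sup>2)
     + 2 * ((\<Sum>j<p. tail_discrepancy R (u j) (v j)) / real p)"
  by (simp only: block_bound_def truncated_form_def tail_discrepancy_def)

text \<open>
  Different blocks are uncorrelated by \<open>expectation_truncated_form\<close>, so only the \<open>p\<close> diagonal terms,
  each at most \<open>R\<^sup>2\<close>, survive.
\<close>

lemma block_bound_expectation:
  assumes kl: "(k, l) \<in> treatment_pairs m" and p: "1 \<le> p" and R: "0 \<le> R"
  defines "B \<equiv> (\<lambda>\<omega>. block_bound F ip p R (\<lambda>j. X (m * j + k) \<omega>) (\<lambda>j. X (m * j + l) \<omega>))"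
  shows "integrable M B"
    and "expectation B \<le> 2 * (R\<^sup>2 / real p) + 2 * expectation (\<lambda>\<omega>. tail_discrepancy R (X 0 \<omega>) (X 1 \<omega>))"
proof -
  let ?f = "\<lambda>i j \<omega>. truncated_form R (X (m * i + k) \<omega>) (X (m * i + l) \<omega>) (X (m * j + k) \<omega>) (X (m * j + l) \<omega>)"
  let ?t = "\<lambda>j \<omega>. tail_discrepancy R (X (m * j + k) \<omega>) (X (m * j + l) \<omega>)"
  have kl': "k < m" "l < m" "k \<noteq> l" using kl by (auto simp: treatment_pairs_def)
  have ne: "m * i + a \<noteq> m * j + b" if "a < m" "b < m" "i \<noteq> j \<or> a \<noteq> b" for i j a b
  proof
    assume eq: "m * i + a = m * j + b"
    have "(m * i + a) mod m = a" "(m * j + b) mod m = b" "(m * i + a) div m = i" "(m * j + b) div m = j"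
      using that by simp_all
    then show False using eq that(3) by metis
  qed
  have tint: "integrable M (?t j)" and texp: "expectation (?t j) =
      expectation (\<lambda>\<omega>. tail_discrepancy R (X 0 \<omega>) (X 1 \<omega>))" for j
    using tail_discrepancy_law[of "m * j + k" "m * j + l"] kl' by simp_all
  have fint: "integrable M (?f i j)" for i j by (rule truncated_form_integrable[OF R])
  have fexp: "expectation (?f i j) \<le> (if i = j then R\<^sup>2 else 0)" for i j
  proof (cases "i = j")
    case True
    have "expectation (?f i j) \<le> expectation (\<lambda>_. R\<^sup>2)"
      using abs_truncated_form_le[OF R] by (intro integral_mono fint) (auto simp: abs_le_iff)
    then show ?thesis using True by (simp add: prob_space)
  next
    case False
    have "distinct [m * i + k, m * i + l, m * j + k, m * j + l]"
      using ne[of k l i i] ne[of k k i j] ne[of k l i j] ne[of l k i j] ne[of l l i j] ne[of k l j j] kl' False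
      by auto
    then show ?thesis using expectation_truncated_form False by simp
  qed
  show "integrable M B"
    unfolding B_def block_bound_eq using fint tint
    by (intro Bochner_Integration.integrable_add integrable_mult_right integrable_divide_zero
        Bochner_Integration.integrable_sum) auto
  have "expectation B = 2 * ((\<Sum>i<p. \<Sum>j<p. expectation (?f i j)) / (real p)\<^sup>2) + 2 * ((\<Sum>j<p. expectation (?t j)) / real p)"
    unfolding B_def block_bound_eq using fint tint
    by (simp add: Bochner_Integration.integral_sum)
  also have "\<dots> \<le> 2 * ((\<Sum>i<p. \<Sum>j<p. (if i = j then R\<^sup>2 else 0)) / (real p)\<^sup>2) + 2 * ((\<Sum>j<p. expectation (?t j)) / real p)"
    using fexp by (intro add_mono mult_left_mono divide_right_mono sum_mono) auto
  also have "\<dots> = 2 * (R\<^sup>2 / real p) + 2 * expectation (\<lambda>\<omega>. tail_discrepancy R (X 0 \<omega>) (X 1 \<omega>))"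
    using p by (simp add: texp power2_eq_square)
  finally show "expectation B \<le> 2 * (R\<^sup>2 / real p) + 2 * expectation (\<lambda>\<omega>. tail_discrepancy R (X 0 \<omega>) (X 1 \<omega>))" .
qed

definition total_block_bound :: "nat \<Rightarrow> nat \<Rightarrow> real \<Rightarrow> 'a \<Rightarrow> real" where
  "total_block_bound m p R \<omega> =
     (\<Sum>(k, l)\<in>treatment_pairs m. block_bound F ip p R (\<lambda>j. X (m * j + k) \<omega>) (\<lambda>j. X (m * j + l) \<omega>))"

lemma total_block_bound_integrable:
  assumes "1 \<le> p" "0 \<le> R"
  shows "integrable M (total_block_bound m p R)"
  unfolding total_block_bound_def split_beta'
  using block_bound_expectation(1)[OF _ assms] by (intro Bochner_Integration.integrable_sum) auto

text \<open>First \<open>R\<close> is chosen to make the tail expectation small, then \<open>p\<close> grows.\<close>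

lemma total_block_bound_small:
  assumes "0 < e"
  obtains R where "0 \<le> R" "eventually (\<lambda>p. expectation (total_block_bound m p R) \<le> e) sequentially"
proof -
  define c where "c = real (card (treatment_pairs m))"
  have "((\<lambda>n. c * (2 * expectation (\<lambda>\<omega>. tail_discrepancy (real n) (X 0 \<omega>) (X 1 \<omega>)))) \<longlongrightarrow> c * (2 * 0)) sequentially"
    by (intro tendsto_mult tendsto_const tail_discrepancy_tendsto_0)
  then have "eventually (\<lambda>n. c * (2 * expectation (\<lambda>\<omega>. tail_discrepancy (real n) (X 0 \<omega>) (X 1 \<omega>))) < e / 2) sequentially"
    using assms by (intro order_tendstoD(2)) auto
  then obtain n where n: "c * (2 * expectation (\<lambda>\<omega>. tail_discrepancy (real n) (X 0 \<omega>) (X 1 \<omega>))) < e / 2"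
    by (auto simp: eventually_sequentially)
  have "(\<lambda>p. c * (2 * ((real n)\<^sup>2 * inverse (real p)))) \<longlonglongrightarrow> c * (2 * ((real n)\<^sup>2 * 0))"
    by (intro tendsto_mult tendsto_const lim_inverse_n)
  then have ev: "eventually (\<lambda>p. c * (2 * ((real n)\<^sup>2 * inverse (real p))) < e / 2) sequentially"
    using assms by (intro order_tendstoD(2)) auto
  have "eventually (\<lambda>p. expectation (total_block_bound m p (real n)) \<le> e) sequentially"
    using ev eventually_ge_at_top[of 1]
  proof eventually_elim
    case (elim p)
    have "expectation (total_block_bound m p (real n)) = (\<Sum>z\<in>treatment_pairs m.
        expectation (\<lambda>\<omega>. block_bound F ip p (real n) (\<lambda>j. X (m * j + fst z) \<omega>) (\<lambda>j. X (m * j + snd z) \<omega>)))"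
      unfolding total_block_bound_def split_beta'
      using block_bound_expectation(1)[OF _ elim(2)] by (intro Bochner_Integration.integral_sum) auto
    also have "\<dots> \<le> (\<Sum>z\<in>treatment_pairs m.
        2 * ((real n)\<^sup>2 / real p) + 2 * expectation (\<lambda>\<omega>. tail_discrepancy (real n) (X 0 \<omega>) (X 1 \<omega>)))"
      using block_bound_expectation(2)[OF _ elim(2)] by (intro sum_mono) auto
    also have "\<dots> = c * (2 * ((real n)\<^sup>2 * inverse (real p)))
        + c * (2 * expectation (\<lambda>\<omega>. tail_discrepancy (real n) (X 0 \<omega>) (X 1 \<omega>)))"
      by (simp add: c_def distrib_left divide_inverse)
    also have "\<dots> \<le> e" using elim(1) n by simp
    finally show ?case .
  qed
  then show ?thesis using that[of "real n"] by simp
qed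

end

section \<open>Density of compactly supported functions\<close>

definition compactly_supported :: "('x::topological_space \<Rightarrow> real) \<Rightarrow> bool" where
  "compactly_supported g \<longleftrightarrow> continuous_on UNIV g \<and> compact (closure {x. g x \<noteq> 0})"

lemma compact_closure_mono:
  assumes "closure S \<subseteq> C" "compact C"
  shows "compact (closure S)"
  using compact_Int_closed[OF assms(2) closed_closure[of S]] Int_absorb1[OF assms(1)] by simp

lemma compactly_supported_add:
  fixes f g :: "'x::t2_space \<Rightarrow> real"
  assumes "compactly_supported f" "compactly_supported g"
  shows "compactly_supported (\<lambda>x. f x + g x)"
proof -
  have "closure {x. f x + g x \<noteq> 0} \<subseteq> closure {x. f x \<noteq> 0} \<union> closure {x. g x \<noteq> 0}"
    unfolding closure_Un[symmetric] by (intro closure_mono) auto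
  moreover have "compact (closure {x. f x \<noteq> 0} \<union> closure {x. g x \<noteq> 0})"
    using assms by (intro compact_Un) (simp_all add: compactly_supported_def)
  ultimately have "compact (closure {x. f x + g x \<noteq> 0})" by (rule compact_closure_mono)
  then show ?thesis using assms by (auto simp: compactly_supported_def intro!: continuous_intros)
qed

lemma compactly_supported_scale:
  fixes g :: "'x::t2_space \<Rightarrow> real"
  assumes "compactly_supported g"
  shows "compactly_supported (\<lambda>x. g x * c)"
proof -
  have "closure {x. g x * c \<noteq> 0} \<subseteq> closure {x. g x \<noteq> 0}" by (intro closure_mono) auto
  then have "compact (closure {x. g x * c \<noteq> 0})"
    by (rule compact_closure_mono) (use assms in \<open>simp add: compactly_supported_def\<close>)
  then show ?thesis using assms by (auto simp: compactly_supported_def intro!: continuous_intros)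
qed

lemma compactly_supported_bounded:
  assumes "compactly_supported g"
  obtains G where "0 \<le> G" "\<And>x. \<bar>g x\<bar> \<le> G"
proof -
  let ?C = "closure {x. g x \<noteq> 0}"
  have "compact (g ` ?C)"
    using assms by (intro compact_continuous_image)
      (auto simp: compactly_supported_def intro: continuous_on_subset)
  from compact_imp_bounded[OF this] obtain B where B: "\<And>y. y \<in> g ` ?C \<Longrightarrow> norm y \<le> B"
    by (auto simp: bounded_iff)
  have "\<bar>g x\<bar> \<le> max 0 B" for x
    using B[of "g x"] closure_subset[of "{x. g x \<noteq> 0}"] by (cases "g x = 0") auto
  then show ?thesis using that[of "max 0 B"] by simp
qed

lemma compactly_supported_measurable: "compactly_supported g \<Longrightarrow> g \<in> borel_measurable borel"
  by (simp add: compactly_supported_def borel_measurable_continuous_onI)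

lemma compactly_supported_integrable:
  assumes "finite_measure P" "sets P = sets borel" "compactly_supported g"
  shows "integrable P g"
proof -
  interpret finite_measure P by fact
  obtain G where "\<And>x. \<bar>g x\<bar> \<le> G" using compactly_supported_bounded[OF assms(3)] by blast
  then show ?thesis
    using compactly_supported_measurable[OF assms(3)] assms(2)
    by (intro integrable_const_bound[of _ G]) (simp_all cong: measurable_cong_sets)
qed

text \<open>
  A compact neighbourhood of \<open>K\<close> confines the support; its complement is joined to \<open>L\<close> before
  Urysohn's lemma is applied.
\<close>

lemma locally_compact_Urysohn:
  fixes K L :: "'x::t2_space set"
  assumes lc: "locally_compact_space (euclidean :: 'x topology)"
    and K: "compact K" and L: "closed L" and disj: "K \<inter> L = {}"
  obtains g where "compactly_supported g" "\<And>x. 0 \<le> g x" "\<And>x. g x \<le> 1"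
    "\<And>x. x \<in> K \<Longrightarrow> g x = 1" "\<And>x. x \<in> L \<Longrightarrow> g x = 0"
proof -
  have H: "Hausdorff_space (euclidean :: 'x topology)" 
    using hausdorff by (fastforce simp: Hausdorff_space_def disjnt_def)
  obtain U C where U: "open U" "compact C" "K \<subseteq> U" "U \<subseteq> C"
    using lc K H locally_compact_space_compact_closed_compact[of "euclidean :: 'x topology"]
    by (auto simp: compactin_euclidean_iff)
  have "completely_regular_space (euclidean :: 'x topology)"
    using lc H locally_compact_regular_imp_completely_regular_space by blast
  moreover have "closedin euclidean (L \<union> - U)" "disjnt K (L \<union> - U)"
    using L U disj by (auto simp: disjnt_def closed_Compl intro: closed_Un)
  ultimately obtain g where g: "continuous_map euclidean (top_of_set {0..1::real}) g"
      "g ` (L \<union> - U) \<subseteq> {0}" "g ` K \<subseteq> {1}"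
    using Urysohn_completely_regular_compact_closed[of 0 1 "euclidean :: 'x topology" K "L \<union> - U"] K
    by (auto simp: compactin_euclidean_iff)
  have cont: "continuous_on UNIV g" and range: "\<And>x. g x \<in> {0..1}"
    using g(1) by (auto simp: continuous_map_in_subtopology)
  have "{x. g x \<noteq> 0} \<subseteq> C" using g(2) U(4) by auto
  then have "closure {x. g x \<noteq> 0} \<subseteq> C"
    using U(2) compact_imp_closed by (intro closure_minimal) auto
  then have "compact (closure {x. g x \<noteq> 0})"
    using U(2) by (rule compact_closure_mono)
  then have "compactly_supported g" using cont by (simp add: compactly_supported_def)
  moreover have "0 \<le> g x" "g x \<le> 1" for x using range[of x] by auto
  moreover have "x \<in> K \<Longrightarrow> g x = 1" "x \<in> L \<Longrightarrow> g x = 0" for x using g(2,3) by auto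
  ultimately show ?thesis by (rule that)
qed

lemma inner_regular_compact:
  assumes fin: "finite_measure P" and P: "sets P = sets borel" and reg: "inner_regular P"
    and A: "A \<in> sets borel" and e: "0 < e"
  obtains K where "K \<subseteq> A" "compact K" "measure P A - measure P K < e"
proof -
  interpret finite_measure P by fact
  show ?thesis
  proof (cases "measure P A < e")
    case True
    then show ?thesis using that[of "{}"] by simp
  next
    case False
    then have "ennreal (measure P A - e) < emeasure P A"
      using e by (auto simp: emeasure_eq_measure ennreal_less_iff)
    also have "\<dots> = (SUP K\<in>{K. K \<subseteq> A \<and> compact K}. emeasure P K)"
      using reg A by (simp add: inner_regular_def)
    finally obtain K where K: "K \<subseteq> A" "compact K" "ennreal (measure P A - e) < emeasure P K"
      by (auto simp: less_SUP_iff)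
    then show ?thesis using that[of K] False by (auto simp: emeasure_eq_measure ennreal_less_iff)
  qed
qed

text \<open>
  Inner regularity of \<open>A\<close> and of its complement gives compact sets \<open>K\<close> and \<open>L\<close> that together carry
  almost all mass; a Urysohn function that separates them agrees with the indicator there.
\<close>

lemma compactly_supported_approx_indicator:
  fixes P :: "'x::t2_space measure"
  assumes fin: "finite_measure P" and P: "sets P = sets borel" and reg: "inner_regular P"
    and lc: "locally_compact_space (euclidean :: 'x topology)"
    and A: "A \<in> sets borel" and e: "0 < e"
  obtains g where "compactly_supported g" "(\<integral>x. \<bar>indicator A x - g x\<bar> \<partial>P) \<le> e"
proof -
  interpret finite_measure P by fact
  have sp: "space P = UNIV" using P sets_eq_imp_space_eq by fastforce
  obtain K where K: "K \<subseteq> A" "compact K" "measure P A - measure P K < e / 2"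
    using inner_regular_compact[OF fin P reg A, of "e / 2"] e by auto
  obtain L where L: "L \<subseteq> - A" "compact L" "measure P (- A) - measure P L < e / 2"
    using inner_regular_compact[OF fin P reg borel_comp[OF A], of "e / 2"] e by auto
  have meas: "K \<in> sets P" "L \<in> sets P" "A \<in> sets P" "- A \<in> sets P"
    using K L A P by (auto simp: borel_compact)
  obtain g where g: "compactly_supported g" "\<And>x. 0 \<le> g x" "\<And>x. g x \<le> 1"
    "\<And>x. x \<in> K \<Longrightarrow> g x = 1" "\<And>x. x \<in> L \<Longrightarrow> g x = 0"
    using locally_compact_Urysohn[OF lc K(2) compact_imp_closed[OF L(2)]] K(1) L(1) by blast
  have "\<bar>indicator A x - g x\<bar> \<le> indicator (A - K) x + indicator (- A - L) x" for x
    using g(2-5)[of x] K(1) L(1) by (auto simp: indicator_def abs_le_iff)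
  then have "(\<integral>x. \<bar>indicator A x - g x\<bar> \<partial>P) \<le> (\<integral>x. indicator (A - K) x + indicator (- A - L) x \<partial>P)"
    using compactly_supported_integrable[OF fin P g(1)] meas
    by (intro integral_mono) (auto simp: emeasure_eq_measure)
  also have "\<dots> = measure P (A - K) + measure P (- A - L)"
    using meas by (simp add: emeasure_eq_measure sp)
  also have "\<dots> \<le> e"
    using K L meas by (simp add: finite_measure_Diff)
  finally show ?thesis using that g(1) by blast
qed

lemma compactly_supported_dense_L1:
  fixes P :: "'x::t2_space measure" and f :: "'x \<Rightarrow> real"
  assumes fin: "finite_measure P" and P: "sets P = sets borel" and reg: "inner_regular P"
    and lc: "locally_compact_space (euclidean :: 'x topology)"
    and f: "integrable P f" and e: "0 < e"
  shows "\<exists>g. compactly_supported g \<and> (\<integral>x. \<bar>f x - g x\<bar> \<partial>P) \<le> e"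
  using f e
proof (induction arbitrary: e)
  case (base A c)
  obtain g where g: "compactly_supported g" "(\<integral>x. \<bar>indicator A x - g x\<bar> \<partial>P) \<le> e / (\<bar>c\<bar> + 1)"
    using compactly_supported_approx_indicator[OF fin P reg lc, of A "e / (\<bar>c\<bar> + 1)"] base P by auto
  have "(\<integral>x. \<bar>indicator A x *\<^sub>R c - g x * c\<bar> \<partial>P) = (\<integral>x. \<bar>indicator A x - g x\<bar> \<partial>P) * \<bar>c\<bar>"
    by (simp add: left_diff_distrib[symmetric] abs_mult)
  also have "\<dots> \<le> e / (\<bar>c\<bar> + 1) * \<bar>c\<bar>" using g(2) by (intro mult_right_mono) auto
  also have "\<dots> \<le> e" using base(3) by (simp add: field_simps)
  finally show ?case using compactly_supported_scale[OF g(1)] by blast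
next
  case (add f1 f2)
  obtain g1 where g1: "compactly_supported g1" "(\<integral>x. \<bar>f1 x - g1 x\<bar> \<partial>P) \<le> e / 2"
    using add.IH(1)[of "e / 2"] add.prems by auto
  obtain g2 where g2: "compactly_supported g2" "(\<integral>x. \<bar>f2 x - g2 x\<bar> \<partial>P) \<le> e / 2"
    using add.IH(2)[of "e / 2"] add.prems by auto
  note int = compactly_supported_integrable[OF fin P]
  have "(\<integral>x. \<bar>f1 x + f2 x - (g1 x + g2 x)\<bar> \<partial>P) \<le> (\<integral>x. \<bar>f1 x - g1 x\<bar> + \<bar>f2 x - g2 x\<bar> \<partial>P)"
    using add.hyps int[OF g1(1)] int[OF g2(1)] by (intro integral_mono) auto
  also have "\<dots> = (\<integral>x. \<bar>f1 x - g1 x\<bar> \<partial>P) + (\<integral>x. \<bar>f2 x - g2 x\<bar> \<partial>P)"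
    using add.hyps int[OF g1(1)] int[OF g2(1)] by (intro Bochner_Integration.integral_add) auto
  also have "\<dots> \<le> e" using g1(2) g2(2) by simp
  finally show ?case using compactly_supported_add[OF g1(1) g2(1)] by blast
next
  case (lim f s)
  have "(\<lambda>i. \<integral>x. \<bar>f x - s i x\<bar> \<partial>P) \<longlonglongrightarrow> (\<integral>x. 0 \<partial>P)"
  proof (rule integral_dominated_convergence[where w = "\<lambda>x. 3 * \<bar>f x\<bar>"])
    show "AE x in P. (\<lambda>i. \<bar>f x - s i x\<bar>) \<longlonglongrightarrow> 0"
    proof (rule AE_I2)
      fix x assume "x \<in> space P"
      then have "(\<lambda>i. f x - s i x) \<longlonglongrightarrow> f x - f x"
        using lim.hyps(2) by (intro tendsto_diff tendsto_const)
      then show "(\<lambda>i. \<bar>f x - s i x\<bar>) \<longlonglongrightarrow> 0" by (simp add: tendsto_rabs_zero)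
    qed
    show "AE x in P. norm \<bar>f x - s i x\<bar> \<le> 3 * \<bar>f x\<bar>" for i
    proof (rule AE_I2)
      fix x assume "x \<in> space P"
      then have "\<bar>s i x\<bar> \<le> 2 * \<bar>f x\<bar>" using lim.hyps(3)[of x i] by simp
      then show "norm \<bar>f x - s i x\<bar> \<le> 3 * \<bar>f x\<bar>" by simp
    qed
  qed (use lim.hyps(1,4) in auto)
  then have "eventually (\<lambda>i. (\<integral>x. \<bar>f x - s i x\<bar> \<partial>P) < e / 2) sequentially"
    using lim.prems by (intro order_tendstoD(2)) auto
  then obtain i where i: "(\<integral>x. \<bar>f x - s i x\<bar> \<partial>P) < e / 2"
    by (auto simp: eventually_sequentially)
  obtain g where g: "compactly_supported g" "(\<integral>x. \<bar>s i x - g x\<bar> \<partial>P) \<le> e / 2"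
    using lim.IH[of "e / 2" i] lim.prems by auto
  note int = compactly_supported_integrable[OF fin P g(1)]
  have "(\<integral>x. \<bar>f x - g x\<bar> \<partial>P) \<le> (\<integral>x. \<bar>f x - s i x\<bar> + \<bar>s i x - g x\<bar> \<partial>P)"
    using lim.hyps(1)[of i] lim.hyps(4) int by (intro integral_mono) auto
  also have "\<dots> = (\<integral>x. \<bar>f x - s i x\<bar> \<partial>P) + (\<integral>x. \<bar>s i x - g x\<bar> \<partial>P)"
    using lim.hyps(1)[of i] lim.hyps(4) int by (intro Bochner_Integration.integral_add) auto
  also have "\<dots> \<le> e" using i g(2) by simp
  finally show ?case using g(1) by blast
qed

section \<open>Regression functions\<close>

lemma subalgebra_vimage_algebra:
  assumes "T \<in> measurable M S"
  shows "subalgebra M (vimage_algebra (space M) T S)"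
  using assms unfolding subalgebra_def
  by (simp add: measurable_iff_sets measurable_space Pi_iff)

text \<open>
  The conditional expectation is taken on the joint law of \<open>(U, V)\<close> given the first coordinate.
  There it is a function \<open>h\<close> of a pair that is measurable with respect to the first coordinate, hence
  constant on fibres, so \<open>x \<mapsto> h (x, 0)\<close> is a measurable function on the value space of \<open>U\<close>.  Square
  integrability is Jensen's inequality.
\<close>

lemma (in prob_space) regression_function:
  fixes V :: "'a \<Rightarrow> real"
  assumes U[measurable]: "U \<in> measurable M S" and V[measurable]: "V \<in> borel_measurable M"
    and V2: "integrable M (\<lambda>\<omega>. (V \<omega>)\<^sup>2)"
  obtains f where "f \<in> borel_measurable S" "integrable M (\<lambda>\<omega>. (f (U \<omega>))\<^sup>2)"
    "\<And>A. A \<in> sets S \<Longrightarrow> expectation (\<lambda>\<omega>. indicator A (U \<omega>) * (V \<omega> - f (U \<omega>))) = 0"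
proof -
  have V1: "integrable M V" by (rule square_integrable_imp_integrable[OF V V2])
  define N where "N = distr M (S \<Otimes>\<^sub>M borel) (\<lambda>\<omega>. (U \<omega>, V \<omega>))"
  have UV[measurable]: "(\<lambda>\<omega>. (U \<omega>, V \<omega>)) \<in> measurable M (S \<Otimes>\<^sub>M borel)" by measurable
  interpret N: prob_space N unfolding N_def by (rule prob_space_distr[OF UV])
  define G where "G = vimage_algebra (space N) fst S"
  have fst_N: "fst \<in> measurable N S" by (simp add: N_def)
  have snd_N[measurable]: "snd \<in> borel_measurable N" by (simp add: N_def)
  have spN: "space N = space S \<times> UNIV" by (simp add: N_def space_pair_measure)
  have "subalgebra N G"
    unfolding G_def by (rule subalgebra_vimage_algebra[OF fst_N])
  then interpret G: finite_measure_subalgebra N G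
    by unfold_locales
  have int1: "integrable N snd" and int2: "integrable N (\<lambda>z. (snd z)\<^sup>2)"
    using V1 V2 by (simp_all add: N_def integrable_distr_eq)
  define h where "h = real_cond_exp N G snd"
  have hG[measurable]: "h \<in> borel_measurable G" by (simp add: h_def)
  have hN[measurable]: "h \<in> borel_measurable N" by (simp add: h_def)
  define f where "f = (\<lambda>x. h (x, 0))"
  \<comment> \<open>The level set of \<open>h\<close> through \<open>(x, 0)\<close> is a preimage under \<open>fst\<close>, so it contains all \<open>(x, y)\<close>.\<close>
  have hf: "h z = f (fst z)" if z: "z \<in> space N" for z
  proof -
    have "h -` {f (fst z)} \<inter> space G \<in> sets G" by (rule measurable_sets[OF hG]) simp
    then obtain B where "h -` {f (fst z)} \<inter> space N = fst -` B \<inter> space N"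
      using fst_N by (auto simp: G_def sets_vimage_algebra2 measurable_space Pi_iff)
    moreover have "(fst z, 0) \<in> h -` {f (fst z)} \<inter> space N" using z by (auto simp: f_def spN)
    ultimately have "z \<in> h -` {f (fst z)} \<inter> space N" using z by auto
    then show ?thesis by simp
  qed
  have f[measurable]: "f \<in> borel_measurable S"
  proof -
    have "h \<in> borel_measurable (S \<Otimes>\<^sub>M borel)" using hN by (simp add: N_def)
    then show ?thesis unfolding f_def by measurable
  qed
  have "integrable N (\<lambda>z. (h z)\<^sup>2)"
  proof (rule Bochner_Integration.integrable_bound[OF G.real_cond_exp_int(1)[OF int2]])
    show "(\<lambda>z. (h z)\<^sup>2) \<in> borel_measurable N" by measurable
    have "AE z in N. (h z)\<^sup>2 \<le> real_cond_exp N G (\<lambda>z. (snd z)\<^sup>2) z"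
      unfolding h_def
      by (rule G.real_cond_exp_jensens_inequality(2)[OF int1, of UNIV])
        (auto simp: int2 convex_power2)
    then show "AE z in N. norm ((h z)\<^sup>2) \<le> norm (real_cond_exp N G (\<lambda>z. (snd z)\<^sup>2) z)"
      by eventually_elim simp
  qed
  then have "integrable N (\<lambda>z. (f (fst z))\<^sup>2)"
    using Bochner_Integration.integrable_cong[OF refl, of N "\<lambda>z. (h z)\<^sup>2" "\<lambda>z. (f (fst z))\<^sup>2"] hf by simp
  then have f2: "integrable M (\<lambda>\<omega>. (f (U \<omega>))\<^sup>2)"
    by (simp add: N_def integrable_distr_eq)
  have "expectation (\<lambda>\<omega>. indicator A (U \<omega>) * (V \<omega> - f (U \<omega>))) = 0" if A[measurable]: "A \<in> sets S" for A
  proof -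
    have AG: "fst -` A \<inter> space N \<in> sets G" unfolding G_def by (rule in_vimage_algebra[OF A])
    have intf: "integrable N (\<lambda>z. f (fst z))"
      using square_integrable_imp_integrable[OF _ f2] by (simp add: N_def integrable_distr_eq)
    have "(\<integral>z\<in>fst -` A \<inter> space N. snd z \<partial>N) = (\<integral>z\<in>fst -` A \<inter> space N. h z \<partial>N)"
      unfolding h_def by (rule G.real_cond_exp_intA[OF int1 AG])
    moreover have "(\<integral>z\<in>fst -` A \<inter> space N. snd z \<partial>N) = (\<integral>z. indicator A (fst z) * snd z \<partial>N)"
      unfolding set_lebesgue_integral_def
      by (intro Bochner_Integration.integral_cong refl) (simp add: indicator_def)
    moreover have "(\<integral>z\<in>fst -` A \<inter> space N. h z \<partial>N) = (\<integral>z. indicator A (fst z) * f (fst z) \<partial>N)"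
      unfolding set_lebesgue_integral_def
      by (intro Bochner_Integration.integral_cong refl) (simp add: indicator_def hf)
    ultimately have "(\<integral>z. indicator A (fst z) * snd z \<partial>N) = (\<integral>z. indicator A (fst z) * f (fst z) \<partial>N)"
      by simp
    then have "expectation (\<lambda>\<omega>. indicator A (U \<omega>) * V \<omega>) = expectation (\<lambda>\<omega>. indicator A (U \<omega>) * f (U \<omega>))"
      by (simp add: N_def integral_distr)
    moreover have "integrable M (\<lambda>\<omega>. indicator A (U \<omega>) * V \<omega>)"
      by (rule Bochner_Integration.integrable_bound[OF V1]) (auto simp: indicator_def)
    moreover have "integrable M (\<lambda>\<omega>. indicator A (U \<omega>) * f (U \<omega>))"
      by (rule Bochner_Integration.integrable_bound[OF square_integrable_imp_integrable[OF _ f2]])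
        (auto simp: indicator_def)
    ultimately show ?thesis by (simp add: right_diff_distrib)
  qed
  then show ?thesis using that f f2 by blast
qed

section \<open>Orthogonality of residuals given covariates and assignment\<close>

lemma (in prob_space) vimage_subalgebra:
  assumes "T \<in> measurable M S"
  shows "finite_measure_subalgebra M (vimage_algebra (space M) T S)"
  using subalgebra_vimage_algebra[OF assms] by unfold_locales

text \<open>
  Conditional independence is stated for events.  Both sides integrate \<open>\<phi>\<close> against a finite measure
  on pairs, namely the law of \<open>(T, V)\<close> weighted by the indicator and by its conditional probability.
  The two measures agree on rectangles, hence everywhere.
\<close>

lemma (in prob_space) cond_indep_integral:
  fixes \<phi> :: "'c \<times> 'd \<Rightarrow> real"
  assumes T[measurable]: "T \<in> measurable M S" and U[measurable]: "U \<in> measurable M N"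
    and V[measurable]: "V \<in> measurable M L"
    and ci: "cond_indep M (vimage_algebra (space M) T S) N U L V"
    and A[measurable]: "A \<in> sets N" and \<phi>[measurable]: "\<phi> \<in> borel_measurable (S \<Otimes>\<^sub>M L)"
  shows "expectation (\<lambda>\<omega>. indicator A (U \<omega>) * \<phi> (T \<omega>, V \<omega>)) =
    expectation (\<lambda>\<omega>. cond_prob_given M (vimage_algebra (space M) T S) {\<omega> \<in> space M. U \<omega> \<in> A} \<omega> * \<phi> (T \<omega>, V \<omega>))"
proof -
  define G where "G = vimage_algebra (space M) T S"
  interpret G: finite_measure_subalgebra M G unfolding G_def by (rule vimage_subalgebra[OF T])
  let ?E = "{\<omega> \<in> space M. U \<omega> \<in> A}"
  define Q where "Q = cond_prob_given M G ?E"
  have QG[measurable]: "Q \<in> borel_measurable G" by (simp add: Q_def cond_prob_given_def)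
  have QM[measurable]: "Q \<in> borel_measurable M" by (simp add: Q_def cond_prob_given_def)
  have E[measurable]: "?E \<in> sets M" by measurable
  have Q0: "AE \<omega> in M. 0 \<le> Q \<omega>"
    unfolding Q_def cond_prob_given_def by (rule G.real_cond_exp_pos) auto
  have Qint: "integrable M Q"
    unfolding Q_def cond_prob_given_def by (rule G.real_cond_exp_int) (simp add: emeasure_eq_measure)
  define \<mu> where "\<mu> = distr (density M (\<lambda>\<omega>. ennreal (indicator ?E \<omega>))) (S \<Otimes>\<^sub>M L) (\<lambda>\<omega>. (T \<omega>, V \<omega>))"
  define \<nu> where "\<nu> = distr (density M (\<lambda>\<omega>. ennreal (Q \<omega>))) (S \<Otimes>\<^sub>M L) (\<lambda>\<omega>. (T \<omega>, V \<omega>))"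
  have TV[measurable]: "(\<lambda>\<omega>. (T \<omega>, V \<omega>)) \<in> measurable M (S \<Otimes>\<^sub>M L)" by measurable
  have emeasure_weighted: "emeasure (distr (density M (\<lambda>\<omega>. ennreal (q \<omega>))) (S \<Otimes>\<^sub>M L) (\<lambda>\<omega>. (T \<omega>, V \<omega>))) (C \<times> B)
      = ennreal (expectation (\<lambda>\<omega>. q \<omega> * (indicator C (T \<omega>) * indicator B (V \<omega>))))"
    if q: "integrable M q" "AE \<omega> in M. 0 \<le> q \<omega>" and C[measurable]: "C \<in> sets S" and B[measurable]: "B \<in> sets L" for q C B
  proof -
    have [measurable]: "q \<in> borel_measurable M" using q(1) by auto
    have "emeasure (distr (density M (\<lambda>\<omega>. ennreal (q \<omega>))) (S \<Otimes>\<^sub>M L) (\<lambda>\<omega>. (T \<omega>, V \<omega>))) (C \<times> B)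
        = (\<integral>\<^sup>+\<omega>. ennreal (q \<omega>) * indicator ((\<lambda>\<omega>. (T \<omega>, V \<omega>)) -` (C \<times> B) \<inter> space M) \<omega> \<partial>M)"
      by (subst emeasure_distr) (auto simp: emeasure_density measurable_sets[OF TV])
    also have "\<dots> = (\<integral>\<^sup>+\<omega>. ennreal (q \<omega> * (indicator C (T \<omega>) * indicator B (V \<omega>))) \<partial>M)"
      by (intro nn_integral_cong) (auto simp: indicator_def)
    also have "\<dots> = ennreal (expectation (\<lambda>\<omega>. q \<omega> * (indicator C (T \<omega>) * indicator B (V \<omega>))))"
    proof (rule nn_integral_eq_integral)
      show "integrable M (\<lambda>\<omega>. q \<omega> * (indicator C (T \<omega>) * indicator B (V \<omega>)))"
        by (rule Bochner_Integration.integrable_bound[OF q(1)]) (auto simp: indicator_def)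
      show "AE \<omega> in M. 0 \<le> q \<omega> * (indicator C (T \<omega>) * indicator B (V \<omega>))"
        using q(2) by eventually_elim (auto simp: indicator_def)
    qed
    finally show ?thesis .
  qed
  have rect: "emeasure \<mu> (C \<times> B) = emeasure \<nu> (C \<times> B)" if C[measurable]: "C \<in> sets S" and B[measurable]: "B \<in> sets L" for C B
  proof -
    let ?V = "{\<omega> \<in> space M. V \<omega> \<in> B}" and ?UV = "{\<omega> \<in> space M. U \<omega> \<in> A \<and> V \<omega> \<in> B}"
    have CG[measurable]: "(\<lambda>\<omega>. indicator C (T \<omega>) :: real) \<in> borel_measurable G"
    proof -
      have "T \<in> measurable G S" unfolding G_def
        by (rule measurable_vimage_algebra1) (use measurable_space[OF T] in auto)
      then show ?thesis by measurable
    qed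
    have CM[measurable]: "(\<lambda>\<omega>. indicator C (T \<omega>) :: real) \<in> borel_measurable M" by measurable
    have bounded: "integrable M (\<lambda>\<omega>. indicator C (T \<omega>) * indicator D \<omega> :: real)" if [measurable]: "D \<in> sets M" for D
      by (rule integrable_const_bound[of _ 1]) (auto simp: indicator_def)
    have "expectation (\<lambda>\<omega>. indicator ?E \<omega> * (indicator C (T \<omega>) * indicator B (V \<omega>)) :: real) =
        expectation (\<lambda>\<omega>. indicator C (T \<omega>) * indicator ?UV \<omega>)"
      by (intro Bochner_Integration.integral_cong refl) (auto simp: indicator_def)
    also have "\<dots> = expectation (\<lambda>\<omega>. indicator C (T \<omega>) * cond_prob_given M G ?UV \<omega>)"
      unfolding cond_prob_given_def by (rule G.real_cond_exp_intg(2)[symmetric]) (auto intro: bounded)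
    also have "\<dots> = expectation (\<lambda>\<omega>. indicator C (T \<omega>) * Q \<omega> * cond_prob_given M G ?V \<omega>)"
    proof (rule integral_cong_AE)
      have "AE \<omega> in M. cond_prob_given M G ?UV \<omega> = Q \<omega> * cond_prob_given M G ?V \<omega>"
        using ci A B unfolding cond_indep_def G_def Q_def by blast
      then show "AE \<omega> in M. indicator C (T \<omega>) * cond_prob_given M G ?UV \<omega>
          = indicator C (T \<omega>) * Q \<omega> * cond_prob_given M G ?V \<omega>"
        by eventually_elim simp
    qed (simp_all add: cond_prob_given_def)
    also have "\<dots> = expectation (\<lambda>\<omega>. indicator C (T \<omega>) * Q \<omega> * indicator ?V \<omega>)"
      unfolding cond_prob_given_def
    proof (rule G.real_cond_exp_intg(2))
      show "integrable M (\<lambda>\<omega>. indicator C (T \<omega>) * Q \<omega> * indicator ?V \<omega>)"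
        by (rule Bochner_Integration.integrable_bound[OF Qint]) (auto simp: indicator_def)
    qed measurable
    also have "\<dots> = expectation (\<lambda>\<omega>. Q \<omega> * (indicator C (T \<omega>) * indicator B (V \<omega>)))"
      by (intro Bochner_Integration.integral_cong refl) (auto simp: indicator_def)
    finally have eq: "expectation (\<lambda>\<omega>. indicator ?E \<omega> * (indicator C (T \<omega>) * indicator B (V \<omega>)) :: real) =
        expectation (\<lambda>\<omega>. Q \<omega> * (indicator C (T \<omega>) * indicator B (V \<omega>)))" .
    have "integrable M (indicator ?E :: 'a \<Rightarrow> real)" by (simp add: emeasure_eq_measure)
    then show ?thesis
      unfolding \<mu>_def \<nu>_def using eq emeasure_weighted[OF _ _ C B, of "indicator ?E"]
        emeasure_weighted[OF Qint Q0 C B] by simp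
  qed
  \<comment> \<open>Rectangles form an intersection-stable generator.\<close>
  have "\<mu> = \<nu>"
  proof (rule measure_eqI_generator_eq[where E = "{C \<times> B |C B. C \<in> sets S \<and> B \<in> sets L}"
        and \<Omega> = "space S \<times> space L" and A = "\<lambda>_. space S \<times> space L"])
    show "Int_stable {C \<times> B |C B. C \<in> sets S \<and> B \<in> sets L}" by (rule Int_stable_pair_measure_generator)
    show "emeasure \<mu> (space S \<times> space L) \<noteq> \<infinity>"
      unfolding \<mu>_def by (subst emeasure_weighted) (simp_all add: emeasure_eq_measure)
    show "emeasure \<mu> R = emeasure \<nu> R" if "R \<in> {C \<times> B |C B. C \<in> sets S \<and> B \<in> sets L}" for R
      using that rect by blast
  qed (auto simp: \<mu>_def \<nu>_def sets_pair_measure dest: sets.sets_into_space)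
  then have "(\<integral>z. \<phi> z \<partial>\<mu>) = (\<integral>z. \<phi> z \<partial>\<nu>)" by simp
  then have "expectation (\<lambda>\<omega>. indicator ?E \<omega> * \<phi> (T \<omega>, V \<omega>)) = expectation (\<lambda>\<omega>. Q \<omega> * \<phi> (T \<omega>, V \<omega>))"
    unfolding \<mu>_def \<nu>_def using Q0 by (simp add: integral_distr integral_density)
  moreover have "expectation (\<lambda>\<omega>. indicator ?E \<omega> * \<phi> (T \<omega>, V \<omega>)) = expectation (\<lambda>\<omega>. indicator A (U \<omega>) * \<phi> (T \<omega>, V \<omega>))"
    by (intro Bochner_Integration.integral_cong refl) (auto simp: indicator_def)
  ultimately show ?thesis by (simp add: Q_def G_def)
qed

context iid_sequence
begin

text \<open>
  Integrate out unit \<open>i\<close> first, with all other units held fixed: the event in \<open>C\<close> then constrains only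
  the covariate of unit \<open>i\<close>, and the residual has mean \<open>0\<close> on every such event.
\<close>

lemma residual_product_orthogonal:
  fixes e :: "'b \<Rightarrow> real" and u :: "'b \<Rightarrow> 'c" and n :: nat
  defines "T \<equiv> (\<lambda>\<omega>. \<lambda>l\<in>{..<n}. u (Z l \<omega>))"
  assumes u[measurable]: "u \<in> measurable N S" and e[measurable]: "e \<in> borel_measurable N"
    and centred: "\<And>A. A \<in> sets S \<Longrightarrow> expectation (\<lambda>\<omega>. indicator A (u (Z 0 \<omega>)) * e (Z 0 \<omega>)) = 0"
    and ij: "i < n" "j < n" "i \<noteq> j"
    and C[measurable]: "C \<in> sets (\<Pi>\<^sub>M l\<in>{..<n}. S)"
    and int: "integrable M (\<lambda>\<omega>. e (Z i \<omega>) * e (Z j \<omega>))"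
  shows "expectation (\<lambda>\<omega>. indicator C (T \<omega>) * (e (Z i \<omega>) * e (Z j \<omega>))) = 0"
proof -
  define \<mu> where "\<mu> = distr M N (Z 0)"
  note Z0[measurable] = term_measurable[of 0]
  interpret \<mu>: prob_space \<mu> unfolding \<mu>_def by (rule prob_space_distr[OF Z0])
  interpret P: product_sigma_finite "\<lambda>_::nat. \<mu>" by standard
  have sets_\<mu>[measurable_cong]: "sets \<mu> = sets N" by (simp add: \<mu>_def)
  let ?I = "{..<n} - {i}"
  have I: "insert i ?I = {..<n}" using ij by auto
  have law: "distr M (\<Pi>\<^sub>M l\<in>{..<n}. N) (\<lambda>\<omega>. \<lambda>l\<in>{..<n}. Z l \<omega>) = (\<Pi>\<^sub>M l\<in>{..<n}. \<mu>)"
    unfolding \<mu>_def using distr_subsequence[of "\<lambda>l. l" "{..<n}"] ij by auto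
  define \<phi> where "\<phi> = (\<lambda>z. indicator C (\<lambda>l\<in>{..<n}. u (z l)) * (e (z i) * e (z j)))"
  have vec: "(\<lambda>\<omega>. \<lambda>l\<in>{..<n}. Z l \<omega>) \<in> measurable M (\<Pi>\<^sub>M l\<in>{..<n}. N)"
    by (intro measurable_restrict term_measurable)
  have uvec: "(\<lambda>z. \<lambda>l\<in>{..<n}. u (z l)) \<in> measurable (\<Pi>\<^sub>M l\<in>{..<n}. N) (\<Pi>\<^sub>M l\<in>{..<n}. S)"
    by measurable
  have comp: "(\<lambda>z. z l) \<in> measurable (\<Pi>\<^sub>M l\<in>{..<n}. N) N" if "l < n" for l
    using that by (intro measurable_component_singleton) auto
  have [measurable]: "(\<lambda>z. e (z i)) \<in> borel_measurable (\<Pi>\<^sub>M l\<in>{..<n}. N)"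
    "(\<lambda>z. e (z j)) \<in> borel_measurable (\<Pi>\<^sub>M l\<in>{..<n}. N)"
    "(\<lambda>z. indicator C (\<lambda>l\<in>{..<n}. u (z l)) :: real) \<in> borel_measurable (\<Pi>\<^sub>M l\<in>{..<n}. N)"
    using measurable_compose[OF comp[OF ij(1)] e] measurable_compose[OF comp[OF ij(2)] e]
      measurable_compose[OF uvec borel_measurable_indicator[OF C]] by simp_all
  have \<phi>: "\<phi> \<in> borel_measurable (\<Pi>\<^sub>M l\<in>{..<n}. N)" unfolding \<phi>_def by measurable
  have T: "\<phi> (\<lambda>l\<in>{..<n}. Z l \<omega>) = indicator C (T \<omega>) * (e (Z i \<omega>) * e (Z j \<omega>))" for \<omega>
  proof -
    have "(\<lambda>l\<in>{..<n}. u ((\<lambda>l\<in>{..<n}. Z l \<omega>) l)) = T \<omega>" by (auto simp: T_def)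
    then show ?thesis using ij by (simp add: \<phi>_def)
  qed
  have "integrable M (\<lambda>\<omega>. \<phi> (\<lambda>l\<in>{..<n}. Z l \<omega>))"
  proof (rule Bochner_Integration.integrable_bound[OF int])
    show "(\<lambda>\<omega>. \<phi> (\<lambda>l\<in>{..<n}. Z l \<omega>)) \<in> borel_measurable M" by (rule measurable_compose[OF vec \<phi>])
  qed (simp add: T indicator_def)
  then have int_\<phi>: "integrable (\<Pi>\<^sub>M l\<in>{..<n}. \<mu>) \<phi>"
    unfolding law[symmetric] by (simp add: integrable_distr_eq[OF vec \<phi>])
  have "expectation (\<lambda>\<omega>. indicator C (T \<omega>) * (e (Z i \<omega>) * e (Z j \<omega>))) = (\<integral>z. \<phi> z \<partial>(\<Pi>\<^sub>M l\<in>{..<n}. \<mu>))"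
    unfolding law[symmetric] by (simp add: integral_distr[OF vec \<phi>] T)
  also have "\<dots> = (\<integral>z. (\<integral>y. \<phi> (z(i := y)) \<partial>\<mu>) \<partial>(\<Pi>\<^sub>M l\<in>?I. \<mu>))"
    using P.product_integral_insert[of ?I i \<phi>] int_\<phi> unfolding I by simp
  also have "\<dots> = (\<integral>z. 0 \<partial>(\<Pi>\<^sub>M l\<in>?I. \<mu>))"
  proof (rule Bochner_Integration.integral_cong[OF refl])
    fix z assume z: "z \<in> space (\<Pi>\<^sub>M l\<in>?I. \<mu>)"
    define x where "x = (\<lambda>l\<in>?I. u (z l))"
    have x: "x \<in> space (\<Pi>\<^sub>M l\<in>?I. S)"
      using z measurable_space[OF u] sets_eq_imp_space_eq[OF sets_\<mu>]
      by (auto simp: x_def space_PiM PiE_iff)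
    define A where "A = (\<lambda>a. x(i := a)) -` C \<inter> space S"
    have A: "A \<in> sets S"
    proof -
      have "(\<lambda>a. x(i := a)) \<in> measurable S (\<Pi>\<^sub>M l\<in>insert i ?I. S)"
        using x by (intro measurable_component_update) auto
      then show ?thesis unfolding A_def I by (rule measurable_sets[OF _ C])
    qed
    have "\<phi> (z(i := y)) = e (z j) * (indicator A (u y) * e y)" if "y \<in> space \<mu>" for y
    proof -
      have "(\<lambda>l\<in>{..<n}. u ((z(i := y)) l)) = x(i := u y)" using ij by (auto simp: x_def fun_eq_iff)
      moreover have "u y \<in> space S"
        using that measurable_space[OF u] sets_eq_imp_space_eq[OF sets_\<mu>] by auto
      ultimately show ?thesis using ij by (simp add: \<phi>_def A_def indicator_def)
    qed
    then have "(\<integral>y. \<phi> (z(i := y)) \<partial>\<mu>) = (\<integral>y. e (z j) * (indicator A (u y) * e y) \<partial>\<mu>)"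
      by (intro Bochner_Integration.integral_cong) auto
    also have "\<dots> = 0"
      using centred[OF A] A unfolding \<mu>_def by (simp add: integral_distr)
    finally show "(\<integral>y. \<phi> (z(i := y)) \<partial>\<mu>) = 0" .
  qed
  finally show ?thesis by simp
qed

text \<open>
  The previous lemma says that the conditional expectation of the product given all covariates
  vanishes, so events may be replaced by functions of the covariates.
\<close>

lemma residual_product_orthogonal_measurable:
  fixes e :: "'b \<Rightarrow> real" and u :: "'b \<Rightarrow> 'c" and n :: nat
  defines "T \<equiv> (\<lambda>\<omega>. \<lambda>l\<in>{..<n}. u (Z l \<omega>))"
  assumes u: "u \<in> measurable N S" and e: "e \<in> borel_measurable N"
    and centred: "\<And>A. A \<in> sets S \<Longrightarrow> expectation (\<lambda>\<omega>. indicator A (u (Z 0 \<omega>)) * e (Z 0 \<omega>)) = 0"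
    and ij: "i < n" "j < n" "i \<noteq> j"
    and int: "integrable M (\<lambda>\<omega>. e (Z i \<omega>) * e (Z j \<omega>))"
    and Q: "Q \<in> borel_measurable (vimage_algebra (space M) T (\<Pi>\<^sub>M l\<in>{..<n}. S))"
    and intQ: "integrable M (\<lambda>\<omega>. Q \<omega> * (e (Z i \<omega>) * e (Z j \<omega>)))"
  shows "expectation (\<lambda>\<omega>. Q \<omega> * (e (Z i \<omega>) * e (Z j \<omega>))) = 0"
proof -
  have T: "T \<in> measurable M (\<Pi>\<^sub>M l\<in>{..<n}. S)"
    unfolding T_def by (intro measurable_restrict measurable_compose[OF term_measurable u])
  define G where "G = vimage_algebra (space M) T (\<Pi>\<^sub>M l\<in>{..<n}. S)"
  interpret G: finite_measure_subalgebra M G unfolding G_def by (rule vimage_subalgebra[OF T])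
  have ee: "(\<lambda>\<omega>. e (Z i \<omega>) * e (Z j \<omega>)) \<in> borel_measurable M" using int by auto
  have zero: "AE \<omega> in M. real_cond_exp M G (\<lambda>\<omega>. e (Z i \<omega>) * e (Z j \<omega>)) \<omega> = 0"
  proof (rule G.real_cond_exp_charact[OF _ int])
    fix A assume "A \<in> sets G"
    then obtain C where C: "C \<in> sets (\<Pi>\<^sub>M l\<in>{..<n}. S)" "A = T -` C \<inter> space M"
      using T by (auto simp: G_def sets_vimage_algebra2 measurable_space Pi_iff)
    have "(\<integral>\<omega>\<in>A. e (Z i \<omega>) * e (Z j \<omega>) \<partial>M) = expectation (\<lambda>\<omega>. indicator C (T \<omega>) * (e (Z i \<omega>) * e (Z j \<omega>)))"
      unfolding set_lebesgue_integral_def C(2)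
      by (intro Bochner_Integration.integral_cong refl) (simp add: indicator_def)
    also have "\<dots> = 0"
      unfolding T_def by (rule residual_product_orthogonal[OF u e centred ij C(1) int])
    finally show "(\<integral>\<omega>\<in>A. e (Z i \<omega>) * e (Z j \<omega>) \<partial>M) = (\<integral>\<omega>\<in>A. 0 \<partial>M)" by (simp add: set_lebesgue_integral_def)
  qed simp_all
  have "expectation (\<lambda>\<omega>. Q \<omega> * (e (Z i \<omega>) * e (Z j \<omega>))) =
      expectation (\<lambda>\<omega>. Q \<omega> * real_cond_exp M G (\<lambda>\<omega>. e (Z i \<omega>) * e (Z j \<omega>)) \<omega>)"
    using G.real_cond_exp_intg(2)[OF intQ Q[folded G_def] ee] by simp
  also have "\<dots> = expectation (\<lambda>\<omega>. 0)"
  proof (rule integral_cong_AE)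
    show "AE \<omega> in M. Q \<omega> * real_cond_exp M G (\<lambda>\<omega>. e (Z i \<omega>) * e (Z j \<omega>)) \<omega> = 0"
      using zero by eventually_elim simp
    have "Q \<in> borel_measurable M"
      using measurable_from_subalg[OF G.subalg Q[folded G_def]] .
    then show "(\<lambda>\<omega>. Q \<omega> * real_cond_exp M G (\<lambda>\<omega>. e (Z i \<omega>) * e (Z j \<omega>)) \<omega>) \<in> borel_measurable M"
      by measurable
  qed simp
  finally show ?thesis by simp
qed

end

text \<open>
  Expand the square over the values of \<open>W\<close> and over pairs of units.  By \<open>cond_indep_integral\<close> the
  indicator of \<open>W = w\<close> may be replaced by its conditional probability given the covariates, after which
  \<open>residual_product_orthogonal_measurable\<close> removes all pairs of distinct units.  The maps \<open>h i\<close>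
  express the residuals through the covariates \<open>T\<close> and the outcomes \<open>V\<close>, the variables in which
  conditional independence is given.
\<close>

lemma (in iid_sequence) weighted_residuals_second_moment:
  fixes e :: "'b \<Rightarrow> real" and u :: "'b \<Rightarrow> 'c" and n :: nat and c :: "'w \<Rightarrow> nat \<Rightarrow> real"
  defines "T \<equiv> (\<lambda>\<omega>. \<lambda>l\<in>{..<n}. u (Z l \<omega>))"
  assumes u: "u \<in> measurable N S" and e: "e \<in> borel_measurable N"
    and e2: "integrable M (\<lambda>\<omega>. (e (Z 0 \<omega>))\<^sup>2)"
    and centred: "\<And>A. A \<in> sets S \<Longrightarrow> expectation (\<lambda>\<omega>. indicator A (u (Z 0 \<omega>)) * e (Z 0 \<omega>)) = 0"
    and V: "V \<in> measurable M L"
    and h: "\<And>i. i < n \<Longrightarrow> h i \<in> borel_measurable ((\<Pi>\<^sub>M l\<in>{..<n}. S) \<Otimes>\<^sub>M L)"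
    and eh: "\<And>i \<omega>. i < n \<Longrightarrow> e (Z i \<omega>) = h i (T \<omega>, V \<omega>)"
    and W: "W \<in> measurable M (count_space \<Omega>)" and fin: "finite \<Omega>"
    and ci: "cond_indep M (vimage_algebra (space M) T (\<Pi>\<^sub>M l\<in>{..<n}. S)) (count_space \<Omega>) W L V"
    and c: "\<And>w i. \<bar>c w i\<bar> \<le> b"
  shows "integrable M (\<lambda>\<omega>. (\<Sum>i<n. c (W \<omega>) i * e (Z i \<omega>))\<^sup>2)"
    and "expectation (\<lambda>\<omega>. (\<Sum>i<n. c (W \<omega>) i * e (Z i \<omega>))\<^sup>2) \<le>
      real n * b\<^sup>2 * expectation (\<lambda>\<omega>. (e (Z 0 \<omega>))\<^sup>2)"
proof -
  have T: "T \<in> measurable M (\<Pi>\<^sub>M l\<in>{..<n}. S)"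
    unfolding T_def by (intro measurable_restrict measurable_compose[OF term_measurable u])
  have eZ[measurable]: "(\<lambda>\<omega>. e (Z i \<omega>)) \<in> borel_measurable M" for i
    by (rule measurable_compose[OF term_measurable e])
  have sq: "(\<lambda>z. (e z)\<^sup>2) \<in> borel_measurable N" using e by measurable
  have int2: "integrable M (\<lambda>\<omega>. (e (Z i \<omega>))\<^sup>2)" for i
    using e2 unfolding integrable_distr_eq[OF term_measurable sq, symmetric] identical[of i] .
  have exp2: "expectation (\<lambda>\<omega>. (e (Z i \<omega>))\<^sup>2) = expectation (\<lambda>\<omega>. (e (Z 0 \<omega>))\<^sup>2)" for i
    unfolding integral_distr[OF term_measurable sq, symmetric] identical[of i] ..
  have intee: "integrable M (\<lambda>\<omega>. e (Z i \<omega>) * e (Z j \<omega>))" for i j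
  proof (rule Bochner_Integration.integrable_bound[OF Bochner_Integration.integrable_add[OF int2[of i] int2[of j]]])
    show "AE \<omega> in M. norm (e (Z i \<omega>) * e (Z j \<omega>)) \<le> norm ((e (Z i \<omega>))\<^sup>2 + (e (Z j \<omega>))\<^sup>2)"
    proof (rule AE_I2)
      fix \<omega>
      have "2 * \<bar>e (Z i \<omega>)\<bar> * \<bar>e (Z j \<omega>)\<bar> \<le> (e (Z i \<omega>))\<^sup>2 + (e (Z j \<omega>))\<^sup>2"
        using sum_squares_bound[of "\<bar>e (Z i \<omega>)\<bar>" "\<bar>e (Z j \<omega>)\<bar>"] by simp
      moreover have "0 \<le> \<bar>e (Z i \<omega>)\<bar> * \<bar>e (Z j \<omega>)\<bar>" by simp
      ultimately have "\<bar>e (Z i \<omega>)\<bar> * \<bar>e (Z j \<omega>)\<bar> \<le> (e (Z i \<omega>))\<^sup>2 + (e (Z j \<omega>))\<^sup>2"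
        by linarith
      then show "norm (e (Z i \<omega>) * e (Z j \<omega>)) \<le> norm ((e (Z i \<omega>))\<^sup>2 + (e (Z j \<omega>))\<^sup>2)"
        by (simp add: abs_mult)
    qed
  qed measurable
  define A where "A = (\<lambda>w \<omega>. indicator {w} (W \<omega>) :: real)"
  have A[measurable]: "A w \<in> borel_measurable M" for w
    unfolding A_def by (rule measurable_compose[OF W]) simp
  have A01: "0 \<le> A w \<omega>" "A w \<omega> \<le> 1" for w \<omega> by (simp_all add: A_def)
  have intA: "integrable M (\<lambda>\<omega>. A w \<omega> * (e (Z i \<omega>) * e (Z j \<omega>)))" for w i j
  proof (rule Bochner_Integration.integrable_bound[OF intee[of i j]])
    show "AE \<omega> in M. norm (A w \<omega> * (e (Z i \<omega>) * e (Z j \<omega>))) \<le> norm (e (Z i \<omega>) * e (Z j \<omega>))"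
      by (auto simp: A_def indicator_def)
  qed measurable
  \<comment> \<open>Conditional independence trades the indicator for a function of the covariates.\<close>
  have off_diagonal: "expectation (\<lambda>\<omega>. A w \<omega> * (e (Z i \<omega>) * e (Z j \<omega>))) = 0"
    if w: "w \<in> \<Omega>" and ij: "i < n" "j < n" "i \<noteq> j" for w i j
  proof -
    define G where "G = vimage_algebra (space M) T (\<Pi>\<^sub>M l\<in>{..<n}. S)"
    interpret G: finite_measure_subalgebra M G unfolding G_def by (rule vimage_subalgebra[OF T])
    let ?E = "{\<omega> \<in> space M. W \<omega> \<in> {w}}"
    have E: "?E \<in> sets M"
    proof -
      have "W -` {w} \<inter> space M \<in> sets M" using w by (intro measurable_sets[OF W]) auto
      moreover have "W -` {w} \<inter> space M = ?E" by auto
      ultimately show ?thesis by simp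
    qed
    have intE: "integrable M (indicator ?E :: 'a \<Rightarrow> real)" using E by (simp add: emeasure_eq_measure)
    define Q where "Q = cond_prob_given M G ?E"
    have QG: "Q \<in> borel_measurable G" and QM[measurable]: "Q \<in> borel_measurable M"
      by (simp_all add: Q_def cond_prob_given_def)
    have "AE \<omega> in M. 0 \<le> Q \<omega>" "AE \<omega> in M. Q \<omega> \<le> 1"
      unfolding Q_def cond_prob_given_def
      by (rule G.real_cond_exp_ge_c[OF intE] G.real_cond_exp_le_c[OF intE]; simp add: indicator_def)+
    then have Q01: "AE \<omega> in M. \<bar>Q \<omega>\<bar> \<le> 1" by eventually_elim simp
    have intQ: "integrable M (\<lambda>\<omega>. Q \<omega> * (e (Z i \<omega>) * e (Z j \<omega>)))"
    proof (rule Bochner_Integration.integrable_bound[OF intee[of i j]])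
      show "AE \<omega> in M. norm (Q \<omega> * (e (Z i \<omega>) * e (Z j \<omega>))) \<le> norm (e (Z i \<omega>) * e (Z j \<omega>))"
        using Q01 by eventually_elim (simp add: abs_mult mult_left_le_one_le)
    qed measurable
    have hh: "(\<lambda>z. h i z * h j z) \<in> borel_measurable ((\<Pi>\<^sub>M l\<in>{..<n}. S) \<Otimes>\<^sub>M L)"
      using h[OF ij(1)] h[OF ij(2)] by (rule borel_measurable_times)
    have "expectation (\<lambda>\<omega>. A w \<omega> * (e (Z i \<omega>) * e (Z j \<omega>))) =
        expectation (\<lambda>\<omega>. indicator {w} (W \<omega>) * (h i (T \<omega>, V \<omega>) * h j (T \<omega>, V \<omega>)))"
      using eh ij by (simp add: A_def)
    also have "\<dots> = expectation (\<lambda>\<omega>. Q \<omega> * (h i (T \<omega>, V \<omega>) * h j (T \<omega>, V \<omega>)))"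
      using cond_indep_integral[OF T W V ci _ hh, of "{w}"] w by (simp add: Q_def G_def)
    also have "\<dots> = expectation (\<lambda>\<omega>. Q \<omega> * (e (Z i \<omega>) * e (Z j \<omega>)))"
      using eh ij by simp
    also have "\<dots> = 0"
      by (rule residual_product_orthogonal_measurable[OF u e centred ij intee
            QG[unfolded G_def T_def] intQ])
    finally show ?thesis .
  qed
  have partition: "(\<Sum>w\<in>\<Omega>. A w \<omega> * t w) = t (W \<omega>)" if "\<omega> \<in> space M" for \<omega> and t :: "'w \<Rightarrow> real"
  proof -
    have "W \<omega> \<in> \<Omega>" using measurable_space[OF W that] by simp
    moreover have "(\<Sum>w\<in>\<Omega>. A w \<omega> * t w) = (\<Sum>w\<in>\<Omega>. if W \<omega> = w then t w else 0)"
      by (intro sum.cong) (auto simp: A_def indicator_def)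
    ultimately show ?thesis using fin by simp
  qed
  have expand: "(\<Sum>i<n. c (W \<omega>) i * e (Z i \<omega>))\<^sup>2 =
      (\<Sum>w\<in>\<Omega>. \<Sum>i<n. \<Sum>j<n. c w i * c w j * (A w \<omega> * (e (Z i \<omega>) * e (Z j \<omega>))))"
    if "\<omega> \<in> space M" for \<omega>
  proof -
    have "(\<Sum>i<n. c (W \<omega>) i * e (Z i \<omega>))\<^sup>2 = (\<Sum>w\<in>\<Omega>. A w \<omega> * (\<Sum>i<n. c w i * e (Z i \<omega>))\<^sup>2)"
      by (rule partition[OF that, symmetric])
    also have "\<dots> = (\<Sum>w\<in>\<Omega>. \<Sum>i<n. \<Sum>j<n. c w i * c w j * (A w \<omega> * (e (Z i \<omega>) * e (Z j \<omega>))))"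
      unfolding power2_eq_square sum_product by (simp add: sum_distrib_left mult_ac)
    finally show ?thesis .
  qed
  have int_sum: "integrable M (\<lambda>\<omega>. \<Sum>w\<in>\<Omega>. \<Sum>i<n. \<Sum>j<n. c w i * c w j * (A w \<omega> * (e (Z i \<omega>) * e (Z j \<omega>))))"
    by (intro Bochner_Integration.integrable_sum integrable_mult_right intA)
  show "integrable M (\<lambda>\<omega>. (\<Sum>i<n. c (W \<omega>) i * e (Z i \<omega>))\<^sup>2)"
    by (rule Bochner_Integration.integrable_cong[OF refl expand, THEN iffD2, OF _ int_sum])
  have "expectation (\<lambda>\<omega>. (\<Sum>i<n. c (W \<omega>) i * e (Z i \<omega>))\<^sup>2) =
      expectation (\<lambda>\<omega>. \<Sum>w\<in>\<Omega>. \<Sum>i<n. \<Sum>j<n. c w i * c w j * (A w \<omega> * (e (Z i \<omega>) * e (Z j \<omega>))))"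
    by (rule Bochner_Integration.integral_cong[OF refl expand])
  also have "\<dots> = (\<Sum>w\<in>\<Omega>. \<Sum>i<n. \<Sum>j<n. c w i * c w j * expectation (\<lambda>\<omega>. A w \<omega> * (e (Z i \<omega>) * e (Z j \<omega>))))"
    using intA by (simp add: Bochner_Integration.integral_sum)
  also have "\<dots> = (\<Sum>w\<in>\<Omega>. \<Sum>i<n. \<Sum>j<n. if i = j then (c w i)\<^sup>2 * expectation (\<lambda>\<omega>. A w \<omega> * (e (Z i \<omega>))\<^sup>2) else 0)"
    using off_diagonal by (intro sum.cong refl) (auto simp: power2_eq_square)
  also have "\<dots> = (\<Sum>w\<in>\<Omega>. \<Sum>i<n. (c w i)\<^sup>2 * expectation (\<lambda>\<omega>. A w \<omega> * (e (Z i \<omega>))\<^sup>2))"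
    by simp
  also have "\<dots> \<le> (\<Sum>w\<in>\<Omega>. \<Sum>i<n. b\<^sup>2 * expectation (\<lambda>\<omega>. A w \<omega> * (e (Z i \<omega>))\<^sup>2))"
  proof (intro sum_mono mult_right_mono)
    show "(c w i)\<^sup>2 \<le> b\<^sup>2" for w i using power_mono[OF c, of w i 2] by simp
    show "0 \<le> expectation (\<lambda>\<omega>. A w \<omega> * (e (Z i \<omega>))\<^sup>2)" for w i
      using A01 by (intro Bochner_Integration.integral_nonneg) simp
  qed
  also have "\<dots> = b\<^sup>2 * (\<Sum>i<n. \<Sum>w\<in>\<Omega>. expectation (\<lambda>\<omega>. A w \<omega> * (e (Z i \<omega>))\<^sup>2))"
    by (subst sum.swap) (simp add: sum_distrib_left)
  also have "\<dots> = b\<^sup>2 * (\<Sum>i<n. expectation (\<lambda>\<omega>. \<Sum>w\<in>\<Omega>. A w \<omega> * (e (Z i \<omega>))\<^sup>2))"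
    using intA by (simp add: Bochner_Integration.integral_sum power2_eq_square)
  also have "\<dots> = b\<^sup>2 * (\<Sum>i<n. expectation (\<lambda>\<omega>. (e (Z i \<omega>))\<^sup>2))"
  proof -
    have "expectation (\<lambda>\<omega>. \<Sum>w\<in>\<Omega>. A w \<omega> * (e (Z i \<omega>))\<^sup>2) = expectation (\<lambda>\<omega>. (e (Z i \<omega>))\<^sup>2)" for i
      by (rule Bochner_Integration.integral_cong[OF refl partition])
    then show ?thesis by simp
  qed
  also have "\<dots> = real n * b\<^sup>2 * expectation (\<lambda>\<omega>. (e (Z 0 \<omega>))\<^sup>2)"
    by (subst sum.cong[OF refl exp2]) simp
  finally show "expectation (\<lambda>\<omega>. (\<Sum>i<n. c (W \<omega>) i * e (Z i \<omega>))\<^sup>2) \<le>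
      real n * b\<^sup>2 * expectation (\<lambda>\<omega>. (e (Z 0 \<omega>))\<^sup>2)" .
qed

section \<open>Imbalance under an optimal design\<close>

lemma group_mean_close:
  assumes w: "w \<in> assignments m p" and k: "k < m" and p: "1 \<le> p"
    and close: "\<And>i. \<bar>v i - v' i\<bar> \<le> \<eta>"
  shows "\<bar>group_mean m p w k v - group_mean m p w k v'\<bar> \<le> \<eta>"
proof -
  have card: "card {i. i < m * p \<and> w i = k} = p" using w k by (simp add: assignments_def)
  have "\<bar>\<Sum>i | i < m * p \<and> w i = k. v i - v' i\<bar> \<le> (\<Sum>i | i < m * p \<and> w i = k. \<eta>)"
    using close by (intro order.trans[OF sum_abs] sum_mono) auto
  also have "\<dots> = real p * \<eta>" by (simp add: card)
  finally have "\<bar>\<Sum>i | i < m * p \<and> w i = k. v i - v' i\<bar> \<le> real p * \<eta>" .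
  moreover have "group_mean m p w k v - group_mean m p w k v' =
      (\<Sum>i | i < m * p \<and> w i = k. v i - v' i) / real p"
    by (simp add: group_mean_def sum_subtractf diff_divide_distrib)
  ultimately show ?thesis using p by (simp add: abs_divide divide_le_eq mult.commute)
qed

lemma optimal_design_support:
  assumes "0 < m" "D = PSOD F ip m p \<or> is_MSOD F ip m p D"
  shows "set_pmf (D x) \<subseteq> assignments m p"
proof -
  have "D x \<in> mixed_strategies m p"
    using assms(2) PSOD_mixed_strategy[OF assms(1), of F ip p x] by (auto simp: is_MSOD_def is_arg_min_def)
  then show ?thesis by (simp add: mixed_strategies_def)
qed

text \<open>
  Replacing \<open>g\<close> by \<open>f\<close> changes an imbalance by at most \<open>2 * \<eta>\<close>, and \<open>(a + d)\<^sup>2 \<le> 2 * a\<^sup>2 + 2 * d\<^sup>2\<close> gives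
  the constants \<open>2\<close> and \<open>8\<close>.  The truncation at \<open>1\<close> passes through the average over the design and then
  onto \<open>MP2\<close> of the block assignment.
\<close>

lemma (in rkhs) optimal_design_truncated:
  assumes m: "2 \<le> m" and p: "1 \<le> p" and D: "D = PSOD F ip m p \<or> is_MSOD F ip m p D"
    and f: "f \<in> F" and fg: "\<And>z. \<bar>f z - g z\<bar> \<le> \<eta>" and kl: "(k, l) \<in> treatment_pairs m"
    and \<Omega>: "finite \<Omega>" "assignments m p \<subseteq> \<Omega>"
  shows "(\<Sum>w\<in>\<Omega>. pmf (D x) w * min 1 ((imbalance m p x w k l g)\<^sup>2)) \<le>
    2 * (ip f f + 1) *
      (\<Sum>(k, l)\<in>treatment_pairs m. block_bound F ip p R (\<lambda>j. x (m * j + k)) (\<lambda>j. x (m * j + l)))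
    + 8 * \<eta>\<^sup>2"
proof -
  let ?A = "assignments m p"
  define V where "V = MP2 F ip m p x (block_assignment m p)"
  have m0: "0 < m" using m by simp
  note supp = optimal_design_support[OF m0 D, of x]
  have total: "(\<Sum>w\<in>?A. pmf (D x) w) = 1" by (rule sum_pmf_eq_1[OF finite_assignments supp])
  have zero: "pmf (D x) w = 0" if "w \<notin> ?A" for w using supp that by (auto simp: set_pmf_iff)
  have "(\<Sum>w\<in>\<Omega>. pmf (D x) w * min 1 ((imbalance m p x w k l g)\<^sup>2)) =
      (\<Sum>w\<in>?A. pmf (D x) w * min 1 ((imbalance m p x w k l g)\<^sup>2))"
    using \<Omega> zero by (intro sum.mono_neutral_right) auto
  also have "\<dots> \<le> min 1 (\<Sum>w\<in>?A. pmf (D x) w * (imbalance m p x w k l g)\<^sup>2)"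
  proof (rule min.boundedI)
    have "(\<Sum>w\<in>?A. pmf (D x) w * min 1 ((imbalance m p x w k l g)\<^sup>2)) \<le> (\<Sum>w\<in>?A. pmf (D x) w * 1)"
      by (intro sum_mono mult_left_mono) auto
    then show "(\<Sum>w\<in>?A. pmf (D x) w * min 1 ((imbalance m p x w k l g)\<^sup>2)) \<le> 1" by (simp add: total)
  qed (intro sum_mono mult_left_mono, auto)
  also have "\<dots> \<le> min 1 (2 * (ip f f + 1) * V + 8 * \<eta>\<^sup>2)"
  proof (rule min.mono)
    have "(imbalance m p x w k l g)\<^sup>2 \<le> 2 * (imbalance m p x w k l f)\<^sup>2 + 8 * \<eta>\<^sup>2" if w: "w \<in> ?A" for w
    proof -
      have klm: "k < m" "l < m" using kl by (auto simp: treatment_pairs_def)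
      define d where "d = imbalance m p x w k l g - imbalance m p x w k l f"
      have "\<bar>d\<bar> \<le> 2 * \<eta>"
        using group_mean_close[OF w klm(1) p, of "\<lambda>i. f (x i)" "\<lambda>i. g (x i)" \<eta>]
          group_mean_close[OF w klm(2) p, of "\<lambda>i. f (x i)" "\<lambda>i. g (x i)" \<eta>] fg
        by (simp add: d_def imbalance_def)
      then have "d\<^sup>2 \<le> (2 * \<eta>)\<^sup>2" using power_mono[of "\<bar>d\<bar>" "2 * \<eta>" 2] by simp
      moreover have "(imbalance m p x w k l g)\<^sup>2 = (imbalance m p x w k l f + d)\<^sup>2" by (simp add: d_def)
      moreover have "(imbalance m p x w k l f + d)\<^sup>2 \<le> 2 * (imbalance m p x w k l f)\<^sup>2 + 2 * d\<^sup>2"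
        using sum_squares_bound[of "imbalance m p x w k l f" d] by (simp add: power2_sum)
      ultimately show ?thesis by (simp add: power_mult_distrib)
    qed
    then have "(\<Sum>w\<in>?A. pmf (D x) w * (imbalance m p x w k l g)\<^sup>2) \<le>
        (\<Sum>w\<in>?A. pmf (D x) w * (2 * (imbalance m p x w k l f)\<^sup>2 + 8 * \<eta>\<^sup>2))"
      by (intro sum_mono mult_left_mono) auto
    also have "\<dots> = 2 * (\<Sum>w\<in>?A. pmf (D x) w * (imbalance m p x w k l f)\<^sup>2) + 8 * \<eta>\<^sup>2 * (\<Sum>w\<in>?A. pmf (D x) w)"
      by (simp add: sum_distrib_left sum.distrib[symmetric] algebra_simps)
    also have "\<dots> \<le> 2 * ((ip f f + 1) * V) + 8 * \<eta>\<^sup>2"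
      using optimal_design_imbalance[OF m D f kl block_assignment_mem[OF m0], of x]
      unfolding total V_def by simp
    finally show "(\<Sum>w\<in>?A. pmf (D x) w * (imbalance m p x w k l g)\<^sup>2) \<le> 2 * (ip f f + 1) * V + 8 * \<eta>\<^sup>2"
      by (simp only: mult.assoc)
  qed simp
  also have "\<dots> \<le> 2 * (ip f f + 1) * min 1 V + 8 * \<eta>\<^sup>2"
  proof (cases "V \<le> 1")
    case True
    then show ?thesis by (simp add: min.absorb2 min.coboundedI2)
  next
    case False
    have "1 \<le> 2 * (ip f f + 1) + 8 * \<eta>\<^sup>2"
      using ip_nonneg[OF f] by (intro add_increasing2) simp_all
    then show ?thesis using False by (simp add: min.absorb1 min.coboundedI1)
  qed
  also have "\<dots> \<le> 2 * (ip f f + 1) *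
      (\<Sum>(k, l)\<in>treatment_pairs m. block_bound F ip p R (\<lambda>j. x (m * j + k)) (\<lambda>j. x (m * j + l)))
      + 8 * \<eta>\<^sup>2"
    unfolding V_def using ip_nonneg[OF f] min_MP2_block_le[OF m, of p x R]
    by (intro add_right_mono mult_left_mono) auto
  finally show ?thesis .
qed

context covariate_sample
begin

lemma covariates_measurable: "covariates n X \<in> measurable M (\<Pi>\<^sub>M i\<in>{..<n}. borel)"
  unfolding covariates_def by (intro measurable_restrict term_measurable)

lemma covariate_measurable_sigma_covariates:
  assumes "i < n"
  shows "X i \<in> measurable (sigma_covariates M n X) borel"
proof -
  have "covariates n X \<in> measurable (sigma_covariates M n X) (\<Pi>\<^sub>M i\<in>{..<n}. borel)"
    unfolding sigma_covariates_def
    by (rule measurable_vimage_algebra1) (use measurable_space[OF covariates_measurable] in auto)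
  moreover have "(\<lambda>z. z i) \<in> measurable (\<Pi>\<^sub>M i\<in>{..<n}. borel) (borel :: 'x measure)"
    by (rule measurable_component_singleton) (use assms in simp)
  ultimately have "(\<lambda>\<omega>. covariates n X \<omega> i) \<in> measurable (sigma_covariates M n X) borel"
    by (rule measurable_compose)
  then show ?thesis using assms by (simp add: covariates_def)
qed

text \<open>
  Conditioning on the covariates replaces the indicator of \<open>W = w\<close> by the design probability of \<open>w\<close>
  almost surely, and \<open>optimal_design_truncated\<close> applies pointwise.
\<close>

lemma imbalance_expectation_le:
  fixes g :: "'x \<Rightarrow> real"
  assumes m: "2 \<le> m" and p: "1 \<le> p" and D: "D = PSOD F ip m p \<or> is_MSOD F ip m p D"
    and drawn: "drawn_from M (m * p) X W D"
    and W: "W \<in> measurable M (count_space ({..<m * p} \<rightarrow>\<^sub>E {..<m}))"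
    and g: "g \<in> borel_measurable borel"
    and f: "f \<in> F" and fg: "\<And>z. \<bar>f z - g z\<bar> \<le> \<eta>" and kl: "(k, l) \<in> treatment_pairs m" and R: "0 \<le> R"
  shows "expectation (\<lambda>\<omega>. min 1 ((imbalance m p (\<lambda>i. X i \<omega>) (W \<omega>) k l g)\<^sup>2)) \<le>
      2 * (ip f f + 1) * expectation (total_block_bound m p R) + 8 * \<eta>\<^sup>2"
proof -
  let ?\<Omega> = "{..<m * p} \<rightarrow>\<^sub>E {..<m}"
  define G where "G = sigma_covariates M (m * p) X"
  interpret G: finite_measure_subalgebra M G
    unfolding G_def sigma_covariates_def by (rule vimage_subalgebra[OF covariates_measurable])
  define B where "B = (\<lambda>w \<omega>. min 1 ((imbalance m p (\<lambda>i. X i \<omega>) w k l g)\<^sup>2))"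
  define Q where "Q = (\<lambda>w. cond_prob_given M G {\<omega> \<in> space M. W \<omega> = w})"
  have fin: "finite ?\<Omega>" by (intro finite_PiE) auto
  have sets_W[measurable]: "{\<omega> \<in> space M. W \<omega> = w} \<in> sets M" for w
  proof (cases "w \<in> ?\<Omega>")
    case True
    then have "W -` {w} \<inter> space M \<in> sets M" by (intro measurable_sets[OF W]) auto
    moreover have "W -` {w} \<inter> space M = {\<omega> \<in> space M. W \<omega> = w}" by auto
    ultimately show ?thesis by simp
  next
    case False
    then have empty: "{\<omega> \<in> space M. W \<omega> = w} = {}" using measurable_space[OF W] by auto
    show ?thesis unfolding empty by simp
  qed
  have BG[measurable]: "B w \<in> borel_measurable G" for w
  proof -
    have [measurable]: "(\<lambda>\<omega>. g (X i \<omega>)) \<in> borel_measurable G" if "i < m * p" for i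
      unfolding G_def by (rule measurable_compose[OF covariate_measurable_sigma_covariates[OF that] g])
    have "(\<lambda>\<omega>. imbalance m p (\<lambda>i. X i \<omega>) w k l g) \<in> borel_measurable G"
      unfolding imbalance_eq_sum
      by (intro borel_measurable_sum borel_measurable_times borel_measurable_const) simp
    then show ?thesis unfolding B_def by measurable
  qed
  have BM[measurable]: "B w \<in> borel_measurable M" for w
    by (rule measurable_from_subalg[OF G.subalg BG])
  have B01: "0 \<le> B w \<omega>" "B w \<omega> \<le> 1" for w \<omega> by (simp_all add: B_def)
  have int: "integrable M (\<lambda>\<omega>. B w \<omega> * indicator {\<omega> \<in> space M. W \<omega> = w} \<omega>)" for w
    by (rule integrable_const_bound[of _ 1]) (use B01 in \<open>auto simp: indicator_def\<close>)
  have intQ: "integrable M (\<lambda>\<omega>. B w \<omega> * Q w \<omega>)"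
    and expQ: "expectation (\<lambda>\<omega>. B w \<omega> * Q w \<omega>) = expectation (\<lambda>\<omega>. B w \<omega> * indicator {\<omega> \<in> space M. W \<omega> = w} \<omega>)" for w
    unfolding Q_def cond_prob_given_def using G.real_cond_exp_intg[OF int] by auto
  have "expectation (\<lambda>\<omega>. B (W \<omega>) \<omega>) = expectation (\<lambda>\<omega>. \<Sum>w\<in>?\<Omega>. B w \<omega> * indicator {\<omega> \<in> space M. W \<omega> = w} \<omega>)"
  proof (intro Bochner_Integration.integral_cong refl)
    fix \<omega> assume \<omega>: "\<omega> \<in> space M"
    then have "W \<omega> \<in> ?\<Omega>" using measurable_space[OF W] by auto
    moreover have "(\<Sum>w\<in>?\<Omega>. B w \<omega> * indicator {\<omega> \<in> space M. W \<omega> = w} \<omega>) = (\<Sum>w\<in>?\<Omega>. if W \<omega> = w then B w \<omega> else 0)"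
      using \<omega> by (intro sum.cong) (auto simp: indicator_def)
    ultimately show "B (W \<omega>) \<omega> = (\<Sum>w\<in>?\<Omega>. B w \<omega> * indicator {\<omega> \<in> space M. W \<omega> = w} \<omega>)"
      using fin by simp
  qed
  also have "\<dots> = (\<Sum>w\<in>?\<Omega>. expectation (\<lambda>\<omega>. B w \<omega> * Q w \<omega>))"
    unfolding expQ by (intro Bochner_Integration.integral_sum int)
  also have "\<dots> = expectation (\<lambda>\<omega>. \<Sum>w\<in>?\<Omega>. B w \<omega> * Q w \<omega>)"
    by (intro Bochner_Integration.integral_sum[symmetric] intQ)
  also have "\<dots> \<le> expectation (\<lambda>\<omega>. 2 * (ip f f + 1) * total_block_bound m p R \<omega> + 8 * \<eta>\<^sup>2)"
  proof (rule integral_mono_AE)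
    have "AE \<omega> in M. \<forall>w\<in>?\<Omega>. Q w \<omega> = pmf (D (covariates (m * p) X \<omega>)) w"
      using drawn fin unfolding drawn_from_def Q_def G_def by (intro AE_finite_allI) auto
    then show "AE \<omega> in M. (\<Sum>w\<in>?\<Omega>. B w \<omega> * Q w \<omega>) \<le> 2 * (ip f f + 1) * total_block_bound m p R \<omega> + 8 * \<eta>\<^sup>2"
    proof eventually_elim
      case (elim \<omega>)
      define x where "x = covariates (m * p) X \<omega>"
      have x: "x i = X i \<omega>" if "i < m * p" for i using that by (simp add: x_def covariates_def)
      have "B w \<omega> = min 1 ((imbalance m p x w k l g)\<^sup>2)" for w
        unfolding B_def imbalance_eq_sum using x by simp
      then have "(\<Sum>w\<in>?\<Omega>. B w \<omega> * Q w \<omega>) = (\<Sum>w\<in>?\<Omega>. pmf (D x) w * min 1 ((imbalance m p x w k l g)\<^sup>2))"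
        using elim by (simp add: x_def mult.commute)
      also have "\<dots> \<le> 2 * (ip f f + 1) *
          (\<Sum>(k, l)\<in>treatment_pairs m. block_bound F ip p R (\<lambda>j. x (m * j + k)) (\<lambda>j. x (m * j + l))) + 8 * \<eta>\<^sup>2"
        by (rule optimal_design_truncated[OF m p D f fg kl fin]) (auto simp: assignments_def)
      also have "(\<Sum>(k, l)\<in>treatment_pairs m. block_bound F ip p R (\<lambda>j. x (m * j + k)) (\<lambda>j. x (m * j + l)))
          = total_block_bound m p R \<omega>"
        unfolding total_block_bound_def
      proof (intro sum.cong refl, clarify)
        fix k l assume kl: "(k, l) \<in> treatment_pairs m"
        have idx: "m * j + a < m * p" if "j < p" "a < m" for j a
        proof -
          have "m * j + a < m * Suc j" using that by simp
          also have "\<dots> \<le> m * p" using that by (intro mult_le_mono2) auto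
          finally show ?thesis .
        qed
        show "block_bound F ip p R (\<lambda>j. x (m * j + k)) (\<lambda>j. x (m * j + l)) =
            block_bound F ip p R (\<lambda>j. X (m * j + k) \<omega>) (\<lambda>j. X (m * j + l) \<omega>)"
          using kl unfolding block_bound_eq by (simp add: x idx treatment_pairs_def)
      qed
      finally show ?case .
    qed
  qed (use intQ total_block_bound_integrable[OF p R, of m] in auto)
  also have "\<dots> = 2 * (ip f f + 1) * expectation (total_block_bound m p R) + 8 * \<eta>\<^sup>2"
    using total_block_bound_integrable[OF p R, of m] by (simp add: prob_space)
  finally show ?thesis unfolding B_def .
qed

end

section \<open>Convergence in probability\<close>

context prob_space
begin

lemma tendsto_zero_in_prob_add:
  assumes U: "tendsto_zero_in_prob M U" and V: "tendsto_zero_in_prob M V"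
    and meas: "\<And>p. 1 \<le> p \<Longrightarrow> U p \<in> borel_measurable M" "\<And>p. 1 \<le> p \<Longrightarrow> V p \<in> borel_measurable M"
    and Z: "\<And>p \<omega>. 1 \<le> p \<Longrightarrow> \<omega> \<in> space M \<Longrightarrow> \<bar>Z p \<omega>\<bar> \<le> \<bar>U p \<omega>\<bar> + \<bar>V p \<omega>\<bar>"
  shows "tendsto_zero_in_prob M Z"
  unfolding tendsto_zero_in_prob_def
proof (intro allI impI)
  fix e :: real assume e: "0 < e"
  have "(\<lambda>p. prob {\<omega> \<in> space M. \<bar>U p \<omega>\<bar> > e / 2} + prob {\<omega> \<in> space M. \<bar>V p \<omega>\<bar> > e / 2}) \<longlonglongrightarrow> 0 + 0"
    using U V half_gt_zero[OF e] unfolding tendsto_zero_in_prob_def by (intro tendsto_add) blast+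
  then have lim: "(\<lambda>p. prob {\<omega> \<in> space M. \<bar>U p \<omega>\<bar> > e / 2} + prob {\<omega> \<in> space M. \<bar>V p \<omega>\<bar> > e / 2}) \<longlonglongrightarrow> 0"
    by simp
  have "eventually (\<lambda>p. prob {\<omega> \<in> space M. \<bar>Z p \<omega>\<bar> > e} \<le>
      prob {\<omega> \<in> space M. \<bar>U p \<omega>\<bar> > e / 2} + prob {\<omega> \<in> space M. \<bar>V p \<omega>\<bar> > e / 2}) sequentially"
    using eventually_ge_at_top[of 1]
  proof eventually_elim
    case (elim p)
    note [measurable] = meas[OF elim]
    have "prob {\<omega> \<in> space M. \<bar>Z p \<omega>\<bar> > e} \<le>
        prob ({\<omega> \<in> space M. \<bar>U p \<omega>\<bar> > e / 2} \<union> {\<omega> \<in> space M. \<bar>V p \<omega>\<bar> > e / 2})"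
    proof (rule finite_measure_mono)
      show "{\<omega> \<in> space M. \<bar>Z p \<omega>\<bar> > e} \<subseteq> {\<omega> \<in> space M. \<bar>U p \<omega>\<bar> > e / 2} \<union> {\<omega> \<in> space M. \<bar>V p \<omega>\<bar> > e / 2}"
        using Z[OF elim] by fastforce
    qed measurable
    also have "\<dots> \<le> prob {\<omega> \<in> space M. \<bar>U p \<omega>\<bar> > e / 2} + prob {\<omega> \<in> space M. \<bar>V p \<omega>\<bar> > e / 2}"
      by (rule measure_Un_le) measurable
    finally show ?case .
  qed
  then show "(\<lambda>p. prob {\<omega> \<in> space M. \<bar>Z p \<omega>\<bar> > e}) \<longlonglongrightarrow> 0"
    by (intro tendsto_sandwich[OF _ _ tendsto_const lim]) auto
qed

lemma tendsto_zero_in_prob_sum: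
  assumes "finite I"
    and "\<And>i. i \<in> I \<Longrightarrow> tendsto_zero_in_prob M (U i)"
    and "\<And>i p. i \<in> I \<Longrightarrow> 1 \<le> p \<Longrightarrow> U i p \<in> borel_measurable M"
  shows "tendsto_zero_in_prob M (\<lambda>p \<omega>. \<Sum>i\<in>I. U i p \<omega>)"
  using assms
proof (induction I rule: finite_induct)
  case empty
  then show ?case by (simp add: tendsto_zero_in_prob_def)
next
  case (insert i I)
  show ?case
  proof (rule tendsto_zero_in_prob_add)
    show "tendsto_zero_in_prob M (U i)" using insert.prems by simp
    show "tendsto_zero_in_prob M (\<lambda>p \<omega>. \<Sum>i\<in>I. U i p \<omega>)" using insert by simp
    show "\<bar>\<Sum>i\<in>insert i I. U i p \<omega>\<bar> \<le> \<bar>U i p \<omega>\<bar> + \<bar>\<Sum>i\<in>I. U i p \<omega>\<bar>" for p \<omega>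
      using insert.hyps by simp
  qed (use insert.prems in auto)
qed

lemma tendsto_zero_in_prob_if_L2:
  assumes meas: "\<And>p. 1 \<le> p \<Longrightarrow> Z p \<in> borel_measurable M"
    and small: "\<And>e. 0 < e \<Longrightarrow> eventually (\<lambda>p. expectation (\<lambda>\<omega>. min 1 ((Z p \<omega>)\<^sup>2)) \<le> e) sequentially"
  shows "tendsto_zero_in_prob M Z"
  unfolding tendsto_zero_in_prob_def
proof (intro allI impI)
  fix \<epsilon> :: real assume \<epsilon>: "0 < \<epsilon>"
  define c where "c = min 1 (\<epsilon>\<^sup>2)"
  have c: "0 < c" using \<epsilon> by (simp add: c_def)
  show "(\<lambda>p. prob {\<omega> \<in> space M. \<bar>Z p \<omega>\<bar> > \<epsilon>}) \<longlonglongrightarrow> 0"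
  proof (rule order_tendstoI)
    fix a :: real assume a: "0 < a"
    have "eventually (\<lambda>p. expectation (\<lambda>\<omega>. min 1 ((Z p \<omega>)\<^sup>2)) \<le> a * c / 2) sequentially"
      using a c by (intro small) simp
    then show "eventually (\<lambda>p. prob {\<omega> \<in> space M. \<bar>Z p \<omega>\<bar> > \<epsilon>} < a) sequentially"
      using eventually_ge_at_top[of 1]
    proof eventually_elim
      case (elim p)
      note [measurable] = meas[OF elim(2)]
      have "prob {\<omega> \<in> space M. \<bar>Z p \<omega>\<bar> > \<epsilon>} \<le> prob {\<omega> \<in> space M. c \<le> min 1 ((Z p \<omega>)\<^sup>2)}"
      proof (rule finite_measure_mono)
        show "{\<omega> \<in> space M. \<bar>Z p \<omega>\<bar> > \<epsilon>} \<subseteq> {\<omega> \<in> space M. c \<le> min 1 ((Z p \<omega>)\<^sup>2)}"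
        proof safe
          fix \<omega> assume "\<epsilon> < \<bar>Z p \<omega>\<bar>"
          then have "\<epsilon>\<^sup>2 \<le> (Z p \<omega>)\<^sup>2" using \<epsilon> power_mono[of \<epsilon> "\<bar>Z p \<omega>\<bar>" 2] by simp
          then show "c \<le> min 1 ((Z p \<omega>)\<^sup>2)" unfolding c_def by (intro min.mono) auto
        qed
      qed measurable
      also have "\<dots> \<le> expectation (\<lambda>\<omega>. min 1 ((Z p \<omega>)\<^sup>2)) / c"
      proof (rule integral_Markov_inequality_measure[where A = "space M"])
        show "integrable M (\<lambda>\<omega>. min 1 ((Z p \<omega>)\<^sup>2))"
          by (rule integrable_const_bound[of _ 1]) auto
      qed (use c in auto)
      also have "\<dots> \<le> (a * c / 2) / c" using elim(1) c by (intro divide_right_mono) auto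
      also have "\<dots> < a" using a c by simp
      finally show ?case .
    qed
  qed (auto intro: always_eventually less_le_trans[OF _ measure_nonneg])
qed

lemma tendsto_zero_in_prob_approx:
  assumes approx: "\<And>\<delta>. 0 < \<delta> \<Longrightarrow> \<exists>U V. tendsto_zero_in_prob M U \<and>
      (\<forall>p\<ge>1. U p \<in> borel_measurable M \<and> integrable M (V p) \<and> expectation (\<lambda>\<omega>. \<bar>V p \<omega>\<bar>) \<le> \<delta> \<and>
         (\<forall>\<omega>\<in>space M. Z p \<omega> = U p \<omega> + V p \<omega>))"
  shows "tendsto_zero_in_prob M Z"
  unfolding tendsto_zero_in_prob_def
proof (intro allI impI)
  fix e :: real assume e: "0 < e"
  show "(\<lambda>p. prob {\<omega> \<in> space M. \<bar>Z p \<omega>\<bar> > e}) \<longlonglongrightarrow> 0"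
  proof (rule order_tendstoI)
    fix a :: real assume a: "0 < a"
    obtain U V where U: "tendsto_zero_in_prob M U"
      and UV: "\<And>p. 1 \<le> p \<Longrightarrow> U p \<in> borel_measurable M \<and> integrable M (V p) \<and>
        expectation (\<lambda>\<omega>. \<bar>V p \<omega>\<bar>) \<le> a * e / 4 \<and> (\<forall>\<omega>\<in>space M. Z p \<omega> = U p \<omega> + V p \<omega>)"
      using approx[of "a * e / 4"] a e by auto
    have "(\<lambda>p. prob {\<omega> \<in> space M. \<bar>U p \<omega>\<bar> > e / 2}) \<longlonglongrightarrow> 0"
      using U half_gt_zero[OF e] unfolding tendsto_zero_in_prob_def by blast
    then have "eventually (\<lambda>p. prob {\<omega> \<in> space M. \<bar>U p \<omega>\<bar> > e / 2} < a / 2) sequentially"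
      using a by (intro order_tendstoD(2)) auto
    then show "eventually (\<lambda>p. prob {\<omega> \<in> space M. \<bar>Z p \<omega>\<bar> > e} < a) sequentially"
      using eventually_ge_at_top[of 1]
    proof eventually_elim
      case (elim p)
      have [measurable]: "U p \<in> borel_measurable M" "V p \<in> borel_measurable M" and V: "integrable M (V p)"
        and Z: "\<And>\<omega>. \<omega> \<in> space M \<Longrightarrow> Z p \<omega> = U p \<omega> + V p \<omega>"
        using UV[OF elim(2)] by auto
      have "prob {\<omega> \<in> space M. \<bar>Z p \<omega>\<bar> > e} \<le>
          prob ({\<omega> \<in> space M. \<bar>U p \<omega>\<bar> > e / 2} \<union> {\<omega> \<in> space M. \<bar>V p \<omega>\<bar> \<ge> e / 2})"
      proof (rule finite_measure_mono)
        show "{\<omega> \<in> space M. \<bar>Z p \<omega>\<bar> > e} \<subseteq> {\<omega> \<in> space M. \<bar>U p \<omega>\<bar> > e / 2} \<union> {\<omega> \<in> space M. \<bar>V p \<omega>\<bar> \<ge> e / 2}"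
          by (auto simp: Z)
      qed measurable
      also have "\<dots> \<le> prob {\<omega> \<in> space M. \<bar>U p \<omega>\<bar> > e / 2} + prob {\<omega> \<in> space M. \<bar>V p \<omega>\<bar> \<ge> e / 2}"
        by (rule measure_Un_le) measurable
      also have "prob {\<omega> \<in> space M. \<bar>V p \<omega>\<bar> \<ge> e / 2} \<le> expectation (\<lambda>\<omega>. \<bar>V p \<omega>\<bar>) / (e / 2)"
        using V e by (intro integral_Markov_inequality_measure[where A = "space M"]) auto
      also have "\<dots> \<le> (a * e / 4) / (e / 2)"
        using UV[OF elim(2)] e by (intro divide_right_mono) auto
      also have "\<dots> = a / 2" using e by simp
      finally show ?case using elim(1) by simp
    qed
  qed (auto intro: always_eventually less_le_trans[OF _ measure_nonneg])
qed

end

text \<open>The weight of subject \<open>i\<close> in the mean of group \<open>k\<close> minus the overall mean.\<close>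

definition centred_weight :: "nat \<Rightarrow> nat \<Rightarrow> nat \<Rightarrow> (nat \<Rightarrow> nat) \<Rightarrow> nat \<Rightarrow> real" where
  "centred_weight m p k w i = ((if w i = k then 1 else 0) - 1 / real m) / real p"

lemma abs_centred_weight_le:
  assumes "0 < m"
  shows "\<bar>centred_weight m p k w i\<bar> \<le> 1 / real p"
proof -
  have "0 \<le> 1 / real m" "1 / real m \<le> 1" using assms by auto
  then have "\<bar>(if w i = k then 1 else 0) - 1 / real m\<bar> \<le> 1" by auto
  then show ?thesis unfolding centred_weight_def abs_divide by (simp add: divide_right_mono)
qed

lemma group_mean_minus_mean:
  "group_mean m p w k v - (1 / real (m * p)) * (\<Sum>i<m * p. v i) =
     (\<Sum>i<m * p. centred_weight m p k w i * v i)"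
  unfolding group_mean_eq_sum centred_weight_def sum_distrib_left sum_subtractf[symmetric]
  by (intro sum.cong) (simp_all add: diff_divide_distrib left_diff_distrib)

text \<open>The overall mean is the average of the \<open>m\<close> group means.\<close>

lemma centred_weight_sum_eq_imbalance:
  assumes w: "w \<in> {..<m * p} \<rightarrow>\<^sub>E {..<m}" and m: "0 < m"
  shows "(\<Sum>i<m * p. centred_weight m p k w i * f (x i)) = (\<Sum>l<m. 1 / real m * imbalance m p x w k l f)"
proof -
  have "(\<Sum>l<m. group_mean m p w l (\<lambda>i. f (x i))) = (\<Sum>i<m * p. \<Sum>l<m. (if w i = l then 1 else 0) / real p * f (x i))"
    unfolding group_mean_eq_sum by (rule sum.swap)
  also have "\<dots> = (\<Sum>i<m * p. 1 / real p * f (x i))"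
  proof (rule sum.cong[OF refl])
    fix i assume "i \<in> {..<m * p}"
    then have "w i < m" using w by auto
    then have "(\<Sum>l<m. if w i = l then 1 / real p * f (x i) else 0) = 1 / real p * f (x i)" by simp
    moreover have "(\<Sum>l<m. (if w i = l then 1 else 0) / real p * f (x i)) =
        (\<Sum>l<m. if w i = l then 1 / real p * f (x i) else 0)"
      by (intro sum.cong) auto
    ultimately show "(\<Sum>l<m. (if w i = l then 1 else 0) / real p * f (x i)) = 1 / real p * f (x i)" by simp
  qed
  also have "\<dots> = 1 / real p * (\<Sum>i<m * p. f (x i))" by (rule sum_distrib_left[symmetric])
  finally have total: "(\<Sum>l<m. group_mean m p w l (\<lambda>i. f (x i))) = 1 / real p * (\<Sum>i<m * p. f (x i))" .
  have "(\<Sum>l<m. 1 / real m * imbalance m p x w k l f) =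
      1 / real m * (real m * group_mean m p w k (\<lambda>i. f (x i)) - (\<Sum>l<m. group_mean m p w l (\<lambda>i. f (x i))))"
    by (simp add: imbalance_def sum_divide_distrib[symmetric] sum_subtractf)
  also have "\<dots> = group_mean m p w k (\<lambda>i. f (x i)) - (1 / real (m * p)) * (\<Sum>i<m * p. f (x i))"
    using m by (simp add: total right_diff_distrib)
  finally show ?thesis unfolding group_mean_minus_mean by simp
qed

text \<open>
  The last assumption treats both designs at once, because both satisfy the bound
  \<open>optimal_design_unit_ball\<close>.
\<close>

locale randomized_experiment =
  covariate_sample M X F ip +
  unit: iid_sequence M "borel \<Otimes>\<^sub>M (\<Pi>\<^sub>M k\<in>{..<m}. borel)" "\<lambda>i \<omega>. (X i \<omega>, \<lambda>k\<in>{..<m}. Y i k \<omega>)"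
  for M :: "'a measure" and X :: "nat \<Rightarrow> 'a \<Rightarrow> 'x::t2_space"
    and F :: "('x \<Rightarrow> real) set" and ip and m :: nat and Y :: "nat \<Rightarrow> nat \<Rightarrow> 'a \<Rightarrow> real" +
  fixes W :: "nat \<Rightarrow> 'a \<Rightarrow> nat \<Rightarrow> nat"
  assumes two_treatments: "2 \<le> m"
    and square_integrable: "\<And>i k. k < m \<Longrightarrow> integrable M (\<lambda>\<omega>. (Y i k \<omega>)\<^sup>2)"
    and locally_compact: "locally_compact_space (euclidean :: 'x topology)"
    and radon: "inner_regular (distr M borel (X 0))"
    and universal: "C0_universal F"
    and assignment_measurable:
      "\<And>p. 1 \<le> p \<Longrightarrow> W p \<in> measurable M (count_space ({..<m * p} \<rightarrow>\<^sub>E {..<m}))"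
    and assignment_cond_indep:
      "\<And>p. 1 \<le> p \<Longrightarrow> cond_indep M (sigma_covariates M (m * p) X)
           (count_space ({..<m * p} \<rightarrow>\<^sub>E {..<m})) (W p)
           (\<Pi>\<^sub>M ik\<in>{..<m * p} \<times> {..<m}. borel) (outcomes (m * p) m Y)"
    and assignment_optimal:
      "\<And>p. 1 \<le> p \<Longrightarrow> \<exists>D. (D = PSOD F ip m p \<or> is_MSOD F ip m p D) \<and> drawn_from M (m * p) X (W p) D"
begin

lemma finite_labelings: "finite ({..<m * p} \<rightarrow>\<^sub>E {..<m})"
  by (intro finite_PiE) auto

lemma assignment_compose:
  assumes "1 \<le> p" "\<And>w. \<Phi> w \<in> borel_measurable M"
  shows "(\<lambda>\<omega>. \<Phi> (W p \<omega>) \<omega> :: real) \<in> borel_measurable M"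
  by (rule measurable_compose_countable'[OF assms(2) assignment_measurable[OF assms(1)]])
    (rule countable_finite[OF finite_labelings])

lemma imbalance_measurable:
  assumes "1 \<le> p" "g \<in> borel_measurable borel"
  shows "(\<lambda>\<omega>. imbalance m p (\<lambda>i. X i \<omega>) (W p \<omega>) k l g) \<in> borel_measurable M"
proof (rule assignment_compose[OF assms(1), where \<Phi> = "\<lambda>w \<omega>. imbalance m p (\<lambda>i. X i \<omega>) w k l g"])
  fix w
  have [measurable]: "(\<lambda>\<omega>. g (X i \<omega>)) \<in> borel_measurable M" for i
    by (rule measurable_compose[OF term_measurable assms(2)])
  show "(\<lambda>\<omega>. imbalance m p (\<lambda>i. X i \<omega>) w k l g) \<in> borel_measurable M"
    unfolding imbalance_eq_sum by measurable
qed

lemma outcome_measurable: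
  assumes "k < m"
  shows "Y i k \<in> borel_measurable M"
proof -
  have "(\<lambda>\<omega>. snd (X i \<omega>, \<lambda>k\<in>{..<m}. Y i k \<omega>)) \<in> measurable M (\<Pi>\<^sub>M k\<in>{..<m}. borel)"
    by (rule measurable_compose[OF unit.term_measurable measurable_snd])
  moreover have "(\<lambda>z. z k) \<in> measurable (\<Pi>\<^sub>M k\<in>{..<m}. borel) (borel :: real measure)"
    by (rule measurable_component_singleton) (use assms in simp)
  ultimately have "(\<lambda>\<omega>. (snd (X i \<omega>, \<lambda>k\<in>{..<m}. Y i k \<omega>)) k) \<in> borel_measurable M"
    by (rule measurable_compose)
  then show ?thesis using assms by simp
qed

text \<open>
  Given \<open>e\<close>, the constants are chosen in the order \<open>\<eta>\<close>, \<open>f\<close>, \<open>R\<close>, \<open>p\<close>; the norm of the approximant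
  \<open>f\<close>, which grows as \<open>\<eta>\<close> shrinks, is fixed before the weak law is used.
\<close>

lemma imbalance_tendsto_zero:
  assumes g: "compactly_supported g" and k: "k < m" and l: "l < m"
  shows "tendsto_zero_in_prob M (\<lambda>p \<omega>. imbalance m p (\<lambda>i. X i \<omega>) (W p \<omega>) k l g)"
proof (cases "k = l")
  case True
  then show ?thesis by (simp add: imbalance_def tendsto_zero_in_prob_def)
next
  case False
  then have kl: "(k, l) \<in> treatment_pairs m" using k l by (simp add: treatment_pairs_def)
  show ?thesis
  proof (rule tendsto_zero_in_prob_if_L2)
    fix e :: real assume e: "0 < e"
    define \<eta> where "\<eta> = sqrt (e / 16)"
    have \<eta>: "0 < \<eta>" "8 * \<eta>\<^sup>2 = e / 2" using e by (simp_all add: \<eta>_def)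
    obtain f where f: "f \<in> F" "\<And>x. \<bar>f x - g x\<bar> \<le> \<eta>"
      using universal g \<eta>(1) unfolding C0_universal_def compactly_supported_def by blast
    define C where "C = 2 * (ip f f + 1)"
    have C: "0 < C" using ip_nonneg[OF f(1)] by (simp add: C_def)
    obtain R where R: "0 \<le> R"
      "eventually (\<lambda>p. expectation (total_block_bound m p R) \<le> e / (2 * C)) sequentially"
      using total_block_bound_small[of "e / (2 * C)" m] e C by auto
    show "eventually (\<lambda>p. expectation (\<lambda>\<omega>. min 1 ((imbalance m p (\<lambda>i. X i \<omega>) (W p \<omega>) k l g)\<^sup>2)) \<le> e) sequentially"
      using R(2) eventually_ge_at_top[of 1]
    proof eventually_elim
      case (elim p)
      obtain D where D: "D = PSOD F ip m p \<or> is_MSOD F ip m p D" "drawn_from M (m * p) X (W p) D"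
        using assignment_optimal[OF elim(2)] by blast
      have "expectation (\<lambda>\<omega>. min 1 ((imbalance m p (\<lambda>i. X i \<omega>) (W p \<omega>) k l g)\<^sup>2)) \<le>
          C * expectation (total_block_bound m p R) + 8 * \<eta>\<^sup>2"
        unfolding C_def
        by (rule imbalance_expectation_le[OF two_treatments elim(2) D assignment_measurable[OF elim(2)]
              compactly_supported_measurable[OF g] f kl R(1)])
      also have "\<dots> \<le> C * (e / (2 * C)) + e / 2"
        using elim(1) C unfolding \<eta>(2) by (intro add_right_mono mult_left_mono) auto
      also have "\<dots> = e" using C by simp
      finally show ?case .
    qed
  qed (rule imbalance_measurable[OF _ compactly_supported_measurable[OF g]])
qed

lemma residual_noise_tendsto_zero:
  assumes k: "k < m" and f: "f \<in> borel_measurable borel" and f2: "integrable M (\<lambda>\<omega>. (f (X 0 \<omega>))\<^sup>2)"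
    and centred: "\<And>A. A \<in> sets borel \<Longrightarrow> expectation (\<lambda>\<omega>. indicator A (X 0 \<omega>) * (Y 0 k \<omega> - f (X 0 \<omega>))) = 0"
  shows "tendsto_zero_in_prob M (\<lambda>p \<omega>. \<Sum>i<m * p. centred_weight m p k (W p \<omega>) i * (Y i k \<omega> - f (X i \<omega>)))"
    and "\<And>p. 1 \<le> p \<Longrightarrow> (\<lambda>\<omega>. \<Sum>i<m * p. centred_weight m p k (W p \<omega>) i * (Y i k \<omega> - f (X i \<omega>))) \<in> borel_measurable M"
proof -
  let ?N = "\<lambda>p \<omega>. \<Sum>i<m * p. centred_weight m p k (W p \<omega>) i * (Y i k \<omega> - f (X i \<omega>))"
  have fX[measurable]: "(\<lambda>\<omega>. f (X i \<omega>)) \<in> borel_measurable M" for i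
    by (rule measurable_compose[OF term_measurable f])
  note Y[measurable] = outcome_measurable[OF k]
  show meas: "?N p \<in> borel_measurable M" if "1 \<le> p" for p
    by (rule assignment_compose[OF that]) measurable
  define e where "e = (\<lambda>z :: 'x \<times> (nat \<Rightarrow> real). snd z k - f (fst z))"
  define v where "v = expectation (\<lambda>\<omega>. (e (X 0 \<omega>, \<lambda>k\<in>{..<m}. Y 0 k \<omega>))\<^sup>2)"
  have comp: "(\<lambda>z. z k) \<in> measurable (\<Pi>\<^sub>M k\<in>{..<m}. borel) (borel :: real measure)"
    by (rule measurable_component_singleton) (use k in simp)
  have e[measurable]: "e \<in> borel_measurable (borel \<Otimes>\<^sub>M (\<Pi>\<^sub>M k\<in>{..<m}. borel))"
    unfolding e_def
    by (intro borel_measurable_diff measurable_compose[OF measurable_snd comp] measurable_compose[OF measurable_fst f])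
  have eZ: "e (X i \<omega>, \<lambda>k\<in>{..<m}. Y i k \<omega>) = Y i k \<omega> - f (X i \<omega>)" for i \<omega>
    using k by (simp add: e_def)
  have e2: "integrable M (\<lambda>\<omega>. (e (X 0 \<omega>, \<lambda>k\<in>{..<m}. Y 0 k \<omega>))\<^sup>2)"
    unfolding eZ
  proof (rule Bochner_Integration.integrable_bound)
    show "integrable M (\<lambda>\<omega>. 2 * (Y 0 k \<omega>)\<^sup>2 + 2 * (f (X 0 \<omega>))\<^sup>2)"
      using square_integrable[OF k] f2 by simp
    show "AE \<omega> in M. norm ((Y 0 k \<omega> - f (X 0 \<omega>))\<^sup>2) \<le> norm (2 * (Y 0 k \<omega>)\<^sup>2 + 2 * (f (X 0 \<omega>))\<^sup>2)"
    proof (rule AE_I2)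
      fix \<omega>
      have "0 \<le> (Y 0 k \<omega> + f (X 0 \<omega>))\<^sup>2" by simp
      then have "(Y 0 k \<omega> - f (X 0 \<omega>))\<^sup>2 \<le> 2 * (Y 0 k \<omega>)\<^sup>2 + 2 * (f (X 0 \<omega>))\<^sup>2"
        by (simp add: power2_sum power2_diff)
      then show "norm ((Y 0 k \<omega> - f (X 0 \<omega>))\<^sup>2) \<le> norm (2 * (Y 0 k \<omega>)\<^sup>2 + 2 * (f (X 0 \<omega>))\<^sup>2)"
        by (simp only: real_norm_def abs_power2 order.trans[OF _ abs_ge_self])
    qed
  qed measurable
  have v: "0 \<le> v" unfolding v_def by (intro Bochner_Integration.integral_nonneg) simp
  have second_moment: "integrable M (\<lambda>\<omega>. (?N p \<omega>)\<^sup>2) \<and> expectation (\<lambda>\<omega>. (?N p \<omega>)\<^sup>2) \<le> real m * v / real p"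
    if p: "1 \<le> p" for p
  proof -
    let ?S = "\<Pi>\<^sub>M l\<in>{..<m * p}. (borel :: 'x measure)" and ?L = "\<Pi>\<^sub>M ik\<in>{..<m * p} \<times> {..<m}. (borel :: real measure)"
    have V: "outcomes (m * p) m Y \<in> measurable M ?L"
      unfolding outcomes_def split_beta' by (intro measurable_restrict outcome_measurable) auto
    define h where "h = (\<lambda>i (z :: (nat \<Rightarrow> 'x) \<times> (nat \<times> nat \<Rightarrow> real)). snd z (i, k) - f (fst z i))"
    have h: "h i \<in> borel_measurable (?S \<Otimes>\<^sub>M ?L)" if "i < m * p" for i
    proof -
      have "(\<lambda>y. y (i, k)) \<in> measurable ?L (borel :: real measure)"
        by (rule measurable_component_singleton) (use that k in simp)
      from measurable_compose[OF measurable_snd this]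
      have 1: "(\<lambda>z. snd z (i, k)) \<in> borel_measurable (?S \<Otimes>\<^sub>M ?L)" .
      have "(\<lambda>x. x i) \<in> measurable ?S (borel :: 'x measure)"
        by (rule measurable_component_singleton) (use that in simp)
      from measurable_compose[OF measurable_compose[OF measurable_fst this] f]
      have 2: "(\<lambda>z. f (fst z i)) \<in> borel_measurable (?S \<Otimes>\<^sub>M ?L)" .
      show ?thesis unfolding h_def using 1 2 by (rule borel_measurable_diff)
    qed
    have cov: "(\<lambda>\<omega>. \<lambda>l\<in>{..<m * p}. fst (X l \<omega>, \<lambda>k\<in>{..<m}. Y l k \<omega>)) = covariates (m * p) X"
      by (simp add: covariates_def fun_eq_iff)
    have eh: "e (X i \<omega>, \<lambda>k\<in>{..<m}. Y i k \<omega>) = h i (\<lambda>l\<in>{..<m * p}. fst (X l \<omega>, \<lambda>k\<in>{..<m}. Y l k \<omega>), outcomes (m * p) m Y \<omega>)"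
      if "i < m * p" for i \<omega>
      using that k by (simp add: eZ h_def outcomes_def)
    have centred': "expectation (\<lambda>\<omega>. indicator A (fst (X 0 \<omega>, \<lambda>k\<in>{..<m}. Y 0 k \<omega>)) * e (X 0 \<omega>, \<lambda>k\<in>{..<m}. Y 0 k \<omega>)) = 0"
      if "A \<in> sets borel" for A
      using centred[OF that] by (simp add: eZ)
    have m: "0 < m" using two_treatments by simp
    note moment = unit.weighted_residuals_second_moment[OF measurable_fst e e2 centred' V h eh
        assignment_measurable[OF p] finite_labelings
        assignment_cond_indep[OF p, unfolded sigma_covariates_def cov[symmetric]],
        where c = "centred_weight m p k" and b = "1 / real p"]
    have "integrable M (\<lambda>\<omega>. (\<Sum>i<m * p. centred_weight m p k (W p \<omega>) i * e (X i \<omega>, \<lambda>k\<in>{..<m}. Y i k \<omega>))\<^sup>2)"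
      by (rule moment(1)) (assumption | rule abs_centred_weight_le[OF m])+
    then have int: "integrable M (\<lambda>\<omega>. (?N p \<omega>)\<^sup>2)" by (simp only: eZ)
    have "expectation (\<lambda>\<omega>. (\<Sum>i<m * p. centred_weight m p k (W p \<omega>) i * e (X i \<omega>, \<lambda>k\<in>{..<m}. Y i k \<omega>))\<^sup>2)
        \<le> real (m * p) * (1 / real p)\<^sup>2 * v"
      unfolding v_def by (rule moment(2)) (assumption | rule abs_centred_weight_le[OF m])+
    then have "expectation (\<lambda>\<omega>. (?N p \<omega>)\<^sup>2) \<le> real (m * p) * (1 / real p)\<^sup>2 * v" by (simp only: eZ)
    also have "\<dots> = real m * v / real p" using p by (simp add: power2_eq_square)
    finally show ?thesis using int by blast
  qed
  show "tendsto_zero_in_prob M ?N"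
  proof (rule tendsto_zero_in_prob_if_L2[OF meas])
    fix \<delta> :: real assume \<delta>: "0 < \<delta>"
    have "(\<lambda>p. real m * v * inverse (real p)) \<longlonglongrightarrow> real m * v * 0"
      by (intro tendsto_mult tendsto_const lim_inverse_n)
    then have "eventually (\<lambda>p. real m * v * inverse (real p) < \<delta>) sequentially"
      using \<delta> by (intro order_tendstoD(2)) auto
    then show "eventually (\<lambda>p. expectation (\<lambda>\<omega>. min 1 ((?N p \<omega>)\<^sup>2)) \<le> \<delta>) sequentially"
      using eventually_ge_at_top[of 1]
    proof eventually_elim
      case (elim p)
      note [measurable] = meas[OF elim(2)]
      have "expectation (\<lambda>\<omega>. min 1 ((?N p \<omega>)\<^sup>2)) \<le> expectation (\<lambda>\<omega>. (?N p \<omega>)\<^sup>2)"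
      proof (rule integral_mono)
        show "integrable M (\<lambda>\<omega>. min 1 ((?N p \<omega>)\<^sup>2))"
          by (rule integrable_const_bound[of _ 1]) auto
      qed (use second_moment[OF elim(2)] in auto)
      also have "\<dots> \<le> real m * v / real p" using second_moment[OF elim(2)] by blast
      also have "\<dots> \<le> \<delta>" using elim(1) by (simp add: divide_inverse)
      finally show ?case .
    qed
  qed
qed

text \<open>
  The decomposition \<open>Y = g X + (f X - g X) + (Y - f X)\<close> into imbalance, approximation error and
  noise.
\<close>

lemma treatment_mean_error_tendsto_zero:
  assumes k: "k < m"
  shows "tendsto_zero_in_prob M (\<lambda>p \<omega>. \<Sum>i<m * p. centred_weight m p k (W p \<omega>) i * Y i k \<omega>)"
proof (rule tendsto_zero_in_prob_approx)
  fix \<delta> :: real assume \<delta>: "0 < \<delta>"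
  have m: "0 < m" using two_treatments by simp
  obtain f where f: "f \<in> borel_measurable borel" "integrable M (\<lambda>\<omega>. (f (X 0 \<omega>))\<^sup>2)"
    "\<And>A. A \<in> sets borel \<Longrightarrow> expectation (\<lambda>\<omega>. indicator A (X 0 \<omega>) * (Y 0 k \<omega> - f (X 0 \<omega>))) = 0"
    using regression_function[OF term_measurable[of 0] outcome_measurable[OF k] square_integrable[OF k]] by blast
  have fX[measurable]: "(\<lambda>\<omega>. f (X i \<omega>)) \<in> borel_measurable M" for i
    by (rule measurable_compose[OF term_measurable f(1)])
  define P where "P = distr M borel (X 0)"
  have finP: "finite_measure P" unfolding P_def
    by (rule prob_space.finite_measure[OF prob_space_distr[OF term_measurable]])
  have setsP: "sets P = sets borel" by (simp add: P_def)
  have fP: "integrable P f"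
    unfolding P_def integrable_distr_eq[OF term_measurable f(1)]
    by (rule square_integrable_imp_integrable[OF fX f(2)])
  obtain g where g: "compactly_supported g" "(\<integral>x. \<bar>f x - g x\<bar> \<partial>P) \<le> \<delta> / real m"
    using compactly_supported_dense_L1[OF finP setsP radon[folded P_def] locally_compact fP, of "\<delta> / real m"] \<delta> m
    by auto
  have gX[measurable]: "(\<lambda>\<omega>. g (X i \<omega>)) \<in> borel_measurable M" for i
    by (rule measurable_compose[OF term_measurable compactly_supported_measurable[OF g(1)]])
  have fg: "integrable M (\<lambda>\<omega>. \<bar>f (X i \<omega>) - g (X i \<omega>)\<bar>)"
    and fg_small: "expectation (\<lambda>\<omega>. \<bar>f (X i \<omega>) - g (X i \<omega>)\<bar>) \<le> \<delta> / real m" for i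
  proof -
    have d: "(\<lambda>x. \<bar>f x - g x\<bar>) \<in> borel_measurable borel"
      using f(1) compactly_supported_measurable[OF g(1)] by measurable
    have P: "P = distr M borel (X i)" unfolding P_def by (rule identical[symmetric])
    have "integrable P (\<lambda>x. \<bar>f x - g x\<bar>)"
      using fP compactly_supported_integrable[OF finP setsP g(1)] by auto
    then show "integrable M (\<lambda>\<omega>. \<bar>f (X i \<omega>) - g (X i \<omega>)\<bar>)"
      unfolding P integrable_distr_eq[OF term_measurable d] .
    show "expectation (\<lambda>\<omega>. \<bar>f (X i \<omega>) - g (X i \<omega>)\<bar>) \<le> \<delta> / real m"
      using g(2) unfolding P integral_distr[OF term_measurable d] .
  qed
  define c where "c = (\<lambda>p \<omega> i. centred_weight m p k (W p \<omega>) i)"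
  define B where "B = (\<lambda>p \<omega>. \<Sum>l<m. 1 / real m * imbalance m p (\<lambda>i. X i \<omega>) (W p \<omega>) k l g)"
  define N where "N = (\<lambda>p \<omega>. \<Sum>i<m * p. c p \<omega> i * (Y i k \<omega> - f (X i \<omega>)))"
  define V where "V = (\<lambda>p \<omega>. \<Sum>i<m * p. c p \<omega> i * (f (X i \<omega>) - g (X i \<omega>)))"
  note noise = residual_noise_tendsto_zero[OF k f]
  have imb_meas: "(\<lambda>\<omega>. imbalance m p (\<lambda>i. X i \<omega>) (W p \<omega>) k l g) \<in> borel_measurable M" if "1 \<le> p" for p l
    by (rule imbalance_measurable[OF that compactly_supported_measurable[OF g(1)]])
  have B: "B p \<in> borel_measurable M" if "1 \<le> p" for p
    unfolding B_def using imb_meas[OF that] by measurable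
  have N: "N p \<in> borel_measurable M" if "1 \<le> p" for p
    unfolding N_def c_def by (rule noise(2)) (use that in simp_all)
  have "tendsto_zero_in_prob M B"
    unfolding B_def
  proof (rule tendsto_zero_in_prob_sum)
    fix l assume "l \<in> {..<m}"
    then have "tendsto_zero_in_prob M (\<lambda>p \<omega>. imbalance m p (\<lambda>i. X i \<omega>) (W p \<omega>) k l g)"
      using imbalance_tendsto_zero[OF g(1) k] by simp
    then show "tendsto_zero_in_prob M (\<lambda>p \<omega>. 1 / real m * imbalance m p (\<lambda>i. X i \<omega>) (W p \<omega>) k l g)"
    proof (rule tendsto_zero_in_prob_add[where V = "\<lambda>_ _. 0"])
      show "tendsto_zero_in_prob M (\<lambda>_ _. 0)" by (simp add: tendsto_zero_in_prob_def)
      show "\<bar>1 / real m * imbalance m p (\<lambda>i. X i \<omega>) (W p \<omega>) k l g\<bar> \<le>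
          \<bar>imbalance m p (\<lambda>i. X i \<omega>) (W p \<omega>) k l g\<bar> + \<bar>0\<bar>" for p \<omega>
        using mult_left_le_one_le[of "\<bar>imbalance m p (\<lambda>i. X i \<omega>) (W p \<omega>) k l g\<bar>" "1 / real m"] m
        by (simp add: abs_mult)
    qed (use imb_meas in auto)
  qed (use imb_meas in auto)
  then have U: "tendsto_zero_in_prob M (\<lambda>p \<omega>. B p \<omega> + N p \<omega>)"
  proof (rule tendsto_zero_in_prob_add)
    show "tendsto_zero_in_prob M N" unfolding N_def c_def by (rule noise(1))
  qed (use B N in auto)
  have V: "integrable M (V p) \<and> expectation (\<lambda>\<omega>. \<bar>V p \<omega>\<bar>) \<le> \<delta>" if p: "1 \<le> p" for p
  proof -
    have meas: "V p \<in> borel_measurable M"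
      unfolding V_def c_def by (rule assignment_compose[OF p]) measurable
    have le: "\<bar>V p \<omega>\<bar> \<le> (\<Sum>i<m * p. 1 / real p * \<bar>f (X i \<omega>) - g (X i \<omega>)\<bar>)" for \<omega>
      unfolding V_def
    proof (intro order.trans[OF sum_abs] sum_mono)
      fix i
      show "\<bar>c p \<omega> i * (f (X i \<omega>) - g (X i \<omega>))\<bar> \<le> 1 / real p * \<bar>f (X i \<omega>) - g (X i \<omega>)\<bar>"
        unfolding abs_mult c_def by (intro mult_right_mono abs_centred_weight_le m) simp
    qed
    have int: "integrable M (\<lambda>\<omega>. \<Sum>i<m * p. 1 / real p * \<bar>f (X i \<omega>) - g (X i \<omega>)\<bar>)"
      using fg by (intro Bochner_Integration.integrable_sum integrable_mult_right) auto
    have intV: "integrable M (V p)"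
    proof (rule Bochner_Integration.integrable_bound[OF int meas])
      show "AE \<omega> in M. norm (V p \<omega>) \<le> norm (\<Sum>i<m * p. 1 / real p * \<bar>f (X i \<omega>) - g (X i \<omega>)\<bar>)"
        using le by (intro AE_I2) (metis abs_of_nonneg abs_ge_zero order.trans real_norm_def)
    qed
    have "expectation (\<lambda>\<omega>. \<bar>V p \<omega>\<bar>) \<le> expectation (\<lambda>\<omega>. \<Sum>i<m * p. 1 / real p * \<bar>f (X i \<omega>) - g (X i \<omega>)\<bar>)"
      using intV int le by (intro integral_mono) auto
    also have "\<dots> = (\<Sum>i<m * p. 1 / real p * expectation (\<lambda>\<omega>. \<bar>f (X i \<omega>) - g (X i \<omega>)\<bar>))"
      using fg by (subst Bochner_Integration.integral_sum) auto
    also have "\<dots> \<le> (\<Sum>i<m * p. 1 / real p * (\<delta> / real m))"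
      using fg_small by (intro sum_mono mult_left_mono) auto
    also have "\<dots> = \<delta>" using p m by simp
    finally show ?thesis using intV by blast
  qed
  have split: "(\<Sum>i<m * p. centred_weight m p k (W p \<omega>) i * Y i k \<omega>) = B p \<omega> + N p \<omega> + V p \<omega>"
    if p: "1 \<le> p" and \<omega>: "\<omega> \<in> space M" for p \<omega>
  proof -
    have "W p \<omega> \<in> {..<m * p} \<rightarrow>\<^sub>E {..<m}" using measurable_space[OF assignment_measurable[OF p] \<omega>] by simp
    then have "B p \<omega> = (\<Sum>i<m * p. c p \<omega> i * g (X i \<omega>))"
      unfolding B_def c_def by (rule centred_weight_sum_eq_imbalance[OF _ m, symmetric])
    then have "B p \<omega> + N p \<omega> + V p \<omega> =
        (\<Sum>i<m * p. c p \<omega> i * g (X i \<omega>) + c p \<omega> i * (Y i k \<omega> - f (X i \<omega>)) + c p \<omega> i * (f (X i \<omega>) - g (X i \<omega>)))"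
      by (simp only: N_def V_def sum.distrib)
    also have "\<dots> = (\<Sum>i<m * p. c p \<omega> i * Y i k \<omega>)"
      by (intro sum.cong refl) (simp add: algebra_simps)
    finally show ?thesis by (simp add: c_def)
  qed
  show "\<exists>U V. tendsto_zero_in_prob M U \<and>
      (\<forall>p\<ge>1. U p \<in> borel_measurable M \<and> integrable M (V p) \<and> expectation (\<lambda>\<omega>. \<bar>V p \<omega>\<bar>) \<le> \<delta> \<and>
         (\<forall>\<omega>\<in>space M. (\<Sum>i<m * p. centred_weight m p k (W p \<omega>) i * Y i k \<omega>) = U p \<omega> + V p \<omega>))"
    using U V split B N
    by (intro exI[of _ "\<lambda>p \<omega>. B p \<omega> + N p \<omega>"] exI[of _ V]) auto
qed

lemma estimator_consistent:
  assumes k: "k < m" and k': "k' < m"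
  shows "tendsto_zero_in_prob M (\<lambda>p \<omega>.
    tau_hat m p (W p \<omega>) (\<lambda>i j. Y i j \<omega>) k k' - SATE (m * p) (\<lambda>i j. Y i j \<omega>) k k')"
proof (rule tendsto_zero_in_prob_add[OF treatment_mean_error_tendsto_zero[OF k]
      treatment_mean_error_tendsto_zero[OF k']])
  have meas: "(\<lambda>\<omega>. \<Sum>i<m * p. centred_weight m p k (W p \<omega>) i * Y i k \<omega>) \<in> borel_measurable M"
    if "1 \<le> p" "k < m" for p k
  proof -
    note [measurable] = outcome_measurable[OF that(2)]
    show ?thesis by (rule assignment_compose[OF that(1)]) measurable
  qed
  show "(\<lambda>\<omega>. \<Sum>i<m * p. centred_weight m p k (W p \<omega>) i * Y i k \<omega>) \<in> borel_measurable M" if "1 \<le> p" for p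
    by (rule meas[OF that k])
  show "(\<lambda>\<omega>. \<Sum>i<m * p. centred_weight m p k' (W p \<omega>) i * Y i k' \<omega>) \<in> borel_measurable M" if "1 \<le> p" for p
    by (rule meas[OF that k'])
  fix p \<omega>
  have "tau_hat m p (W p \<omega>) (\<lambda>i j. Y i j \<omega>) k k' - SATE (m * p) (\<lambda>i j. Y i j \<omega>) k k' =
      (\<Sum>i<m * p. centred_weight m p k (W p \<omega>) i * Y i k \<omega>)
      - (\<Sum>i<m * p. centred_weight m p k' (W p \<omega>) i * Y i k' \<omega>)"
    unfolding group_mean_minus_mean[symmetric] tau_hat_def SATE_def by simp
  then show "\<bar>tau_hat m p (W p \<omega>) (\<lambda>i j. Y i j \<omega>) k k' - SATE (m * p) (\<lambda>i j. Y i j \<omega>) k k'\<bar> \<le>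
      \<bar>\<Sum>i<m * p. centred_weight m p k (W p \<omega>) i * Y i k \<omega>\<bar>
      + \<bar>\<Sum>i<m * p. centred_weight m p k' (W p \<omega>) i * Y i k' \<omega>\<bar>"
    by simp
qed

end

theorem theorem13:
  fixes M :: "'a measure"
    and m :: nat
    and X :: "nat \<Rightarrow> 'a \<Rightarrow> 'x::t2_space"
    and Y :: "nat \<Rightarrow> nat \<Rightarrow> 'a \<Rightarrow> real"
    and W :: "nat \<Rightarrow> 'a \<Rightarrow> nat \<Rightarrow> nat"
    and F :: "('x \<Rightarrow> real) set"
    and ip :: "('x \<Rightarrow> real) \<Rightarrow> ('x \<Rightarrow> real) \<Rightarrow> real"
  assumes prob: "prob_space M"
    and m_ge_2: "m \<ge> 2"
    and indep: "prob_space.indep_vars M (\<lambda>_. borel \<Otimes>\<^sub>M (\<Pi>\<^sub>M k\<in>{..<m}. borel))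
                  (\<lambda>i \<omega>. (X i \<omega>, \<lambda>k\<in>{..<m}. Y i k \<omega>)) UNIV"
    and ident: "\<And>i. distr M (borel \<Otimes>\<^sub>M (\<Pi>\<^sub>M k\<in>{..<m}. borel))
                       (\<lambda>\<omega>. (X i \<omega>, \<lambda>k\<in>{..<m}. Y i k \<omega>)) =
                     distr M (borel \<Otimes>\<^sub>M (\<Pi>\<^sub>M k\<in>{..<m}. borel))
                       (\<lambda>\<omega>. (X 0 \<omega>, \<lambda>k\<in>{..<m}. Y 0 k \<omega>))"
    and second_moment: "\<And>i k. k < m \<Longrightarrow> integrable M (\<lambda>\<omega>. (Y i k \<omega>)\<^sup>2)"
    and locally_compact: "locally_compact_space (euclidean :: 'x topology)"
    and radon: "inner_regular (distr M borel (X 0))"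
    and rkhs: "rkhs F ip"
    and universal: "C0_universal F"
    and diff_measurable:
      "(\<lambda>(x, x'). SUP f\<in>unit_ball F ip. f x - f x') \<in> borel_measurable (borel \<Otimes>\<^sub>M borel)"
    and diff_integrable:
      "integrable M (\<lambda>\<omega>. SUP f\<in>unit_ball F ip. f (X 0 \<omega>) - f (X 1 \<omega>))"
    and W_measurable:
      "\<And>p. p \<ge> 1 \<Longrightarrow> W p \<in> measurable M (count_space ({..<m * p} \<rightarrow>\<^sub>E {..<m}))"
    and W_cond_indep:
      "\<And>p. p \<ge> 1 \<Longrightarrow>
         cond_indep M (sigma_covariates M (m * p) X)
           (count_space ({..<m * p} \<rightarrow>\<^sub>E {..<m})) (W p)
           (\<Pi>\<^sub>M ik\<in>{..<m * p} \<times> {..<m}. borel) (outcomes (m * p) m Y)"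
    and W_design:
      "(\<forall>p\<ge>1. drawn_from M (m * p) X (W p) (PSOD F ip m p)) \<or>
       (\<forall>p\<ge>1. \<exists>D. is_MSOD F ip m p D \<and> drawn_from M (m * p) X (W p) D)"
  shows "\<forall>k<m. \<forall>k'<m. k \<noteq> k' \<longrightarrow>
           tendsto_zero_in_prob M (\<lambda>p \<omega>.
             tau_hat m p (W p \<omega>) (\<lambda>i j. Y i j \<omega>) k k' - SATE (m * p) (\<lambda>i j. Y i j \<omega>) k k')"
proof -
  interpret prob_space M by (rule prob)
  interpret rkhs F ip by (rule rkhs)
  interpret unit: iid_sequence M "borel \<Otimes>\<^sub>M (\<Pi>\<^sub>M k\<in>{..<m}. borel)" "\<lambda>i \<omega>. (X i \<omega>, \<lambda>k\<in>{..<m}. Y i k \<omega>)"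
    by unfold_locales (fact indep, fact ident)
  have X_law: "distr M borel (X i) = distr (distr M (borel \<Otimes>\<^sub>M (\<Pi>\<^sub>M k\<in>{..<m}. borel))
      (\<lambda>\<omega>. (X i \<omega>, \<lambda>k\<in>{..<m}. Y i k \<omega>))) borel fst" for i
    by (subst distr_distr[OF measurable_fst unit.term_measurable]) (simp add: comp_def)
  interpret randomized_experiment M X F ip m Y W
  proof unfold_locales
    show "indep_vars (\<lambda>_. borel) X UNIV"
      using indep_vars_compose2[OF indep, of "\<lambda>_. fst" "\<lambda>_. borel"] by simp
    show "distr M borel (X i) = distr M borel (X 0)" for i
      unfolding X_law ident[of i] ..
    show "case_prod (discrepancy F ip) \<in> borel_measurable (borel \<Otimes>\<^sub>M borel)"
    proof -
      have "case_prod (discrepancy F ip) = (\<lambda>(x, x'). SUP f\<in>unit_ball F ip. f x - f x')"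
        by (simp add: discrepancy_def fun_eq_iff)
      then show ?thesis using diff_measurable by simp
    qed
    show "integrable M (\<lambda>\<omega>. discrepancy F ip (X 0 \<omega>) (X 1 \<omega>))"
      using diff_integrable by (simp add: discrepancy_def)
    show "\<exists>D. (D = PSOD F ip m p \<or> is_MSOD F ip m p D) \<and> drawn_from M (m * p) X (W p) D" if "1 \<le> p" for p
      using W_design that by blast
  qed (fact m_ge_2 second_moment locally_compact radon universal W_measurable W_cond_indep)+
  show ?thesis using estimator_consistent by blast
qed

end
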